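(* Let $k$ be a field and let $\mathcal{H}$ be a $d$-uniform properly-connected hypergraph that is also triangulated. Then the following are equivalent: (a) $\mathcal{I}(\mathcal{H})$ has a linear resolution; (b) $\mathcal{I}(\mathcal{H})$ has linear first syzygies; (c) $\operatorname{diam}(\mathcal{H})\le d$.
   Context: A simple hypergraph $\mathcal{H}=(\mathcal{X},\mathcal{E})$ consists of a finite set $\mathcal{X}=\{x_1,\dots,x_n\}$ of vertices and a family $\mathcal{E}$ of distinct subsets (edges) with $|E|\ge 2$ for all edges and no edge contained in a different edge; all hypergraphs are simple. Let $R=k[x_1,\dots,x_n]$, $x^E=\prod_{x\in E}x$, and $\mathcal{I}(\mathcal{H})=(x^E: E\in\mathcal{E})\subseteq R$ (edge ideal), with graded Betti numbers $\beta_{i,j}$ over $R$. For $d$-uniform $\mathcal{H}$, $\mathcal{I}(\mathcal{H})$ has linear first syzygies if $\beta_{1,j}(\mathcal{I}(\mathcal{H}))=0$ for all $j\ne d+1$, and has a linear resolution if $\beta_{i,j}(\mathcal{I}(\mathcal{H}))=0$ for all $i$ and all $j\neq i+d$. $\mathcal{H}$ is $d$-uniform if all edges have cardinality $d$. A chain of length $n$ is a sequence $(E_0,x_1,E_1,\dots,x_n,E_n)$ with $x_1,\dots,x_n$ distinct vertices, $E_0,\dots,E_n$ distinct edges, $x_1\in E_0$, $x_n\in E_n$, and $x_k,x_{k+1}\in E_k$ for $1\le k\le n-1$. In a $d$-uniform hypergraph it is proper if $|E_i\cap E_{i+1}|=d-1$ for all $i$, and a proper chain is irredundant if no proper subsequence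 is a proper chain from $E_0$ to $E_n$. $\operatorname{dist}_{\mathcal{H}}(E,E')$ is the minimum length of a proper irredundant chain from $E$ to $E'$ ($\infty$ if none exists). A $d$-uniform hypergraph is properly-connected if $\operatorname{dist}_{\mathcal{H}}(E,E')=d-|E\cap E'|$ for all edges $E,E'$ with $E\cap E'\neq\emptyset$. The edge diameter is $\operatorname{diam}(\mathcal{H})=\max\{\operatorname{dist}_{\mathcal{H}}(E,H): E,H\in\mathcal{E}\}$ (infinite if two edges are not connected by a proper chain); so $\operatorname{diam}(\mathcal{H})\le d$ means $\operatorname{dist}_{\mathcal{H}}(E,H)\le d$ for all edges $E,H$. For $\mathcal{Y}\subseteq\mathcal{X}$, the induced hypergraph $\mathcal{H}_{\mathcal{Y}}$ has vertex set $\mathcal{Y}$ and edges $\{E\in\mathcal{E}: E\subseteq\mathcal{Y}\}$. Two distinct vertices are neighbors if some edge contains both; $N(x)$ is the set of neighbors of $x$. The $d$-complete hypergraph of order $m$ has $m$ vertices and all $d$-subsets as edges ($m$ isolated vertices if $m<d$). A $d$-uniform properly-connected hypergraph is triangulated if for every nonempty $\mathcal{Y}\subseteq\mathcal{X}$ there is a vertex $x\in\mathcal{Y}$ such that the induced hypergraph of $\mathcal{H}_{\mathcal{Y}}$ on $N(x)\cup\{x\}$ (with $N(x)$ computed in $\mathcal{H}_{\mathcal{Y}}$) is the $d$-complete hypergraph of order $|N(x)|+1$. *)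

theory Defs
  imports Complex_Main "HOL-Library.Poly_Mapping" "HOL-Library.Sublist" "HOL-Library.Extended_Nat"
begin

section \<open>Hypergraphs\<close>

type_synonym 'v hypergraph = "'v set \<times> 'v set set"

abbreviation verts :: "'v hypergraph \<Rightarrow> 'v set" where "verts \<equiv> fst"
abbreviation edges :: "'v hypergraph \<Rightarrow> 'v set set" where "edges \<equiv> snd"

definition simple_hypergraph :: "'v hypergraph \<Rightarrow> bool" where
  "simple_hypergraph H \<longleftrightarrow>
     finite (verts H) \<and>
     (\<forall>E\<in>edges H. E \<subseteq> verts H \<and> card E \<ge> 2) \<and>
     (\<forall>E\<in>edges H. \<forall>E'\<in>edges H. E \<subseteq> E' \<longrightarrow> E = E')"

definition uniform :: "nat \<Rightarrow> 'v hypergraph \<Rightarrow> bool" where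
  "uniform d H \<longleftrightarrow> (\<forall>E\<in>edges H. card E = d)"

text \<open>A chain \<open>(E\<^sub>0, x\<^sub>1, E\<^sub>1, \<dots>, x\<^sub>n, E\<^sub>n)\<close> is given by the lists \<open>[E\<^sub>0, \<dots>, E\<^sub>n]\<close> and
  \<open>[x\<^sub>1, \<dots>, x\<^sub>n]\<close>; thus \<open>xs ! i\<close> is \<open>x\<^bsub>i+1\<^esub>\<close>, which has to lie in \<open>E\<^sub>i\<close> and in \<open>E\<^bsub>i+1\<^esub>\<close>.
  The chain \<open>(E\<^sub>0)\<close> of length 0 is allowed.\<close>

definition chain :: "'v hypergraph \<Rightarrow> 'v set list \<Rightarrow> 'v list \<Rightarrow> bool" where
  "chain H Es xs \<longleftrightarrow>
     length Es = length xs + 1 \<and> set Es \<subseteq> edges H \<and> set xs \<subseteq> verts H \<and>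
     distinct Es \<and> distinct xs \<and>
     (\<forall>i<length xs. xs ! i \<in> Es ! i \<and> xs ! i \<in> Es ! (i + 1))"

definition proper_chain :: "nat \<Rightarrow> 'v hypergraph \<Rightarrow> 'v set list \<Rightarrow> 'v list \<Rightarrow> bool" where
  "proper_chain d H Es xs \<longleftrightarrow>
     chain H Es xs \<and> (\<forall>i<length xs. card (Es ! i \<inter> Es ! (i + 1)) = d - 1)"

text \<open>The chain as one alternating sequence of edges and vertices.\<close>

fun interleave :: "'v set list \<Rightarrow> 'v list \<Rightarrow> ('v set + 'v) list" where
  "interleave (E # Es) (x # xs) = Inl E # Inr x # interleave Es xs"
| "interleave Es [] = map Inl Es"
| "interleave [] xs = map Inr xs"

definition irredundant_chain :: "nat \<Rightarrow> 'v hypergraph \<Rightarrow> 'v set list \<Rightarrow> 'v list \<Rightarrow> bool" where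
  "irredundant_chain d H Es xs \<longleftrightarrow>
     proper_chain d H Es xs \<and>
     \<not> (\<exists>Fs ys. proper_chain d H Fs ys \<and> hd Fs = hd Es \<and> last Fs = last Es \<and>
              strict_subseq (interleave Fs ys) (interleave Es xs))"

text \<open>The infimum of the empty set is \<open>\<infinity>\<close>.\<close>

definition edge_dist :: "nat \<Rightarrow> 'v hypergraph \<Rightarrow> 'v set \<Rightarrow> 'v set \<Rightarrow> enat" where
  "edge_dist d H E E' =
     Inf {enat (length xs) | Es xs. irredundant_chain d H Es xs \<and> hd Es = E \<and> last Es = E'}"

definition edge_diam :: "nat \<Rightarrow> 'v hypergraph \<Rightarrow> enat" where
  "edge_diam d H = (SUP (E, E')\<in>edges H \<times> edges H. edge_dist d H E E')"

definition properly_connected :: "nat \<Rightarrow> 'v hypergraph \<Rightarrow> bool" where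
  "properly_connected d H \<longleftrightarrow>
     (\<forall>E\<in>edges H. \<forall>E'\<in>edges H. E \<inter> E' \<noteq> {} \<longrightarrow> edge_dist d H E E' = enat (d - card (E \<inter> E')))"

definition induced :: "'v hypergraph \<Rightarrow> 'v set \<Rightarrow> 'v hypergraph" where
  "induced H Y = (Y, {E \<in> edges H. E \<subseteq> Y})"

definition neighbors :: "'v hypergraph \<Rightarrow> 'v \<Rightarrow> 'v set" where
  "neighbors H x = {y. y \<noteq> x \<and> (\<exists>E\<in>edges H. x \<in> E \<and> y \<in> E)}"

definition complete_hypergraph :: "nat \<Rightarrow> nat \<Rightarrow> 'v hypergraph \<Rightarrow> bool" where
  "complete_hypergraph d m H \<longleftrightarrow>
     finite (verts H) \<and> card (verts H) = m \<and> edges H = {E. E \<subseteq> verts H \<and> card E = d}"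

definition triangulated :: "nat \<Rightarrow> 'v hypergraph \<Rightarrow> bool" where
  "triangulated d H \<longleftrightarrow>
     uniform d H \<and> properly_connected d H \<and>
     (\<forall>Y. Y \<noteq> {} \<and> Y \<subseteq> verts H \<longrightarrow>
        (\<exists>x\<in>Y. let HY = induced H Y; N = neighbors HY x in
           complete_hypergraph d (card N + 1) (induced HY (N \<union> {x}))))"


section \<open>Polynomial rings and edge ideals\<close>

text \<open>Monomials are finitely supported exponent functions; the product of \<open>\<Rightarrow>\<^sub>0\<close> is
  convolution, i.e. the product of polynomials.\<close>

type_synonym 'v monomial = "'v \<Rightarrow>\<^sub>0 nat"
type_synonym ('v, 'k) mpoly = "'v monomial \<Rightarrow>\<^sub>0 'k"

definition mdegree :: "'v monomial \<Rightarrow> nat" where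
  "mdegree m = (\<Sum>v\<in>Poly_Mapping.keys m. Poly_Mapping.lookup m v)"

text \<open>The polynomial ring \<open>k[X]\<close>, as a subset of the polynomials in variables from \<open>'v\<close>.\<close>

definition poly_ring :: "'v set \<Rightarrow> ('v, 'k::field) mpoly set" where
  "poly_ring X = {p. \<forall>m\<in>Poly_Mapping.keys p. Poly_Mapping.keys m \<subseteq> X}"

definition var :: "'v \<Rightarrow> ('v, 'k::field) mpoly" where
  "var x = Poly_Mapping.single (Poly_Mapping.single x 1) 1"

definition edge_monomial :: "'v set \<Rightarrow> ('v, 'k::field) mpoly" where
  "edge_monomial E = (\<Prod>x\<in>E. var x)"

text \<open>The ideal of \<open>k[X]\<close> generated by the monomials of the (finitely many) edges.\<close>

definition edge_ideal :: "'v hypergraph \<Rightarrow> ('v, 'k::field) mpoly set" where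
  "edge_ideal H =
     {\<Sum>E\<in>edges H. c E * edge_monomial E | c. \<forall>E\<in>edges H. c E \<in> poly_ring (verts H)}"


section \<open>Minimal graded free resolutions and graded Betti numbers\<close>

text \<open>Data for an augmented complex \<open>\<dots> \<rightarrow> F\<^sub>1 \<rightarrow> F\<^sub>0 \<rightarrow> I\<close> of graded free modules. \<open>F\<^sub>i\<close> has the
  basis \<open>basis F i\<close>, where \<open>b\<close> is placed in degree \<open>shift F i b\<close>, so
  \<open>F\<^sub>i = \<Oplus>\<^sub>b R(-shift F i b)\<close>. For \<open>b\<close> in the basis of \<open>F\<^bsub>i+1\<^esub>\<close>, \<open>bd F i b\<close> is its image in
  \<open>F\<^sub>i\<close>, written as a coefficient vector; \<open>aug F b\<close> is the image in \<open>I\<close> of \<open>b\<close> in the basis of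
  \<open>F\<^sub>0\<close>. Degrees are natural numbers because the module resolved is an ideal, and a minimal
  resolution of it has no generators of negative degree.\<close>

record (overloaded) ('v, 'k::zero) free_complex =
  basis :: "nat \<Rightarrow> nat set"
  shift :: "nat \<Rightarrow> nat \<Rightarrow> nat"
  bd :: "nat \<Rightarrow> nat \<Rightarrow> (nat \<Rightarrow>\<^sub>0 ('v, 'k) mpoly)"
  aug :: "nat \<Rightarrow> ('v, 'k) mpoly"

definition free_module :: "'v set \<Rightarrow> nat set \<Rightarrow> (nat \<Rightarrow>\<^sub>0 ('v, 'k::field) mpoly) set" where
  "free_module X B =
     {w. Poly_Mapping.keys w \<subseteq> B \<and> (\<forall>b. Poly_Mapping.lookup w b \<in> poly_ring X)}"

text \<open>The linear extensions of \<open>bd F i\<close> (a map from \<open>F\<^bsub>i+1\<^esub>\<close> to \<open>F\<^sub>i\<close>) and of \<open>aug F\<close>.\<close>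

definition bd_map :: "('v, 'k::field) free_complex \<Rightarrow> nat
    \<Rightarrow> (nat \<Rightarrow>\<^sub>0 ('v, 'k) mpoly) \<Rightarrow> (nat \<Rightarrow>\<^sub>0 ('v, 'k) mpoly)" where
  "bd_map F i w =
     (\<Sum>b\<in>Poly_Mapping.keys w. Poly_Mapping.map ((*) (Poly_Mapping.lookup w b)) (bd F i b))"

definition aug_map :: "('v, 'k::field) free_complex \<Rightarrow> (nat \<Rightarrow>\<^sub>0 ('v, 'k) mpoly) \<Rightarrow> ('v, 'k) mpoly" where
  "aug_map F w = (\<Sum>b\<in>Poly_Mapping.keys w. Poly_Mapping.lookup w b * aug F b)"

definition free_resolution ::
    "'v set \<Rightarrow> ('v, 'k::field) mpoly set \<Rightarrow> ('v, 'k) free_complex \<Rightarrow> bool" where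
  "free_resolution X I F \<longleftrightarrow>
     (\<forall>i. \<forall>b\<in>basis F (Suc i). bd F i b \<in> free_module X (basis F i)) \<and>
     (\<forall>b\<in>basis F 0. aug F b \<in> poly_ring X) \<and>
     aug_map F ` free_module X (basis F 0) = I \<and>
     bd_map F 0 ` free_module X (basis F 1) =
       {w \<in> free_module X (basis F 0). aug_map F w = 0} \<and>
     (\<forall>i. bd_map F (Suc i) ` free_module X (basis F (Suc (Suc i))) =
       {w \<in> free_module X (basis F (Suc i)). bd_map F i w = 0})"

text \<open>The maps preserve degrees: \<open>b\<close> is sent to a homogeneous element of degree \<open>shift F i b\<close>.\<close>

definition graded_complex :: "('v, 'k::field) free_complex \<Rightarrow> bool" where
  "graded_complex F \<longleftrightarrow>
     (\<forall>b\<in>basis F 0. \<forall>m\<in>Poly_Mapping.keys (aug F b). mdegree m = shift F 0 b) \<and>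
     (\<forall>i. \<forall>b\<in>basis F (Suc i). \<forall>c. \<forall>m\<in>Poly_Mapping.keys (Poly_Mapping.lookup (bd F i b) c).
        mdegree m + shift F i c = shift F (Suc i) b)"

text \<open>Minimality: the image of \<open>F\<^bsub>i+1\<^esub>\<close> lies in \<open>\<mm>F\<^sub>i\<close>, where \<open>\<mm>\<close> is the ideal generated by the
  variables, i.e. the entries of the matrices have no constant term.\<close>

definition minimal_complex :: "('v, 'k::field) free_complex \<Rightarrow> bool" where
  "minimal_complex F \<longleftrightarrow>
     (\<forall>i. \<forall>b\<in>basis F (Suc i). \<forall>c. Poly_Mapping.lookup (Poly_Mapping.lookup (bd F i b) c) 0 = 0)"

definition minimal_graded_free_resolution ::
    "'v set \<Rightarrow> ('v, 'k::field) mpoly set \<Rightarrow> ('v, 'k) free_complex \<Rightarrow> bool" where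
  "minimal_graded_free_resolution X I F \<longleftrightarrow>
     free_resolution X I F \<and> graded_complex F \<and> minimal_complex F"

text \<open>\<open>\<beta>\<^bsub>i,j\<^esub>(I)\<close> is the number of copies of \<open>R(-j)\<close> in the \<open>i\<close>-th module of the minimal graded
  free resolution of the homogeneous ideal \<open>I\<close> of \<open>R = k[X]\<close>, \<open>X\<close> finite. That resolution exists
  and is unique up to isomorphism. Finite rank is not part of the definition above, since it
  follows from minimality; in particular the set below is finite.\<close>

definition graded_betti :: "'v set \<Rightarrow> ('v, 'k::field) mpoly set \<Rightarrow> nat \<Rightarrow> nat \<Rightarrow> nat" where
  "graded_betti X I i j =
     (let F = (SOME F. minimal_graded_free_resolution X I F) in card {b \<in> basis F i. shift F i b = j})"

text \<open>For the edge ideal \<open>I\<close> of a \<open>d\<close>-uniform hypergraph.\<close>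

definition linear_first_syzygies :: "nat \<Rightarrow> 'v set \<Rightarrow> ('v, 'k::field) mpoly set \<Rightarrow> bool" where
  "linear_first_syzygies d X I \<longleftrightarrow> (\<forall>j. j \<noteq> d + 1 \<longrightarrow> graded_betti X I 1 j = 0)"

definition linear_resolution :: "nat \<Rightarrow> 'v set \<Rightarrow> ('v, 'k::field) mpoly set \<Rightarrow> bool" where
  "linear_resolution d X I \<longleftrightarrow> (\<forall>i j. j \<noteq> i + d \<longrightarrow> graded_betti X I i j = 0)"

end

theory Submission
  imports Defs "HOL-Library.Countable_Set"
begin

text \<open>The graded Betti number \<open>\<beta>\<^sub>i\<^sub>,\<^sub>j\<close> of an ideal \<open>I\<close> of \<open>R = k[X]\<close> is the dimension of the part of degree \<open>j\<close> of
\<open>Tor\<^sub>i(I, k)\<close>, and \<open>Tor\<close> can be computed by resolving \<open>k\<close> instead of \<open>I\<close>, that is, from the Koszul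
complex with coefficients in \<open>I\<close>. Hence \<open>\<beta>\<^sub>i\<^sub>,\<^sub>j(I) = 0\<close> if and only if every homogeneous Koszul \<open>i\<close>-cycle
of total degree \<open>j\<close> with values in \<open>I\<close> is a boundary. This is \<open>graded_betti_eq_0_iff\<close>. It is proved for
an arbitrary minimal graded free resolution by climbing down its syzygy modules one at a time, so two
minimal resolutions never have to be compared; what it needs besides is that a minimal resolution
exists and has finitely many generators in each degree.

For a monomial ideal the Koszul complex splits into multidegrees \<open>u\<close>. In multidegree \<open>u\<close> it is the
chain complex over \<open>k\<close> of the simplicial complex of all \<open>\<sigma>\<close> such that the monomial \<open>u\<close> divided by the
product of the vertices in \<open>\<sigma>\<close> still lies in \<open>I\<close>. The rest of the proof is about these complexes.

From \<open>diam \<le> d\<close> to a linear resolution: by proper connectedness and the bound on the diameter, two edges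
\<open>E \<noteq> E'\<close> are joined by a chain whose length is the number of vertices of \<open>E'\<close> outside \<open>E\<close>. Such a chain
wastes no step: each one gives up a vertex of \<open>E' - E\<close> for good. Its last step before \<open>E\<close> therefore
yields an edge \<open>E - z + y\<close> with \<open>y \<in> E' - E\<close>. Unlike the distances, this exchange property is visibly
inherited by induced hypergraphs. So one may remove the vertices \<open>x\<close> provided by the triangulation one
by one, and list the edges without \<open>x\<close> before those with \<open>x\<close>. Then for each edge \<open>E\<close> the ideal of the
previous edges has a colon by the monomial of \<open>E\<close> that is generated by variables
(\<open>triangulated_linear_quotients\<close>). Adding such a generator changes the simplicial complex in multidegree
\<open>u\<close> by a set of faces that is a cone, unless these faces have the cardinality that belongs to the linear
strand; so all homology off the linear strand vanishes (\<open>linear_quotients_exact\<close>).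

From linear first syzygies to \<open>diam \<le> d\<close>: edges that meet have distance at most \<open>d\<close> by proper
connectedness. If \<open>E\<close> and \<open>E'\<close> are disjoint, their syzygy has degree \<open>2d \<noteq> d + 1\<close>, and in this degree
the module of syzygies has no minimal generators. In the simplicial complex of multidegree \<open>E \<union> E'\<close> this means that
some face joins a vertex of \<open>E\<close> to a vertex of \<open>E'\<close>, which provides a third edge \<open>G\<close> inside \<open>E \<union> E'\<close>
(\<open>linear_syzygies_connect\<close>). The distances from \<open>E\<close> to \<open>G\<close> and from \<open>G\<close> to \<open>E'\<close> are the cardinalities of
\<open>E' \<inter> G\<close> and of \<open>E \<inter> G\<close>, which add up to \<open>d\<close>.\<close>

section \<open>Graded free modules over the polynomial ring\<close>

type_synonym ('v, 'k) vec = "nat \<Rightarrow>\<^sub>0 ('v, 'k) mpoly"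

abbreviation lookup :: "('a \<Rightarrow>\<^sub>0 'b::zero) \<Rightarrow> 'a \<Rightarrow> 'b" where "lookup \<equiv> Poly_Mapping.lookup"
abbreviation keys :: "('a \<Rightarrow>\<^sub>0 'b::zero) \<Rightarrow> 'a set" where "keys \<equiv> Poly_Mapping.keys"
abbreviation single :: "'a \<Rightarrow> 'b::zero \<Rightarrow> ('a \<Rightarrow>\<^sub>0 'b)" where "single \<equiv> Poly_Mapping.single"

definition smul :: "('v, 'k::field) mpoly \<Rightarrow> ('v, 'k) vec \<Rightarrow> ('v, 'k) vec" (infixr "\<odot>" 75)
  where "p \<odot> w = Poly_Mapping.map ((*) p) w"

text \<open>Vectors are finitely supported functions on \<open>nat\<close>, so they form a commutative ring under convolution, in
which scalars are the vectors supported at 0. The module laws are instances of the ring laws.\<close>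

lemma smul_conv_mult: "p \<odot> w = single 0 p * w"
  by (simp add: smul_def mult_map_scale_conv_mult)

lemma lookup_smul [simp]: "lookup (p \<odot> w) b = p * lookup w b"
  by (cases "lookup w b = 0") (auto simp: smul_def Poly_Mapping.map.rep_eq when_def)

lemma smul_add: "p \<odot> (v + w) = p \<odot> v + p \<odot> w"
  by (simp add: smul_conv_mult algebra_simps)
lemma smul_diff: "p \<odot> (v - w) = p \<odot> v - p \<odot> w"
  by (simp add: smul_conv_mult algebra_simps)
lemma add_smul: "(p + q) \<odot> w = p \<odot> w + q \<odot> w"
  by (simp add: smul_conv_mult single_add algebra_simps)
lemma smul_smul: "p \<odot> (q \<odot> w) = (p * q) \<odot> w"
  by (intro poly_mapping_eqI) (simp add: mult.assoc)
lemma one_smul [simp]: "1 \<odot> w = w"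
  by (intro poly_mapping_eqI) simp
lemma zero_smul [simp]: "0 \<odot> w = 0"
  by (intro poly_mapping_eqI) simp
lemma smul_zero [simp]: "p \<odot> 0 = 0"
  by (intro poly_mapping_eqI) simp
lemma uminus_smul: "(- p) \<odot> w = - (p \<odot> w)"
  by (intro poly_mapping_eqI) simp
lemma smul_uminus: "p \<odot> (- w) = - (p \<odot> w)"
  by (simp add: smul_conv_mult)
lemma smul_sum: "p \<odot> (\<Sum>a\<in>A. f a) = (\<Sum>a\<in>A. p \<odot> f a)"
  by (simp add: smul_conv_mult sum_distrib_left)
lemma smul_single: "p \<odot> single b q = single b (p * q)"
  by (simp add: smul_conv_mult mult_single)
lemma smul_commute: "p \<odot> (q \<odot> w) = q \<odot> (p \<odot> w)"
  by (simp add: smul_smul mult.commute)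

lemma vec_eqI: "(\<And>b m. lookup (lookup v b) m = lookup (lookup w b) m) \<Longrightarrow> v = w"
  by (intro poly_mapping_eqI)

lemma poly_mapping_expansion: "w = (\<Sum>b\<in>keys w. single b (lookup w b))"
proof (rule poly_mapping_eqI)
  fix c
  have "lookup (\<Sum>b\<in>keys w. single b (lookup w b)) c = (\<Sum>b\<in>keys w. if b = c then lookup w b else 0)"
    unfolding lookup_sum by (intro sum.cong refl) (simp add: lookup_single when_def)
  also have "\<dots> = lookup w c" by (simp add: in_keys_iff)
  finally show "lookup w c = lookup (\<Sum>b\<in>keys w. single b (lookup w b)) c" ..
qed

lemma single_sum: "single k (sum f A) = (\<Sum>a\<in>A. single k (f a))"
  by (induction A rule: infinite_finite_induct) (auto simp: single_add)

lemma mdegree_superset: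
  assumes "finite A" "keys m \<subseteq> A"
  shows "mdegree m = (\<Sum>v\<in>A. lookup m v)"
  unfolding mdegree_def using assms by (intro sum.mono_neutral_left) (auto simp: in_keys_iff)

lemma mdegree_add: "mdegree (m + n) = mdegree m + mdegree n"
proof -
  let ?A = "keys m \<union> keys n"
  have "keys (m + n) \<subseteq> ?A" by (rule Poly_Mapping.keys_add)
  then show ?thesis
    by (simp add: mdegree_superset[of ?A] lookup_add sum.distrib)
qed

lemma mdegree_0 [simp]: "mdegree 0 = 0" by (simp add: mdegree_def)
lemma mdegree_single [simp]: "mdegree (single v n) = n" by (simp add: mdegree_def)

lemma keys_add_nat: "keys (m + n) = keys m \<union> keys (n :: 'v monomial)"
  by (auto simp: in_keys_iff lookup_add)

lemma lookup_var_mult: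
  "lookup (var v * p) m = (if v \<in> keys m then lookup p (m - single v 1) else 0)"
proof -
  have *: "m = single v 1 + q \<longleftrightarrow> v \<in> keys m \<and> q = m - single v 1" for q
  proof
    assume "v \<in> keys m \<and> q = m - single v 1"
    then have "m = single v 1 + q"
      by (auto intro!: poly_mapping_eqI simp: lookup_add lookup_minus lookup_single when_def in_keys_iff)
    then show "m = single v 1 + q" .
  qed (auto simp: keys_add_nat)
  have "lookup (var v * p) m = (\<Sum>l. (1 when single v 1 = l) * (\<Sum>q. lookup p q when m = l + q))"
    by (simp add: lookup_mult var_def lookup_single)
  also have "\<dots> = (\<Sum>l. (\<Sum>q. lookup p q when m = l + q) when single v 1 = l)"
    by (simp add: when_mult)
  also have "\<dots> = (\<Sum>q. lookup p q when m = single v 1 + q)"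
    by simp
  also have "\<dots> = (\<Sum>q. (lookup p q when v \<in> keys m) when q = m - single v 1)"
    unfolding * by (intro Sum_any.cong) (auto simp: when_def)
  finally show ?thesis by (simp add: when_def)
qed

subsection \<open>The subring of polynomials in the given variables\<close>

lemma poly_ring_iff: "p \<in> poly_ring X \<longleftrightarrow> (\<forall>m. lookup p m \<noteq> 0 \<longrightarrow> keys m \<subseteq> X)"
  by (auto simp: poly_ring_def in_keys_iff)

lemma poly_ring_0 [simp]: "0 \<in> poly_ring X" by (simp add: poly_ring_def)
lemma poly_ring_single [simp]: "keys m \<subseteq> X \<Longrightarrow> single m c \<in> poly_ring X"
  by (auto simp: poly_ring_iff lookup_single when_def)
lemma poly_ring_1 [simp]: "1 \<in> poly_ring X"
  using poly_ring_single[of 0 X 1] by simp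
lemma poly_ring_var [simp]: "v \<in> X \<Longrightarrow> var v \<in> poly_ring X" by (simp add: var_def)
lemma poly_ring_add: "p \<in> poly_ring X \<Longrightarrow> q \<in> poly_ring X \<Longrightarrow> p + q \<in> poly_ring X"
  unfolding poly_ring_iff lookup_add by (metis add.right_neutral)
lemma poly_ring_uminus: "p \<in> poly_ring X \<Longrightarrow> - p \<in> poly_ring X"
  by (auto simp: poly_ring_iff)
lemma poly_ring_mult:
  assumes "p \<in> poly_ring X" "q \<in> poly_ring X"
  shows "p * q \<in> poly_ring X"
proof -
  { fix m assume "m \<in> keys (p * q)"
    then obtain a b where "m = a + b" "a \<in> keys p" "b \<in> keys q"
      using keys_mult[of p q] by blast
    then have "keys m \<subseteq> X" using assms by (auto simp: poly_ring_def keys_add_nat) }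
  then show ?thesis by (auto simp: poly_ring_def)
qed
lemma poly_ring_sum: "(\<And>a. a \<in> A \<Longrightarrow> f a \<in> poly_ring X) \<Longrightarrow> sum f A \<in> poly_ring X"
  by (induction A rule: infinite_finite_induct) (auto intro: poly_ring_add)
lemma poly_ring_sign [simp]: "(-1) ^ n \<in> poly_ring X"
  by (induction n) (auto intro: poly_ring_uminus)

subsection \<open>Submodules and linear maps\<close>

definition submodule :: "'v set \<Rightarrow> ('v, 'k::field) vec set \<Rightarrow> bool" where
  "submodule X M \<longleftrightarrow> 0 \<in> M \<and> (\<forall>v\<in>M. \<forall>w\<in>M. v + w \<in> M) \<and> (\<forall>p\<in>poly_ring X. \<forall>w\<in>M. p \<odot> w \<in> M)"

lemma submodule_0: "submodule X M \<Longrightarrow> 0 \<in> M"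
  and submodule_add: "submodule X M \<Longrightarrow> v \<in> M \<Longrightarrow> w \<in> M \<Longrightarrow> v + w \<in> M"
  and submodule_smul: "submodule X M \<Longrightarrow> p \<in> poly_ring X \<Longrightarrow> w \<in> M \<Longrightarrow> p \<odot> w \<in> M"
  by (auto simp: submodule_def)

lemma submodule_sum: "submodule X M \<Longrightarrow> (\<And>a. a \<in> A \<Longrightarrow> f a \<in> M) \<Longrightarrow> sum f A \<in> M"
  by (induction A rule: infinite_finite_induct) (auto intro: submodule_add submodule_0)

lemma submodule_uminus: "submodule X M \<Longrightarrow> w \<in> M \<Longrightarrow> - w \<in> M"
  using submodule_smul[of X M "-1" w] by (simp add: uminus_smul poly_ring_uminus)

lemma submodule_diff: "submodule X M \<Longrightarrow> v \<in> M \<Longrightarrow> w \<in> M \<Longrightarrow> v - w \<in> M"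
  using submodule_add[of X M v "-w"] submodule_uminus[of X M w] by simp

lemma free_module_iff:
  "w \<in> free_module X B \<longleftrightarrow> (\<forall>b m. lookup (lookup w b) m \<noteq> 0 \<longrightarrow> b \<in> B \<and> keys m \<subseteq> X)"
proof -
  have "lookup w b \<noteq> 0 \<longleftrightarrow> (\<exists>m. lookup (lookup w b) m \<noteq> 0)" for b
    by (metis lookup_zero poly_mapping_eqI)
  then show ?thesis
    unfolding free_module_def poly_ring_iff by (auto simp: in_keys_iff subset_iff)
qed

lemma submodule_free_module: "submodule X (free_module X B)"
proof -
  have "v + w \<in> free_module X B" if "v \<in> free_module X B" "w \<in> free_module X B" for v w
    using that unfolding free_module_iff lookup_add by (metis add.right_neutral)
  moreover have "p \<odot> w \<in> free_module X B" if "p \<in> poly_ring X" "w \<in> free_module X B" for p w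
    using that by (fastforce simp: free_module_def in_keys_iff intro: poly_ring_mult)
  ultimately show ?thesis
    unfolding submodule_def by (auto simp: free_module_iff[of 0])
qed

lemma free_module_single: "b \<in> B \<Longrightarrow> p \<in> poly_ring X \<Longrightarrow> single b p \<in> free_module X B"
  by (auto simp: free_module_def lookup_single when_def)

definition lin_ext :: "(nat \<Rightarrow> ('v, 'k::field) vec) \<Rightarrow> ('v, 'k) vec \<Rightarrow> ('v, 'k) vec" where
  "lin_ext g w = (\<Sum>b\<in>keys w. lookup w b \<odot> g b)"

lemma lin_ext_superset: "finite A \<Longrightarrow> keys w \<subseteq> A \<Longrightarrow> lin_ext g w = (\<Sum>b\<in>A. lookup w b \<odot> g b)"
  unfolding lin_ext_def by (intro sum.mono_neutral_left) (auto simp: in_keys_iff)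

lemma lin_ext_add: "lin_ext g (v + w) = lin_ext g v + lin_ext g w"
  using Poly_Mapping.keys_add[of v w]
  by (simp add: lin_ext_superset[of "keys v \<union> keys w"] lookup_add add_smul sum.distrib)

lemma lin_ext_0 [simp]: "lin_ext g 0 = 0" by (simp add: lin_ext_def)

lemma lin_ext_smul: "lin_ext g (p \<odot> w) = p \<odot> lin_ext g w"
proof -
  have "keys (p \<odot> w) \<subseteq> keys w" by (auto simp: in_keys_iff)
  then show ?thesis by (simp add: lin_ext_superset[of "keys w"] smul_sum smul_smul)
qed

lemma lin_ext_uminus: "lin_ext g (- w) = - lin_ext g w"
  using lin_ext_smul[of g "-1" w] by (simp add: uminus_smul)
lemma lin_ext_diff: "lin_ext g (v - w) = lin_ext g v - lin_ext g w"
  using lin_ext_add[of g v "-w"] by (simp add: lin_ext_uminus)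
lemma lin_ext_sum: "lin_ext g (sum f A) = (\<Sum>a\<in>A. lin_ext g (f a))"
  by (induction A rule: infinite_finite_induct) (auto simp: lin_ext_add)
lemma lin_ext_single: "lin_ext g (single b p) = p \<odot> g b"
  by (cases "p = 0") (simp_all add: lin_ext_def)

lemma lin_ext_in_submodule:
  assumes "submodule X M" "w \<in> free_module X B" "\<And>b. b \<in> B \<Longrightarrow> g b \<in> M"
  shows "lin_ext g w \<in> M"
  unfolding lin_ext_def using assms
  by (intro submodule_sum[of X M] submodule_smul[of X M]) (auto simp: free_module_def)

lemma submodule_lin_image:
  fixes N :: "('v, 'k::field) vec set"
  assumes "submodule X N"
  shows "submodule X (lin_ext g ` N)"
  unfolding submodule_def
proof (intro conjI ballI)
  show "0 \<in> lin_ext g ` N" using submodule_0[OF assms] by (metis image_eqI lin_ext_0)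
next
  fix v w assume "v \<in> lin_ext g ` N" "w \<in> lin_ext g ` N"
  then show "v + w \<in> lin_ext g ` N" using submodule_add[OF assms] by (auto simp: lin_ext_add[symmetric])
next
  fix p :: "('v, 'k) mpoly" and w assume "p \<in> poly_ring X" "w \<in> lin_ext g ` N"
  then show "p \<odot> w \<in> lin_ext g ` N" using submodule_smul[OF assms] by (auto simp: lin_ext_smul[symmetric])
qed

definition lin_kernel where
  "lin_kernel X B g = {w \<in> free_module X B. lin_ext g w = 0}"

lemma submodule_lin_kernel: "submodule X (lin_kernel X B g)"
  using submodule_free_module[of X B]
  by (auto simp: submodule_def lin_kernel_def lin_ext_add lin_ext_smul)

subsection \<open>Homogeneous vectors and homogeneous components\<close>

text \<open>The basis vector \<open>b\<close> has degree \<open>s b\<close>. The parameter \<open>p\<close> is an additional shift: the values of a Koszul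
\<open>p\<close>-chain of total degree \<open>j\<close> only have degree \<open>j - p\<close>, since the \<open>p\<close> exterior variables count as well.
Writing this as a sum avoids truncated subtraction.\<close>

definition homog :: "(nat \<Rightarrow> nat) \<Rightarrow> nat \<Rightarrow> nat \<Rightarrow> ('v, 'k::field) vec \<Rightarrow> bool" where
  "homog s p j w \<longleftrightarrow> (\<forall>b m. lookup (lookup w b) m \<noteq> 0 \<longrightarrow> mdegree m + s b + p = j)"

definition hcomp :: "(nat \<Rightarrow> nat) \<Rightarrow> nat \<Rightarrow> ('v, 'k::field) vec \<Rightarrow> ('v, 'k) vec" where
  "hcomp s j w = Poly_Mapping.mapp (\<lambda>b. Poly_Mapping.mapp (\<lambda>m a. a when mdegree m + s b = j)) w"

lemma lookup_hcomp: "lookup (lookup (hcomp s j w) b) m = (lookup (lookup w b) m when mdegree m + s b = j)"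
  by (auto simp: hcomp_def lookup_mapp when_def in_keys_iff)

lemma homog_hcomp: "homog s 0 j (hcomp s j w)"
  by (simp add: homog_def lookup_hcomp)

lemma hcomp_homog: "homog s 0 i w \<Longrightarrow> hcomp s j w = (if i = j then w else 0)"
  by (rule vec_eqI) (auto simp: lookup_hcomp homog_def when_def)

lemma hcomp_add: "hcomp s j (v + w) = hcomp s j v + hcomp s j w"
  by (rule vec_eqI) (auto simp: lookup_hcomp lookup_add when_def)
lemma hcomp_0 [simp]: "hcomp s j 0 = 0"
  by (rule vec_eqI) (auto simp: lookup_hcomp)
lemma hcomp_sum: "hcomp s j (sum f A) = (\<Sum>a\<in>A. hcomp s j (f a))"
  by (induction A rule: infinite_finite_induct) (auto simp: hcomp_add)

lemma homog_0 [simp]: "homog s p j 0" by (simp add: homog_def)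
lemma homog_add: "homog s p j v \<Longrightarrow> homog s p j w \<Longrightarrow> homog s p j (v + w)"
  unfolding homog_def lookup_add by (metis add.right_neutral)
lemma homog_sum: "(\<And>a. a \<in> A \<Longrightarrow> homog s p j (f a)) \<Longrightarrow> homog s p j (sum f A)"
  by (induction A rule: infinite_finite_induct) (auto intro: homog_add)
lemma homog_uminus: "homog s p j w \<Longrightarrow> homog s p j (- w)"
  by (simp add: homog_def)
lemma homog_diff: "homog s p j v \<Longrightarrow> homog s p j w \<Longrightarrow> homog s p j (v - w)"
  using homog_add[of s p j v "-w"] homog_uminus[of s p j w] by simp

lemma homog_shift: "homog s (p + q) (j + q) w \<longleftrightarrow> homog s p j w"
  by (simp add: homog_def add.assoc[symmetric])

lemma homog_smul:
  assumes "\<And>m. lookup q m \<noteq> 0 \<Longrightarrow> mdegree m + i = e" "homog s p i w"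
  shows "homog s p e (q \<odot> w)"
  unfolding homog_def
proof (intro allI impI)
  fix b m assume "lookup (lookup (q \<odot> w) b) m \<noteq> 0"
  then have "m \<in> keys (q * lookup w b)" by (simp add: in_keys_iff)
  then obtain a c where "m = a + c" "a \<in> keys q" "c \<in> keys (lookup w b)"
    using keys_mult[of q "lookup w b"] by blast
  then show "mdegree m + s b + p = e"
    using assms(1)[of a] assms(2) by (fastforce simp: homog_def in_keys_iff mdegree_add)
qed

lemma homog_var: "homog s (Suc p) j w \<Longrightarrow> homog s p j (var v \<odot> w)"
  by (subst homog_shift[of s p 1 j, symmetric])
    (rule homog_smul[where i = j], auto simp: var_def lookup_single when_def split: if_splits)

lemma homog_sign: "homog s p j w \<Longrightarrow> homog s p j ((-1) ^ n \<odot> w)"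
  by (induction n) (auto simp: uminus_smul homog_uminus)

lemma homog_lin:
  assumes "homog s' p j w" "keys w \<subseteq> B" "\<And>b. b \<in> B \<Longrightarrow> homog s 0 (s' b) (g b)"
  shows "homog s p j (lin_ext g w)"
  unfolding lin_ext_def
proof (rule homog_sum)
  fix b assume b: "b \<in> keys w"
  then have "homog s p (s' b + p) (g b)" using assms homog_shift[of s 0 p "s' b"] by auto
  then show "homog s p j (lookup w b \<odot> g b)"
    by (rule homog_smul[rotated]) (use assms(1) in \<open>simp add: homog_def add.assoc[symmetric]\<close>)
qed

lemma hcomp_decomposition:
  obtains n where "w = (\<Sum>j\<le>n. hcomp s j w)"
proof -
  define D where "D = (\<Union>b\<in>keys w. (\<lambda>m. mdegree m + s b) ` keys (lookup w b))"
  have "finite D" by (auto simp: D_def)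
  then obtain n where n: "\<And>d. d \<in> D \<Longrightarrow> d \<le> n" using finite_nat_set_iff_bounded_le by auto
  have "w = (\<Sum>j\<le>n. hcomp s j w)"
  proof (rule vec_eqI)
    fix b m
    have "lookup (lookup (\<Sum>j\<le>n. hcomp s j w) b) m = (\<Sum>j\<le>n. if j = mdegree m + s b then lookup (lookup w b) m else 0)"
      by (auto simp: lookup_sum lookup_hcomp when_def intro!: sum.cong)
    also have "\<dots> = lookup (lookup w b) m"
    proof (cases "lookup (lookup w b) m = 0")
      case False
      then have "b \<in> keys w" "m \<in> keys (lookup w b)" by (auto simp: in_keys_iff)
      then have "mdegree m + s b \<in> D" unfolding D_def by blast
      then show ?thesis using n by auto
    qed simp
    finally show "lookup (lookup w b) m = lookup (lookup (\<Sum>j\<le>n. hcomp s j w) b) m" by simp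
  qed
  then show ?thesis by (rule that)
qed

lemma free_module_hcomp: "w \<in> free_module X B \<Longrightarrow> hcomp s j w \<in> free_module X B"
  by (auto simp: free_module_iff lookup_hcomp)

text \<open>Decompose \<open>w\<close> into its components: their images are homogeneous of different degrees, and such a
decomposition of \<open>lin_ext g w\<close> is unique.\<close>

lemma hcomp_lin_ext:
  assumes w: "w \<in> free_module X B" and g: "\<And>b. b \<in> B \<Longrightarrow> homog s 0 (s' b) (g b)"
  shows "hcomp s j (lin_ext g w) = lin_ext g (hcomp s' j w)"
proof -
  obtain n where n: "w = (\<Sum>i\<le>n. hcomp s' i w)" by (rule hcomp_decomposition)
  have h: "homog s 0 i (lin_ext g (hcomp s' i w))" for i
    using free_module_hcomp[OF w, of s' i]
    by (intro homog_lin[OF homog_hcomp _ g]) (auto simp: free_module_def)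
  have "hcomp s j (lin_ext g w) = (\<Sum>i\<le>n. hcomp s j (lin_ext g (hcomp s' i w)))"
    by (subst n) (simp add: lin_ext_sum hcomp_sum)
  also have "\<dots> = (\<Sum>i\<le>n. if i = j then lin_ext g (hcomp s' j w) else 0)"
    by (intro sum.cong) (auto simp: hcomp_homog[OF h])
  also have "\<dots> = lin_ext g (hcomp s' j w)"
  proof (cases "j \<le> n")
    case False
    have "hcomp s' j w = (\<Sum>i\<le>n. hcomp s' j (hcomp s' i w))"
      by (subst n) (simp add: hcomp_sum)
    also have "\<dots> = 0" using False by (intro sum.neutral) (auto simp: hcomp_homog[OF homog_hcomp])
    finally show ?thesis using False by simp
  qed simp
  finally show ?thesis .
qed

definition graded_sub :: "(nat \<Rightarrow> nat) \<Rightarrow> ('v, 'k::field) vec set \<Rightarrow> bool" where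
  "graded_sub s M \<longleftrightarrow> (\<forall>w\<in>M. \<forall>j. hcomp s j w \<in> M)"

lemma graded_lin_kernel:
  assumes "\<And>b. b \<in> B \<Longrightarrow> homog s 0 (s' b) (g b)"
  shows "graded_sub s' (lin_kernel X B g)"
  using hcomp_lin_ext[OF _ assms, of _ X B, symmetric] 
  by (auto simp: graded_sub_def lin_kernel_def free_module_hcomp)

section \<open>The Koszul complex\<close>

text \<open>Vertices are not ordered, so the signs of the Koszul complex refer to a numbering \<open>r\<close>; every numbering
that is injective on the vertices will do.\<close>

definition koszul_sign :: "('v \<Rightarrow> nat) \<Rightarrow> 'v \<Rightarrow> 'v set \<Rightarrow> 'a::comm_ring_1" where
  "koszul_sign r v \<tau> = (-1) ^ card {w \<in> \<tau>. r w < r v}"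

lemma koszul_sign_insert:
  assumes "finite \<tau>" "v \<notin> \<tau>"
  shows "koszul_sign r w (insert v \<tau>) = (if r v < r w then - koszul_sign r w \<tau> else koszul_sign r w \<tau>)"
proof -
  have "{x \<in> insert v \<tau>. r x < r w} = (if r v < r w then insert v {x \<in> \<tau>. r x < r w} else {x \<in> \<tau>. r x < r w})"
    by auto
  then show ?thesis using assms by (auto simp: koszul_sign_def)
qed

lemma koszul_sign_square [simp]: "koszul_sign r v \<tau> * koszul_sign r v \<tau> = 1"
  unfolding koszul_sign_def power_mult_distrib[symmetric] by simp

text \<open>The terms with \<open>r v < r w\<close> cancel those with \<open>r w < r v\<close>. Comparing the sum with its negative would not
be enough in characteristic 2.\<close>

lemma antisymmetric_double_sum:
  fixes T :: "'v \<Rightarrow> 'v \<Rightarrow> 'a::ab_group_add" and r :: "'v \<Rightarrow> nat"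
  assumes "finite A" "inj_on r A" and anti: "\<And>v w. v \<in> A \<Longrightarrow> w \<in> A \<Longrightarrow> v \<noteq> w \<Longrightarrow> T v w = - T w v"
  shows "(\<Sum>v\<in>A. \<Sum>w\<in>A - {v}. T v w) = 0"
proof -
  let ?L = "{(v, w). v \<in> A \<and> w \<in> A \<and> r v < r w}" and ?G = "{(v, w). v \<in> A \<and> w \<in> A \<and> r w < r v}"
  have fin: "finite ?L" "finite ?G"
    by (rule finite_subset[of _ "A \<times> A"]; use assms(1) in auto)+
  have eq: "(SIGMA v:A. A - {v}) = ?L \<union> ?G"
    using inj_on_eq_iff[OF assms(2)] by (fastforce simp: nat_neq_iff)
  have "(\<Sum>v\<in>A. \<Sum>w\<in>A - {v}. T v w) = (\<Sum>(v, w)\<in>?L \<union> ?G. T v w)"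
    unfolding eq[symmetric] using assms(1) by (subst sum.Sigma) auto
  also have "\<dots> = (\<Sum>(v, w)\<in>?L. T v w) + (\<Sum>(v, w)\<in>?G. T v w)"
    by (rule sum.union_disjoint[OF fin]) auto
  also have "(\<Sum>(v, w)\<in>?G. T v w) = (\<Sum>(v, w)\<in>?L. T w v)"
    by (rule sum.reindex_bij_witness[of _ "\<lambda>(v, w). (w, v)" "\<lambda>(v, w). (w, v)"]) auto
  also have "(\<Sum>(v, w)\<in>?L. T w v) = - (\<Sum>(v, w)\<in>?L. T v w)"
    unfolding sum_negf[symmetric]
  proof (rule sum.cong)
    fix x assume "x \<in> ?L"
    then obtain v w where x: "x = (v, w)" and "v \<in> A" "w \<in> A" "r v < r w" by auto
    then have "T w v = - T v w" by (intro anti) auto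
    then show "(case x of (v, w) \<Rightarrow> T w v) = - (case x of (v, w) \<Rightarrow> T v w)" by (simp add: x)
  qed simp
  finally show ?thesis by simp
qed

text \<open>A chain with values in a module is a function on sets of vertices; its part of homological degree \<open>p\<close> is
the restriction to sets of cardinality \<open>p\<close>.\<close>

definition koszul_d :: "'v set \<Rightarrow> ('v \<Rightarrow> nat) \<Rightarrow> ('v set \<Rightarrow> ('v, 'k::field) vec) \<Rightarrow> 'v set \<Rightarrow> ('v, 'k) vec" where
  "koszul_d X r z \<tau> = (\<Sum>v\<in>X - \<tau>. (koszul_sign r v \<tau> * var v) \<odot> z (insert v \<tau>))"

lemma koszul_d_cong: "(\<And>v. v \<in> X - \<tau> \<Longrightarrow> y (insert v \<tau>) = z (insert v \<tau>)) \<Longrightarrow> koszul_d X r y \<tau> = koszul_d X r z \<tau>"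
  by (simp add: koszul_d_def)

lemma koszul_d_diff: "koszul_d X r (\<lambda>\<sigma>. y \<sigma> - z \<sigma>) \<tau> = koszul_d X r y \<tau> - koszul_d X r z \<tau>"
  by (simp add: koszul_d_def smul_diff sum_subtractf)

lemma koszul_d_lin: "koszul_d X r (\<lambda>\<sigma>. lin_ext g (z \<sigma>)) \<tau> = lin_ext g (koszul_d X r z \<tau>)"
  by (simp add: koszul_d_def lin_ext_sum lin_ext_smul)

lemma koszul_d_in_submodule:
  assumes "submodule X M" "\<And>v. v \<in> X - \<tau> \<Longrightarrow> z (insert v \<tau>) \<in> M"
  shows "koszul_d X r z \<tau> \<in> M"
  unfolding koszul_d_def using assms
  by (intro submodule_sum[of X M] submodule_smul[of X M]) (auto simp: koszul_sign_def intro!: poly_ring_mult)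

lemma koszul_d_homog:
  assumes "\<And>v. v \<in> X - \<tau> \<Longrightarrow> homog s (Suc p) j (z (insert v \<tau>))"
  shows "homog s p j (koszul_d X r z \<tau>)"
  unfolding koszul_d_def koszul_sign_def smul_smul[symmetric] using assms
  by (intro homog_sum homog_sign homog_var) auto

lemma koszul_d_twice:
  assumes "finite X" "inj_on r X" "\<tau> \<subseteq> X"
  shows "koszul_d X r (koszul_d X r z) \<tau> = 0"
proof -
  have fin: "finite \<tau>" using assms(3,1) by (rule finite_subset)
  let ?T = "\<lambda>v w. (koszul_sign r v \<tau> * koszul_sign r w (insert v \<tau>) * (var v * var w)) \<odot> z (insert w (insert v \<tau>))"
  have "koszul_d X r (koszul_d X r z) \<tau> = (\<Sum>v\<in>X - \<tau>. \<Sum>w\<in>X - insert v \<tau>. ?T v w)"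
    by (simp add: koszul_d_def smul_sum smul_smul mult_ac)
  also have "\<dots> = (\<Sum>v\<in>X - \<tau>. \<Sum>w\<in>(X - \<tau>) - {v}. ?T v w)"
    by (intro sum.cong) auto
  also have "\<dots> = 0"
  proof (rule antisymmetric_double_sum[of _ r])
    fix v w assume v: "v \<in> X - \<tau>" and w: "w \<in> X - \<tau>" and "v \<noteq> w"
    then have "r v \<noteq> r w" using assms(2) by (auto dest: inj_onD)
    then have "koszul_sign r v \<tau> * koszul_sign r w (insert v \<tau>) = - (koszul_sign r w \<tau> * koszul_sign r v (insert w \<tau>) :: ('a, 'b) mpoly)"
      using v w fin by (auto simp: koszul_sign_insert)
    then show "?T v w = - ?T w v"
      by (simp add: insert_commute mult.commute uminus_smul[symmetric])
  qed (use assms in \<open>auto intro: inj_on_subset\<close>)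
  finally show ?thesis .
qed

subsection \<open>Multidegrees\<close>

text \<open>In a fixed multidegree \<open>u\<close> only one monomial can stand in front of \<open>\<sigma>\<close>, namely \<open>u - chi \<sigma>\<close>. What remains
of a chain is a scalar for each \<open>\<sigma>\<close>, and the Koszul differential becomes a simplicial boundary.\<close>

definition scalar_d :: "('v \<Rightarrow> nat) \<Rightarrow> 'v set \<Rightarrow> ('v set \<Rightarrow> 'k::field) \<Rightarrow> 'v set \<Rightarrow> 'k" where
  "scalar_d r U c \<tau> = (\<Sum>v\<in>U - \<tau>. koszul_sign r v \<tau> * c (insert v \<tau>))"

lemma scalar_d_cong: "(\<And>v. v \<in> U - \<tau> \<Longrightarrow> c (insert v \<tau>) = e (insert v \<tau>)) \<Longrightarrow> scalar_d r U c \<tau> = scalar_d r U e \<tau>"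
  by (simp add: scalar_d_def)

lemma scalar_d_add: "scalar_d r U (\<lambda>\<sigma>. c \<sigma> + e \<sigma>) \<tau> = scalar_d r U c \<tau> + scalar_d r U e \<tau>"
  by (simp add: scalar_d_def sum.distrib algebra_simps)
lemma scalar_d_diff: "scalar_d r U (\<lambda>\<sigma>. c \<sigma> - e \<sigma>) \<tau> = scalar_d r U c \<tau> - scalar_d r U e \<tau>"
  by (simp add: scalar_d_def sum_subtractf algebra_simps)

lemma scalar_d_twice:
  assumes "finite U" "inj_on r U" "\<tau> \<subseteq> U"
  shows "scalar_d r U (scalar_d r U c) \<tau> = 0"
proof -
  have fin: "finite \<tau>" using assms(3,1) by (rule finite_subset)
  let ?T = "\<lambda>v w. koszul_sign r v \<tau> * koszul_sign r w (insert v \<tau>) * c (insert w (insert v \<tau>))"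
  have "scalar_d r U (scalar_d r U c) \<tau> = (\<Sum>v\<in>U - \<tau>. \<Sum>w\<in>U - insert v \<tau>. ?T v w)"
    by (simp add: scalar_d_def sum_distrib_left mult_ac)
  also have "\<dots> = (\<Sum>v\<in>U - \<tau>. \<Sum>w\<in>(U - \<tau>) - {v}. ?T v w)"
    by (intro sum.cong) auto
  also have "\<dots> = 0"
  proof (rule antisymmetric_double_sum[of _ r])
    fix v w assume v: "v \<in> U - \<tau>" and w: "w \<in> U - \<tau>" and "v \<noteq> w"
    then have "r v \<noteq> r w" using assms(2) by (auto dest: inj_onD)
    then have "koszul_sign r v \<tau> * koszul_sign r w (insert v \<tau>) = - (koszul_sign r w \<tau> * koszul_sign r v (insert w \<tau>) :: 'b)"
      using v w fin by (auto simp: koszul_sign_insert)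
    then show "?T v w = - ?T w v"
      by (simp add: insert_commute)
  qed (use assms in \<open>auto intro: inj_on_subset\<close>)
  finally show ?thesis .
qed

definition cone :: "('v \<Rightarrow> nat) \<Rightarrow> 'v \<Rightarrow> ('v set \<Rightarrow> 'k::field) \<Rightarrow> 'v set \<Rightarrow> 'k" where
  "cone r v c \<sigma> = (if v \<in> \<sigma> then koszul_sign r v (\<sigma> - {v}) * c (\<sigma> - {v}) else 0)"

text \<open>The usual contraction of a simplex: \<open>d h + h d = id\<close> for the cone operator \<open>h\<close> with apex \<open>v\<close>.\<close>

lemma scalar_d_cone:
  assumes "finite U" "inj_on r U" "v \<in> U" "\<sigma> \<subseteq> U"
  shows "scalar_d r U (cone r v c) \<sigma> = c \<sigma> - cone r v (scalar_d r U c) \<sigma>"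
proof (cases "v \<in> \<sigma>")
  case False
  have "scalar_d r U (cone r v c) \<sigma> = (\<Sum>w\<in>U - \<sigma>. if w = v then c \<sigma> else 0)"
    unfolding scalar_d_def using False by (intro sum.cong) (auto simp: cone_def)
  also have "\<dots> = c \<sigma>" using assms False by simp
  finally show ?thesis using False by (simp add: cone_def)
next
  case True
  define \<rho> where "\<rho> = \<sigma> - {v}"
  have \<sigma>: "\<sigma> = insert v \<rho>" and v: "v \<notin> \<rho>" using True by (auto simp: \<rho>_def)
  have fin: "finite \<rho>" by (rule finite_subset[of _ U]) (use assms in \<open>auto simp: \<rho>_def\<close>)
  have "scalar_d r U (cone r v c) \<sigma> = (\<Sum>w\<in>U - \<sigma>. - (koszul_sign r v \<rho> * (koszul_sign r w \<rho> * c (insert w \<rho>))))"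
    unfolding scalar_d_def
  proof (rule sum.cong)
    fix w assume w: "w \<in> U - \<sigma>"
    then have "r v \<noteq> r w" "w \<noteq> v" using assms \<sigma> by (auto dest: inj_onD)
    moreover from this have "insert w \<sigma> - {v} = insert w \<rho>" using \<sigma> v by auto
    ultimately have "cone r v c (insert w \<sigma>) = koszul_sign r v (insert w \<rho>) * c (insert w \<rho>)"
      using True by (simp add: cone_def)
    moreover have "koszul_sign r w \<sigma> * koszul_sign r v (insert w \<rho>) = - (koszul_sign r v \<rho> * koszul_sign r w \<rho> :: 'b)"
      using \<open>r v \<noteq> r w\<close> w v fin by (auto simp: \<sigma> koszul_sign_insert)
    ultimately show "koszul_sign r w \<sigma> * cone r v c (insert w \<sigma>) = - (koszul_sign r v \<rho> * (koszul_sign r w \<rho> * c (insert w \<rho>)))"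
      by (simp only: mult.assoc[symmetric] mult_minus_left)
  qed simp
  moreover have "scalar_d r U c \<rho> = koszul_sign r v \<rho> * c \<sigma> + (\<Sum>w\<in>U - \<sigma>. koszul_sign r w \<rho> * c (insert w \<rho>))"
  proof -
    have "U - \<rho> = insert v (U - \<sigma>)" using assms \<sigma> v by auto
    then have "scalar_d r U c \<rho> = (\<Sum>w\<in>insert v (U - \<sigma>). koszul_sign r w \<rho> * c (insert w \<rho>))"
      by (simp only: scalar_d_def)
    also have "\<dots> = koszul_sign r v \<rho> * c (insert v \<rho>) + (\<Sum>w\<in>U - \<sigma>. koszul_sign r w \<rho> * c (insert w \<rho>))"
      using assms(1) True by (intro sum.insert) auto
    finally show ?thesis by (simp only: \<sigma>[symmetric])
  qed
  moreover have "cone r v (scalar_d r U c) \<sigma> = koszul_sign r v \<rho> * scalar_d r U c \<rho>"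
    using True by (simp add: cone_def \<rho>_def)
  ultimately show ?thesis
    by (simp add: sum_negf sum_distrib_left[symmetric] distrib_left)
qed

text \<open>The squarefree monomial with support \<open>\<sigma>\<close>.\<close>

definition chi :: "'v set \<Rightarrow> 'v monomial" where
  "chi \<sigma> = (\<Sum>v\<in>\<sigma>. single v 1)"

lemma lookup_chi: "finite \<sigma> \<Longrightarrow> lookup (chi \<sigma>) v = (if v \<in> \<sigma> then 1 else 0)"
  by (simp add: chi_def lookup_sum lookup_single when_def)

lemma keys_chi: "finite \<sigma> \<Longrightarrow> keys (chi \<sigma>) = \<sigma>"
  by (auto simp: in_keys_iff lookup_chi split: if_splits)

lemma mdegree_chi: "finite \<sigma> \<Longrightarrow> mdegree (chi \<sigma>) = card \<sigma>"
  by (simp add: mdegree_def keys_chi lookup_chi)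

lemma minus_chi_add_chi:
  assumes "\<sigma> \<subseteq> keys u"
  shows "u - chi \<sigma> + chi \<sigma> = u"
proof -
  have "finite \<sigma>" using assms by (rule finite_subset) simp
  then show ?thesis using assms
    by (intro poly_mapping_eqI) (auto simp: lookup_add lookup_minus lookup_chi in_keys_iff subset_iff)
qed

lemma keys_diff_nat_subset: "keys (u - m) \<subseteq> keys (u :: 'v monomial)"
  by (auto simp: in_keys_iff lookup_minus)

text \<open>For the ideal of the monomials that satisfy \<open>P\<close>, these faces form the upper Koszul simplicial complex in
multidegree \<open>u\<close>.\<close>

definition koszul_face :: "('v monomial \<Rightarrow> bool) \<Rightarrow> 'v monomial \<Rightarrow> 'v set \<Rightarrow> bool" where
  "koszul_face P u \<sigma> \<longleftrightarrow> \<sigma> \<subseteq> keys u \<and> P (u - chi \<sigma>)"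

definition scalar_cycle :: "('v \<Rightarrow> nat) \<Rightarrow> ('v monomial \<Rightarrow> bool) \<Rightarrow> 'v monomial \<Rightarrow> nat \<Rightarrow> ('v set \<Rightarrow> 'k::field) \<Rightarrow> bool" where
  "scalar_cycle r P u p c \<longleftrightarrow>
     (\<forall>\<sigma>. c \<sigma> \<noteq> 0 \<longrightarrow> koszul_face P u \<sigma> \<and> card \<sigma> = p) \<and> (\<forall>\<tau>\<subseteq>keys u. scalar_d r (keys u) c \<tau> = 0)"

definition scalar_boundary :: "('v \<Rightarrow> nat) \<Rightarrow> ('v monomial \<Rightarrow> bool) \<Rightarrow> 'v monomial \<Rightarrow> nat \<Rightarrow> ('v set \<Rightarrow> 'k::field) \<Rightarrow> bool" where
  "scalar_boundary r P u p c \<longleftrightarrow>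
     (\<exists>f. (\<forall>\<sigma>. f \<sigma> \<noteq> 0 \<longrightarrow> koszul_face P u \<sigma> \<and> card \<sigma> = Suc p) \<and> (\<forall>\<sigma>\<subseteq>keys u. scalar_d r (keys u) f \<sigma> = c \<sigma>))"

lemma lookup_sign_mult: "lookup (koszul_sign r v \<tau> * q) m = koszul_sign r v \<tau> * lookup q m"
proof -
  have "lookup ((-1) ^ n * q) m = (-1) ^ n * lookup q m" for n by (induction n) auto
  then show ?thesis by (simp add: koszul_sign_def)
qed

lemma lookup_koszul_d:
  assumes "finite X"
  shows "lookup (lookup (koszul_d X r z \<tau>) b) m =
    (\<Sum>v\<in>(X - \<tau>) \<inter> keys m. koszul_sign r v \<tau> * lookup (lookup (z (insert v \<tau>)) b) (m - single v 1))"
proof -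
  have "lookup (lookup (koszul_d X r z \<tau>) b) m =
      (\<Sum>v\<in>X - \<tau>. if v \<in> keys m then koszul_sign r v \<tau> * lookup (lookup (z (insert v \<tau>)) b) (m - single v 1) else 0)"
    unfolding koszul_d_def lookup_sum by (intro sum.cong) (simp_all add: mult.assoc lookup_sign_mult lookup_var_mult)
  then show ?thesis using assms by (simp add: sum.inter_restrict del: One_nat_def)
qed

lemma scalar_d_coefficients:
  assumes "finite X" "keys u \<subseteq> X" "\<sigma> \<subseteq> keys u"
  shows "scalar_d r (keys u) (\<lambda>\<rho>. lookup (lookup (z \<rho>) b) (u - chi \<rho>)) \<sigma> = lookup (lookup (koszul_d X r z \<sigma>) b) (u - chi \<sigma>)"
proof -
  have fin: "finite \<sigma>" using assms(3) by (rule finite_subset) simp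
  have "(X - \<sigma>) \<inter> keys (u - chi \<sigma>) = keys u - \<sigma>"
    using assms(2) fin by (auto simp: in_keys_iff lookup_minus lookup_chi subset_iff split: if_splits)
  moreover have "u - chi \<sigma> - single v 1 = u - chi (insert v \<sigma>)" if "v \<notin> \<sigma>" for v
    using fin that by (intro poly_mapping_eqI) (auto simp: lookup_minus lookup_chi lookup_single when_def)
  ultimately show ?thesis unfolding lookup_koszul_d[OF assms(1)] scalar_d_def by simp
qed

text \<open>The Koszul complex of a module that is spanned by monomials is the direct sum of its multigraded parts.
A given chain lives in finitely many of them, so boundaries found in each part add up to a boundary. The
last conclusion says that no new multidegree comes in, which keeps homogeneous chains homogeneous.\<close>

lemma koszul_assemble:
  fixes z :: "'v set \<Rightarrow> ('v, 'k::field) vec"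
  assumes fin: "finite X"
    and zP: "\<And>\<sigma> b m. \<sigma> \<subseteq> X \<Longrightarrow> card \<sigma> = p \<Longrightarrow> lookup (lookup (z \<sigma>) b) m \<noteq> 0 \<Longrightarrow> P b m \<and> keys m \<subseteq> X"
    and cyc: "\<And>\<tau>. \<tau> \<subseteq> X \<Longrightarrow> Suc (card \<tau>) = p \<Longrightarrow> koszul_d X r z \<tau> = 0"
    and exact: "\<And>\<sigma> b m c. \<sigma> \<subseteq> X \<Longrightarrow> card \<sigma> = p \<Longrightarrow> lookup (lookup (z \<sigma>) b) m \<noteq> 0 \<Longrightarrow>
        scalar_cycle r (P b) (m + chi \<sigma>) p (c :: 'v set \<Rightarrow> 'k) \<Longrightarrow> scalar_boundary r (P b) (m + chi \<sigma>) p c"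
  obtains y where "\<And>\<sigma>. \<sigma> \<subseteq> X \<Longrightarrow> card \<sigma> = p \<Longrightarrow> koszul_d X r y \<sigma> = z \<sigma>"
    and "\<And>\<sigma> b m. lookup (lookup (y \<sigma>) b) m \<noteq> 0 \<Longrightarrow> P b m \<and> keys m \<subseteq> X \<and> \<sigma> \<subseteq> X \<and> card \<sigma> = Suc p \<and>
        (\<exists>\<sigma>' m'. \<sigma>' \<subseteq> X \<and> card \<sigma>' = p \<and> lookup (lookup (z \<sigma>') b) m' \<noteq> 0 \<and> m' + chi \<sigma>' = m + chi \<sigma>)"
proof -
  \<comment> \<open>the basis vectors and multidegrees in which \<open>z\<close> lives\<close>
  define S where "S = {(b, m + chi \<sigma>) | \<sigma> b m. \<sigma> \<subseteq> X \<and> card \<sigma> = p \<and> lookup (lookup (z \<sigma>) b) m \<noteq> 0}"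
  have "S \<subseteq> (\<Union>\<sigma>\<in>Pow X. \<Union>b\<in>keys (z \<sigma>). (\<lambda>m. (b, m + chi \<sigma>)) ` keys (lookup (z \<sigma>) b))"
    unfolding S_def by (fastforce simp: in_keys_iff)
  then have finS: "finite S" by (rule finite_subset) (simp add: fin)
  have finsub: "finite \<sigma>" if "\<sigma> \<subseteq> X" for \<sigma> using that fin by (rule finite_subset)
  have S_X: "keys u \<subseteq> X" if "(b, u) \<in> S" for b u
  proof -
    from that obtain \<sigma> m where u: "u = m + chi \<sigma>" and \<sigma>: "\<sigma> \<subseteq> X" "card \<sigma> = p" "lookup (lookup (z \<sigma>) b) m \<noteq> 0"
      unfolding S_def by blast
    then show ?thesis using zP[OF \<sigma>] by (simp add: keys_add_nat keys_chi finsub)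
  qed
  define c where "c = (\<lambda>b u \<sigma>. if \<sigma> \<subseteq> keys u \<and> card \<sigma> = p then lookup (lookup (z \<sigma>) b) (u - chi \<sigma>) else 0)"
  have "\<exists>f. (\<forall>\<sigma>. f \<sigma> \<noteq> 0 \<longrightarrow> koszul_face (P b) u \<sigma> \<and> card \<sigma> = Suc p) \<and>
      (\<forall>\<sigma>\<subseteq>keys u. scalar_d r (keys u) f \<sigma> = c b u \<sigma>)" if S: "(b, u) \<in> S" for b u
  proof -
    have uX: "keys u \<subseteq> X" using S_X[OF S] .
    have "scalar_cycle r (P b) u p (c b u)"
      unfolding scalar_cycle_def
    proof (intro conjI allI impI)
      fix \<sigma> assume "c b u \<sigma> \<noteq> 0"
      then have "\<sigma> \<subseteq> keys u" "card \<sigma> = p" "lookup (lookup (z \<sigma>) b) (u - chi \<sigma>) \<noteq> 0"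
        by (auto simp: c_def split: if_splits)
      moreover from this have "P b (u - chi \<sigma>)" using zP[of \<sigma> b "u - chi \<sigma>"] uX by blast
      ultimately show "koszul_face (P b) u \<sigma>" "card \<sigma> = p" by (auto simp: koszul_face_def)
    next
      fix \<tau> assume \<tau>: "\<tau> \<subseteq> keys u"
      then have fin\<tau>: "finite \<tau>" using finsub uX by auto
      show "scalar_d r (keys u) (c b u) \<tau> = 0"
      proof (cases "Suc (card \<tau>) = p")
        case True
        have "scalar_d r (keys u) (c b u) \<tau> = scalar_d r (keys u) (\<lambda>\<rho>. lookup (lookup (z \<rho>) b) (u - chi \<rho>)) \<tau>"
          using \<tau> fin\<tau> True by (intro scalar_d_cong) (auto simp: c_def)
        also have "\<dots> = 0"
          using scalar_d_coefficients[OF fin uX \<tau>, of r z b] cyc[of \<tau>] True \<tau> uX by auto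
        finally show ?thesis .
      next
        case False
        then show ?thesis using fin\<tau> by (auto simp: scalar_d_def c_def intro!: sum.neutral)
      qed
    qed
    moreover obtain \<sigma> m where "u = m + chi \<sigma>" "\<sigma> \<subseteq> X" "card \<sigma> = p" "lookup (lookup (z \<sigma>) b) m \<noteq> 0"
      using S by (auto simp: S_def)
    ultimately have "scalar_boundary r (P b) u p (c b u)" using exact by blast
    then show ?thesis unfolding scalar_boundary_def .
  qed
  then obtain f where f: "\<And>b u \<sigma>. (b, u) \<in> S \<Longrightarrow> f b u \<sigma> \<noteq> 0 \<Longrightarrow> koszul_face (P b) u \<sigma> \<and> card \<sigma> = Suc p"
    and df: "\<And>b u \<sigma>. (b, u) \<in> S \<Longrightarrow> \<sigma> \<subseteq> keys u \<Longrightarrow> scalar_d r (keys u) (f b u) \<sigma> = c b u \<sigma>"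
    by metis
  define y where "y = (\<lambda>\<sigma>. \<Sum>(b, u)\<in>S. single b (single (u - chi \<sigma>) (f b u \<sigma>)))"
  have y_coeff: "lookup (lookup (y \<sigma>) b) (u - chi \<sigma>) = (if (b, u) \<in> S then f b u \<sigma> else 0)" if "\<sigma> \<subseteq> keys u" for \<sigma> b u
  proof -
    have "lookup (lookup (y \<sigma>) b) (u - chi \<sigma>) = (\<Sum>x\<in>S. if x = (b, u) then f b u \<sigma> else 0)"
      unfolding y_def lookup_sum
    proof (rule sum.cong)
      fix x assume x: "x \<in> S"
      obtain b' u' where x': "x = (b', u')" by fastforce
      show "lookup (lookup (case x of (b, u) \<Rightarrow> single b (single (u - chi \<sigma>) (f b u \<sigma>))) b) (u - chi \<sigma>)
          = (if x = (b, u) then f b u \<sigma> else 0)"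
      proof (cases "b' = b \<and> u' - chi \<sigma> = u - chi \<sigma> \<and> f b' u' \<sigma> \<noteq> 0")
        case True
        then have "\<sigma> \<subseteq> keys u'" using f x x' by (auto simp: koszul_face_def)
        then have "u' = u" using True minus_chi_add_chi that by metis
        then show ?thesis using True x' by simp
      next
        case False
        then show ?thesis by (auto simp: x' lookup_single when_def)
      qed
    qed simp
    then show ?thesis using finS by simp
  qed
  have y_supp: "\<sigma> \<subseteq> keys (m + chi \<sigma>) \<and> (b, m + chi \<sigma>) \<in> S \<and> f b (m + chi \<sigma>) \<sigma> \<noteq> 0"
    if "lookup (lookup (y \<sigma>) b) m \<noteq> 0" for \<sigma> b m
  proof -
    from that obtain b' u where S: "(b', u) \<in> S" and "lookup (lookup (single b' (single (u - chi \<sigma>) (f b' u \<sigma>))) b) m \<noteq> 0"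
      unfolding y_def lookup_sum by (metis (no_types, lifting) case_prod_conv surj_pair sum.neutral)
    then have eq: "b' = b" "u - chi \<sigma> = m" and nz: "f b' u \<sigma> \<noteq> 0"
      by (auto simp: lookup_single when_def split: if_splits)
    from f[OF S nz] have "\<sigma> \<subseteq> keys u" by (simp add: koszul_face_def)
    then have "u = m + chi \<sigma>" using eq minus_chi_add_chi by metis
    then show ?thesis using S nz eq \<open>\<sigma> \<subseteq> keys u\<close> by simp
  qed
  show ?thesis
  proof (rule that[of y])
    fix \<sigma> b m assume nz: "lookup (lookup (y \<sigma>) b) m \<noteq> 0"
    let ?u = "m + chi \<sigma>"
    have *: "\<sigma> \<subseteq> keys ?u" "(b, ?u) \<in> S" "f b ?u \<sigma> \<noteq> 0" using y_supp[OF nz] by auto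
    have "keys ?u \<subseteq> X" using * S_X by auto
    then have "keys m \<subseteq> X" "\<sigma> \<subseteq> X" using * by (auto simp: keys_add_nat)
    moreover have "P b m" "card \<sigma> = Suc p" using f[OF *(2,3)] by (auto simp: koszul_face_def)
    moreover have "\<exists>\<sigma>' m'. \<sigma>' \<subseteq> X \<and> card \<sigma>' = p \<and> lookup (lookup (z \<sigma>') b) m' \<noteq> 0 \<and> m' + chi \<sigma>' = ?u"
      using *(2) by (force simp: S_def)
    ultimately show "P b m \<and> keys m \<subseteq> X \<and> \<sigma> \<subseteq> X \<and> card \<sigma> = Suc p \<and>
        (\<exists>\<sigma>' m'. \<sigma>' \<subseteq> X \<and> card \<sigma>' = p \<and> lookup (lookup (z \<sigma>') b) m' \<noteq> 0 \<and> m' + chi \<sigma>' = ?u)"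
      by blast
  next
    fix \<sigma> assume \<sigma>: "\<sigma> \<subseteq> X" "card \<sigma> = p"
    show "koszul_d X r y \<sigma> = z \<sigma>"
    proof (rule vec_eqI)
      fix b m
      let ?u = "m + chi \<sigma>"
      have sub: "\<sigma> \<subseteq> keys ?u" using finsub[OF \<sigma>(1)] by (auto simp: keys_add_nat keys_chi)
      have m: "m = ?u - chi \<sigma>" by simp
      show "lookup (lookup (koszul_d X r y \<sigma>) b) m = lookup (lookup (z \<sigma>) b) m"
      proof (cases "keys m \<subseteq> X")
        case True
        then have uX: "keys ?u \<subseteq> X" using \<sigma> finsub by (auto simp: keys_add_nat keys_chi)
        have "lookup (lookup (koszul_d X r y \<sigma>) b) m = scalar_d r (keys ?u) (\<lambda>\<rho>. lookup (lookup (y \<rho>) b) (?u - chi \<rho>)) \<sigma>"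
          using scalar_d_coefficients[OF fin uX sub, of r y b] by simp
        also have "\<dots> = scalar_d r (keys ?u) (\<lambda>\<rho>. if (b, ?u) \<in> S then f b ?u \<rho> else 0) \<sigma>"
          using sub by (intro scalar_d_cong y_coeff) auto
        also have "\<dots> = lookup (lookup (z \<sigma>) b) m"
        proof (cases "(b, ?u) \<in> S")
          case True
          then show ?thesis using df[OF True sub] sub \<sigma> by (simp add: c_def)
        next
          case False
          then have "lookup (lookup (z \<sigma>) b) m = 0" using \<sigma> by (auto simp: S_def)
          then show ?thesis using False by (simp add: scalar_d_def)
        qed
        finally show ?thesis .
      next
        case False
        have "lookup (lookup (y (insert v \<sigma>)) b) (m - single v 1) = 0" if "v \<in> X" "v \<in> keys m" for v
        proof (rule ccontr)
          assume "lookup (lookup (y (insert v \<sigma>)) b) (m - single v 1) \<noteq> 0"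
          then have "keys (m - single v 1 + chi (insert v \<sigma>)) \<subseteq> X" using y_supp S_X by blast
          then have "keys (m - single v 1) \<subseteq> X" by (auto simp: keys_add_nat)
          moreover have "keys m \<subseteq> insert v (keys (m - single v 1))"
            by (auto simp: in_keys_iff lookup_minus lookup_single when_def split: if_splits)
          ultimately show False using False that by auto
        qed
        then have "lookup (lookup (koszul_d X r y \<sigma>) b) m = 0" by (auto simp: lookup_koszul_d[OF fin] intro!: sum.neutral)
        moreover have "lookup (lookup (z \<sigma>) b) m = 0" using zP \<sigma> False by blast
        ultimately show ?thesis by simp
      qed
    qed
  qed
qed

text \<open>The hypothesis on \<open>P\<close> says that the complex is a cone with apex \<open>v\<close>.\<close>

lemma cone_bounds:
  assumes c: "scalar_cycle r P u p c" and u: "v \<in> keys u" "inj_on r (keys u)"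
    and P: "\<And>\<sigma>. v \<notin> \<sigma> \<Longrightarrow> koszul_face P u \<sigma> \<Longrightarrow> P (u - chi (insert v \<sigma>))"
  shows "scalar_boundary r P u p c"
  unfolding scalar_boundary_def
proof (intro exI[of _ "cone r v c"] conjI allI impI)
  fix \<sigma> assume "cone r v c \<sigma> \<noteq> 0"
  then have v: "v \<in> \<sigma>" and "c (\<sigma> - {v}) \<noteq> 0" by (auto simp: cone_def split: if_splits)
  then have f: "koszul_face P u (\<sigma> - {v})" and card: "card (\<sigma> - {v}) = p" using c by (auto simp: scalar_cycle_def)
  then have "\<sigma> \<subseteq> keys u" using u by (auto simp: koszul_face_def)
  moreover from this have "finite \<sigma>" by (rule finite_subset) simp
  moreover have "P (u - chi \<sigma>)" using P[OF _ f] v by (simp add: insert_absorb)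
  ultimately show "koszul_face P u \<sigma>" "card \<sigma> = Suc p"
    using card.remove[of \<sigma> v] v unfolding card koszul_face_def by blast+
next
  fix \<sigma> assume \<sigma>: "\<sigma> \<subseteq> keys u"
  then have "scalar_d r (keys u) c (\<sigma> - {v}) = 0" using c unfolding scalar_cycle_def by blast
  then have "cone r v (scalar_d r (keys u) c) \<sigma> = 0" by (simp add: cone_def)
  then show "scalar_d r (keys u) (cone r v c) \<sigma> = c \<sigma>"
    using scalar_d_cone[OF finite_keys u(2,1) \<sigma>, of c] by simp
qed

text \<open>For a free module all subsets of \<open>keys u\<close> are faces, so the complex in multidegree \<open>u\<close> is a simplex and
every vertex can serve as an apex. Only \<open>u = 0\<close> has no vertex; it occurs in homological degree 0 alone,
where it is excluded by asking for a vanishing constant term. In that case the lemma says that a vector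
without constant terms is a combination of multiples of the variables.\<close>

lemma koszul_exact_free:
  fixes z :: "'v set \<Rightarrow> ('v, 'k::field) vec"
  assumes fin: "finite X" and r: "inj_on r X"
    and z: "\<And>\<sigma>. \<sigma> \<subseteq> X \<Longrightarrow> card \<sigma> = p \<Longrightarrow> z \<sigma> \<in> free_module X B"
    and cyc: "\<And>\<tau>. \<tau> \<subseteq> X \<Longrightarrow> Suc (card \<tau>) = p \<Longrightarrow> koszul_d X r z \<tau> = 0"
    and p0: "p = 0 \<Longrightarrow> (\<And>b. lookup (lookup (z {}) b) 0 = 0)"
  obtains w where "\<And>\<sigma>. \<sigma> \<subseteq> X \<Longrightarrow> card \<sigma> = p \<Longrightarrow> koszul_d X r w \<sigma> = z \<sigma>"
    and "\<And>\<sigma>. w \<sigma> \<in> free_module X B" and "\<And>s j \<sigma>. (\<And>\<rho>. \<rho> \<subseteq> X \<Longrightarrow> card \<rho> = p \<Longrightarrow> homog s p j (z \<rho>)) \<Longrightarrow> homog s (Suc p) j (w \<sigma>)"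
proof -
  have finsub: "finite \<sigma>" if "\<sigma> \<subseteq> X" for \<sigma> using that fin by (rule finite_subset)
  define P where "P = (\<lambda>b (m :: 'v monomial). b \<in> B \<and> keys m \<subseteq> X)"
  obtain y where y: "\<And>\<sigma>. \<sigma> \<subseteq> X \<Longrightarrow> card \<sigma> = p \<Longrightarrow> koszul_d X r y \<sigma> = z \<sigma>"
    and ys: "\<And>\<sigma> b m. lookup (lookup (y \<sigma>) b) m \<noteq> 0 \<Longrightarrow> P b m \<and> keys m \<subseteq> X \<and> \<sigma> \<subseteq> X \<and> card \<sigma> = Suc p \<and>
        (\<exists>\<sigma>' m'. \<sigma>' \<subseteq> X \<and> card \<sigma>' = p \<and> lookup (lookup (z \<sigma>') b) m' \<noteq> 0 \<and> m' + chi \<sigma>' = m + chi \<sigma>)"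
  proof (rule koszul_assemble[OF fin, of p z P r])
    fix \<sigma> b m and c :: "'v set \<Rightarrow> 'k"
    assume \<sigma>: "\<sigma> \<subseteq> X" "card \<sigma> = p" and nz: "lookup (lookup (z \<sigma>) b) m \<noteq> 0" and c: "scalar_cycle r (P b) (m + chi \<sigma>) p c"
    have bm: "b \<in> B" "keys m \<subseteq> X" using z[OF \<sigma>] nz by (auto simp: free_module_iff)
    then have uX: "keys (m + chi \<sigma>) \<subseteq> X" using \<sigma> finsub by (auto simp: keys_add_nat keys_chi)
    have "keys (m + chi \<sigma>) \<noteq> {}"
    proof
      assume "keys (m + chi \<sigma>) = {}"
      then have "m = 0" "\<sigma> = {}" using finsub[OF \<sigma>(1)] by (auto simp: keys_add_nat keys_chi)
      then show False using p0 nz \<sigma> by auto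
    qed
    then obtain v where v: "v \<in> keys (m + chi \<sigma>)" by blast
    show "scalar_boundary r (P b) (m + chi \<sigma>) p c"
    proof (rule cone_bounds[OF c v inj_on_subset[OF r uX]])
      show "P b (m + chi \<sigma> - chi (insert v \<rho>))" for \<rho>
        unfolding P_def using bm(1) order_trans[OF keys_diff_nat_subset uX] by blast
    qed
  qed (use z cyc in \<open>auto simp: P_def free_module_iff\<close>)
  show ?thesis
  proof (rule that[of y])
    show "y \<sigma> \<in> free_module X B" for \<sigma> using ys by (auto simp: free_module_iff P_def)
  next
    fix s j \<sigma> assume hom: "\<And>\<rho>. \<rho> \<subseteq> X \<Longrightarrow> card \<rho> = p \<Longrightarrow> homog s p j (z \<rho>)"
    show "homog s (Suc p) j (y \<sigma>)"
      unfolding homog_def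
    proof (intro allI impI)
      fix b m assume "lookup (lookup (y \<sigma>) b) m \<noteq> 0"
      then obtain \<sigma>' m' where *: "\<sigma>' \<subseteq> X" "card \<sigma>' = p" "lookup (lookup (z \<sigma>') b) m' \<noteq> 0" "m' + chi \<sigma>' = m + chi \<sigma>"
        and "\<sigma> \<subseteq> X" "card \<sigma> = Suc p" using ys by blast
      have "mdegree m' + mdegree (chi \<sigma>') = mdegree m + mdegree (chi \<sigma>)"
        unfolding mdegree_add[symmetric] *(4) ..
      then have "mdegree m + Suc p = mdegree m' + p"
        using finsub[OF \<open>\<sigma> \<subseteq> X\<close>] finsub[OF *(1)] *(2) \<open>card \<sigma> = Suc p\<close>
        by (simp add: mdegree_chi)
      moreover have "mdegree m' + s b + p = j" using hom[OF *(1,2)] *(3) by (simp add: homog_def)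
      ultimately show "mdegree m + s b + Suc p = j" by simp
    qed
  qed (rule y)
qed

section \<open>Reading Betti numbers off the Koszul complex\<close>

text \<open>Vanishing of the \<open>p\<close>-th Koszul homology of \<open>M\<close> in total degree \<open>j\<close>. The chain \<open>y\<close> may be inhomogeneous;
if \<open>M\<close> is graded, the component of \<open>y\<close> in the right degree has the boundary \<open>z\<close> as well.\<close>

definition koszul_exact where
  "koszul_exact X r s M p j \<longleftrightarrow>
     (\<forall>z. (\<forall>\<sigma>\<subseteq>X. card \<sigma> = p \<longrightarrow> z \<sigma> \<in> M \<and> homog s p j (z \<sigma>)) \<and>
          (\<forall>\<tau>\<subseteq>X. Suc (card \<tau>) = p \<longrightarrow> koszul_d X r z \<tau> = 0) \<longrightarrow>
        (\<exists>y. (\<forall>\<sigma>\<subseteq>X. card \<sigma> = Suc p \<longrightarrow> y \<sigma> \<in> M) \<and> (\<forall>\<sigma>\<subseteq>X. card \<sigma> = p \<longrightarrow> koszul_d X r y \<sigma> = z \<sigma>)))"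

lemma koszul_exactE:
  assumes "koszul_exact X r s M p j"
    and "\<And>\<sigma>. \<sigma> \<subseteq> X \<Longrightarrow> card \<sigma> = p \<Longrightarrow> z \<sigma> \<in> M" "\<And>\<sigma>. \<sigma> \<subseteq> X \<Longrightarrow> card \<sigma> = p \<Longrightarrow> homog s p j (z \<sigma>)"
    and "\<And>\<tau>. \<tau> \<subseteq> X \<Longrightarrow> Suc (card \<tau>) = p \<Longrightarrow> koszul_d X r z \<tau> = 0"
  obtains y where "\<And>\<sigma>. \<sigma> \<subseteq> X \<Longrightarrow> card \<sigma> = Suc p \<Longrightarrow> y \<sigma> \<in> M"
    and "\<And>\<sigma>. \<sigma> \<subseteq> X \<Longrightarrow> card \<sigma> = p \<Longrightarrow> koszul_d X r y \<sigma> = z \<sigma>"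
proof -
  have "\<exists>y. (\<forall>\<sigma>\<subseteq>X. card \<sigma> = Suc p \<longrightarrow> y \<sigma> \<in> M) \<and> (\<forall>\<sigma>\<subseteq>X. card \<sigma> = p \<longrightarrow> koszul_d X r y \<sigma> = z \<sigma>)"
    using assms(1)[unfolded koszul_exact_def, rule_format, of z] assms(2-) by blast
  then show ?thesis using that by blast
qed

text \<open>One step of a minimal graded free resolution: the free module with basis \<open>B\<close>, in degrees \<open>s'\<close>, is mapped
onto \<open>M\<close>, and the kernel lies in \<open>\<mm>\<close> times the free module. Here \<open>M\<close> itself consists of vectors whose
basis is graded by \<open>s\<close>.\<close>

locale minimal_cover =
  fixes X :: "'v set" and r :: "'v \<Rightarrow> nat"
    and s :: "nat \<Rightarrow> nat" and M :: "('v, 'k::field) vec set"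
    and B :: "nat set" and s' :: "nat \<Rightarrow> nat" and g :: "nat \<Rightarrow> ('v, 'k) vec"
  assumes fin: "finite X" and r: "inj_on r X"
    and image: "lin_ext g ` free_module X B = M"
    and graded: "b \<in> B \<Longrightarrow> homog s 0 (s' b) (g b)"
    and minimal: "w \<in> lin_kernel X B g \<Longrightarrow> lookup (lookup w b) 0 = 0"
begin

lemma finsub: "\<sigma> \<subseteq> X \<Longrightarrow> finite \<sigma>"
  using fin by (rule rev_finite_subset)

lemma card_insert_sub: "v \<in> X - \<tau> \<Longrightarrow> \<tau> \<subseteq> X \<Longrightarrow> insert v \<tau> \<subseteq> X \<and> card (insert v \<tau>) = Suc (card \<tau>)"
  using finsub[of \<tau>] by auto

lemma lin_in_M: "w \<in> free_module X B \<Longrightarrow> lin_ext g w \<in> M"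
  using image by blast

lemma homog_lin_ext_g: "w \<in> free_module X B \<Longrightarrow> homog s' p j w \<Longrightarrow> homog s p j (lin_ext g w)"
  by (rule homog_lin[where B = B]) (auto simp: free_module_def graded)

lemma homog_lift:
  assumes "z \<in> M" "homog s p j z"
  obtains w where "w \<in> free_module X B" "homog s' p j w" "lin_ext g w = z"
proof (cases "p \<le> j")
  case True
  obtain w where w: "w \<in> free_module X B" "lin_ext g w = z" using assms(1) image by blast
  have "homog s 0 (j - p) z" using assms(2) True homog_shift[of s 0 p "j - p" z] by simp
  then have "z = hcomp s (j - p) (lin_ext g w)" using w by (simp add: hcomp_homog)
  also have "\<dots> = lin_ext g (hcomp s' (j - p) w)" using w graded by (intro hcomp_lin_ext)
  finally have "lin_ext g (hcomp s' (j - p) w) = z" ..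
  moreover have "homog s' p j (hcomp s' (j - p) w)"
    using homog_hcomp[of s' "j - p" w] True homog_shift[of s' 0 p "j - p" "hcomp s' (j - p) w"] by simp
  ultimately show ?thesis using that free_module_hcomp w by blast
next
  case False
  then have "z = 0" using assms(2) by (intro vec_eqI) (auto simp: homog_def)
  then show ?thesis using that[of 0] submodule_0[OF submodule_free_module, of X B] by simp
qed

text \<open>The connecting homomorphism identifies the Koszul homology of \<open>M\<close> in homological degree \<open>p + 1\<close> with that
of the kernel, the next syzygy module, in degree \<open>p\<close>. Indeed the free module in the middle has no
homology in positive degrees, and for \<open>p = 0\<close> minimality of the cover takes over. This lemma and the
next one are the two halves of this statement as far as vanishing is concerned.\<close>

lemma koszul_exact_kernelI:
  assumes "koszul_exact X r s M (Suc p) j"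
  shows "koszul_exact X r s' (lin_kernel X B g) p j"
  unfolding koszul_exact_def
proof (intro allI impI, elim conjE)
  fix z
  assume "\<forall>\<sigma>\<subseteq>X. card \<sigma> = p \<longrightarrow> z \<sigma> \<in> lin_kernel X B g \<and> homog s' p j (z \<sigma>)"
    and "\<forall>\<tau>\<subseteq>X. Suc (card \<tau>) = p \<longrightarrow> koszul_d X r z \<tau> = 0"
  then have zc: "\<And>\<tau>. \<tau> \<subseteq> X \<Longrightarrow> Suc (card \<tau>) = p \<Longrightarrow> koszul_d X r z \<tau> = 0"
    and zN: "\<And>\<sigma>. \<sigma> \<subseteq> X \<Longrightarrow> card \<sigma> = p \<Longrightarrow> z \<sigma> \<in> lin_kernel X B g"
    and zh: "\<And>\<sigma>. \<sigma> \<subseteq> X \<Longrightarrow> card \<sigma> = p \<Longrightarrow> homog s' p j (z \<sigma>)"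
    by auto
  obtain w where w: "\<And>\<sigma>. \<sigma> \<subseteq> X \<Longrightarrow> card \<sigma> = p \<Longrightarrow> koszul_d X r w \<sigma> = z \<sigma>"
    and wF: "\<And>\<sigma>. w \<sigma> \<in> free_module X B"
    and wh: "\<And>s j \<sigma>. (\<And>\<rho>. \<rho> \<subseteq> X \<Longrightarrow> card \<rho> = p \<Longrightarrow> homog s p j (z \<rho>)) \<Longrightarrow> homog s (Suc p) j (w \<sigma>)"
  proof (rule koszul_exact_free[OF fin r, of p z B])
    show "lookup (lookup (z {}) b) 0 = 0" if "p = 0" for b using minimal[OF zN] that by simp
  qed (use zN zc in \<open>auto simp: lin_kernel_def\<close>)
  obtain y where yM: "\<And>\<sigma>. \<sigma> \<subseteq> X \<Longrightarrow> card \<sigma> = Suc (Suc p) \<Longrightarrow> y \<sigma> \<in> M"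
    and y: "\<And>\<sigma>. \<sigma> \<subseteq> X \<Longrightarrow> card \<sigma> = Suc p \<Longrightarrow> koszul_d X r y \<sigma> = lin_ext g (w \<sigma>)"
  proof (rule koszul_exactE[OF assms, of "\<lambda>\<sigma>. lin_ext g (w \<sigma>)"])
    show "koszul_d X r (\<lambda>\<sigma>. lin_ext g (w \<sigma>)) \<tau> = 0" if "\<tau> \<subseteq> X" "Suc (card \<tau>) = Suc p" for \<tau>
      using zN[of \<tau>] w[of \<tau>] that by (simp add: koszul_d_lin lin_kernel_def)
  qed (use lin_in_M[OF wF] homog_lin_ext_g[OF wF wh[OF zh]] in auto)
  have "\<exists>u. u \<in> free_module X B \<and> lin_ext g u = y \<sigma>" if "\<sigma> \<subseteq> X" "card \<sigma> = Suc (Suc p)" for \<sigma>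
    using yM[OF that] image by auto
  then obtain u where uF: "\<And>\<sigma>. \<sigma> \<subseteq> X \<Longrightarrow> card \<sigma> = Suc (Suc p) \<Longrightarrow> u \<sigma> \<in> free_module X B"
    and u: "\<And>\<sigma>. \<sigma> \<subseteq> X \<Longrightarrow> card \<sigma> = Suc (Suc p) \<Longrightarrow> lin_ext g (u \<sigma>) = y \<sigma>"
    by metis
  \<comment> \<open>\<open>w\<close> has the boundary \<open>z\<close>, but its values are not in the kernel; their images bound, and \<open>u\<close> lifts what they bound\<close>
  define t where "t = (\<lambda>\<sigma>. w \<sigma> - koszul_d X r u \<sigma>)"
  show "\<exists>y. (\<forall>\<sigma>\<subseteq>X. card \<sigma> = Suc p \<longrightarrow> y \<sigma> \<in> lin_kernel X B g) \<and> (\<forall>\<sigma>\<subseteq>X. card \<sigma> = p \<longrightarrow> koszul_d X r y \<sigma> = z \<sigma>)"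
  proof (intro exI[of _ t] conjI allI impI)
    fix \<sigma> assume \<sigma>: "\<sigma> \<subseteq> X" "card \<sigma> = Suc p"
    have "koszul_d X r u \<sigma> \<in> free_module X B"
      using uF card_insert_sub[OF _ \<sigma>(1)] \<sigma> by (intro koszul_d_in_submodule submodule_free_module) auto
    moreover have "lin_ext g (koszul_d X r u \<sigma>) = koszul_d X r y \<sigma>"
      unfolding koszul_d_lin[symmetric] using u card_insert_sub[OF _ \<sigma>(1)] \<sigma> by (intro koszul_d_cong) auto
    ultimately show "t \<sigma> \<in> lin_kernel X B g"
      using wF y[OF \<sigma>] by (auto simp: lin_kernel_def t_def lin_ext_diff intro: submodule_diff[OF submodule_free_module])
  next
    fix \<tau> assume \<tau>: "\<tau> \<subseteq> X" "card \<tau> = p"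
    then show "koszul_d X r t \<tau> = z \<tau>"
      using w[OF \<tau>] by (simp add: t_def koszul_d_diff koszul_d_twice[OF fin r])
  qed
qed

lemma koszul_exact_kernelD:
  assumes "koszul_exact X r s' (lin_kernel X B g) p j"
  shows "koszul_exact X r s M (Suc p) j"
  unfolding koszul_exact_def
proof (intro allI impI, elim conjE)
  fix z
  assume "\<forall>\<sigma>\<subseteq>X. card \<sigma> = Suc p \<longrightarrow> z \<sigma> \<in> M \<and> homog s (Suc p) j (z \<sigma>)"
    and "\<forall>\<tau>\<subseteq>X. Suc (card \<tau>) = Suc p \<longrightarrow> koszul_d X r z \<tau> = 0"
  then have zM: "\<And>\<sigma>. \<sigma> \<subseteq> X \<Longrightarrow> card \<sigma> = Suc p \<Longrightarrow> z \<sigma> \<in> M"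
    and zh: "\<And>\<sigma>. \<sigma> \<subseteq> X \<Longrightarrow> card \<sigma> = Suc p \<Longrightarrow> homog s (Suc p) j (z \<sigma>)"
    and zc: "\<And>\<tau>. \<tau> \<subseteq> X \<Longrightarrow> card \<tau> = p \<Longrightarrow> koszul_d X r z \<tau> = 0"
    by auto
  have "\<exists>u. u \<in> free_module X B \<and> homog s' (Suc p) j u \<and> lin_ext g u = z \<sigma>" if "\<sigma> \<subseteq> X" "card \<sigma> = Suc p" for \<sigma>
    using homog_lift[OF zM[OF that] zh[OF that]] by metis
  then obtain u where uF: "\<And>\<sigma>. \<sigma> \<subseteq> X \<Longrightarrow> card \<sigma> = Suc p \<Longrightarrow> u \<sigma> \<in> free_module X B"
    and uh: "\<And>\<sigma>. \<sigma> \<subseteq> X \<Longrightarrow> card \<sigma> = Suc p \<Longrightarrow> homog s' (Suc p) j (u \<sigma>)"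
    and u: "\<And>\<sigma>. \<sigma> \<subseteq> X \<Longrightarrow> card \<sigma> = Suc p \<Longrightarrow> lin_ext g (u \<sigma>) = z \<sigma>"
    by metis
  obtain y where yN: "\<And>\<sigma>. \<sigma> \<subseteq> X \<Longrightarrow> card \<sigma> = Suc p \<Longrightarrow> y \<sigma> \<in> lin_kernel X B g"
    and y: "\<And>\<sigma>. \<sigma> \<subseteq> X \<Longrightarrow> card \<sigma> = p \<Longrightarrow> koszul_d X r y \<sigma> = koszul_d X r u \<sigma>"
  proof (rule koszul_exactE[OF assms, of "koszul_d X r u"])
    fix \<tau> assume \<tau>: "\<tau> \<subseteq> X" "card \<tau> = p"
    have "koszul_d X r u \<tau> \<in> free_module X B"
      using uF card_insert_sub[OF _ \<tau>(1)] \<tau> by (intro koszul_d_in_submodule submodule_free_module) auto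
    moreover have "lin_ext g (koszul_d X r u \<tau>) = koszul_d X r z \<tau>"
      unfolding koszul_d_lin[symmetric] using u card_insert_sub[OF _ \<tau>(1)] \<tau> by (intro koszul_d_cong) auto
    ultimately show "koszul_d X r u \<tau> \<in> lin_kernel X B g" using zc[OF \<tau>] by (simp add: lin_kernel_def)
    show "homog s' p j (koszul_d X r u \<tau>)"
      using uh card_insert_sub[OF _ \<tau>(1)] \<tau> by (intro koszul_d_homog) auto
  qed (use koszul_d_twice[OF fin r] in auto)
  \<comment> \<open>the lift \<open>u\<close> of \<open>z\<close> becomes a cycle after subtracting \<open>y\<close>, whose values do not affect the image in \<open>M\<close>\<close>
  obtain w where w: "\<And>\<sigma>. \<sigma> \<subseteq> X \<Longrightarrow> card \<sigma> = Suc p \<Longrightarrow> koszul_d X r w \<sigma> = u \<sigma> - y \<sigma>"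
    and wF: "\<And>\<sigma>. w \<sigma> \<in> free_module X B"
  proof (rule koszul_exact_free[OF fin r, of "Suc p" "\<lambda>\<sigma>. u \<sigma> - y \<sigma>" B])
    show "u \<sigma> - y \<sigma> \<in> free_module X B" if "\<sigma> \<subseteq> X" "card \<sigma> = Suc p" for \<sigma>
      using uF[OF that] yN[OF that] submodule_diff[OF submodule_free_module] by (auto simp: lin_kernel_def)
  qed (use y in \<open>auto simp: koszul_d_diff\<close>)
  show "\<exists>y. (\<forall>\<sigma>\<subseteq>X. card \<sigma> = Suc (Suc p) \<longrightarrow> y \<sigma> \<in> M) \<and> (\<forall>\<sigma>\<subseteq>X. card \<sigma> = Suc p \<longrightarrow> koszul_d X r y \<sigma> = z \<sigma>)"
  proof (intro exI[of _ "\<lambda>\<sigma>. lin_ext g (w \<sigma>)"] conjI allI impI)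
    fix \<sigma> assume \<sigma>: "\<sigma> \<subseteq> X" "card \<sigma> = Suc p"
    show "koszul_d X r (\<lambda>\<sigma>. lin_ext g (w \<sigma>)) \<sigma> = z \<sigma>"
      using yN[OF \<sigma>] u[OF \<sigma>] by (simp add: koszul_d_lin w[OF \<sigma>] lin_ext_diff lin_kernel_def)
  qed (rule lin_in_M[OF wF])
qed

text \<open>In homological degree 0 the Koszul homology is \<open>M / \<mm>M\<close>, whose dimension is the number of generators in
a minimal cover.\<close>

lemma koszul_exact_0_iff: "koszul_exact X r s M 0 j \<longleftrightarrow> (\<forall>b\<in>B. s' b \<noteq> j)"
proof (intro iffI ballI notI)
  fix b assume exact: "koszul_exact X r s M 0 j" and b: "b \<in> B" "s' b = j"
  have gM: "g b \<in> M"
    using lin_in_M[of "single b 1"] b free_module_single[of b B 1 X] by (simp add: lin_ext_single)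
  obtain y where yM: "\<And>\<sigma>. \<sigma> \<subseteq> X \<Longrightarrow> card \<sigma> = Suc 0 \<Longrightarrow> y \<sigma> \<in> M"
    and y': "\<And>\<sigma>. \<sigma> \<subseteq> X \<Longrightarrow> card \<sigma> = 0 \<Longrightarrow> koszul_d X r y \<sigma> = g b"
    by (rule koszul_exactE[OF exact, of "\<lambda>_. g b"]) (use gM graded[OF b(1)] b(2) in auto)
  have y: "koszul_d X r y {} = g b" by (rule y') auto
  have "\<exists>u. u \<in> free_module X B \<and> lin_ext g u = y \<sigma>" if "\<sigma> \<subseteq> X" "card \<sigma> = Suc 0" for \<sigma>
    using yM[OF that] image by auto
  then obtain u where uF: "\<And>\<sigma>. \<sigma> \<subseteq> X \<Longrightarrow> card \<sigma> = Suc 0 \<Longrightarrow> u \<sigma> \<in> free_module X B"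
    and u: "\<And>\<sigma>. \<sigma> \<subseteq> X \<Longrightarrow> card \<sigma> = Suc 0 \<Longrightarrow> lin_ext g (u \<sigma>) = y \<sigma>"
    by metis
  have "koszul_d X r u {} \<in> free_module X B"
    using uF by (intro koszul_d_in_submodule submodule_free_module) auto
  moreover have "lin_ext g (koszul_d X r u {}) = g b"
    unfolding koszul_d_lin[symmetric] y[symmetric] using u by (intro koszul_d_cong) auto
  ultimately have "single b 1 - koszul_d X r u {} \<in> lin_kernel X B g"
    using submodule_diff[OF submodule_free_module, of "single b 1" X B] b free_module_single[of b B 1 X]
    by (simp add: lin_kernel_def lin_ext_diff lin_ext_single)
  from minimal[OF this, of b] show False
    by (simp add: lookup_minus lookup_koszul_d[OF fin])
next
  assume no: "\<forall>b\<in>B. s' b \<noteq> j"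
  show "koszul_exact X r s M 0 j"
    unfolding koszul_exact_def
  proof (intro allI impI, elim conjE)
    fix z assume "\<forall>\<sigma>\<subseteq>X. card \<sigma> = 0 \<longrightarrow> z \<sigma> \<in> M \<and> homog s 0 j (z \<sigma>)"
    then have "z {} \<in> M" "homog s 0 j (z {})" by auto
    then obtain w where w: "w \<in> free_module X B" "homog s' 0 j w" "lin_ext g w = z {}" by (rule homog_lift)
    have w0: "lookup (lookup w b) 0 = 0" for b
      using w(1,2) no by (force simp: free_module_iff homog_def)
    obtain u where u: "\<And>\<sigma>. \<sigma> \<subseteq> X \<Longrightarrow> card \<sigma> = 0 \<Longrightarrow> koszul_d X r u \<sigma> = w" and uF: "\<And>\<sigma>. u \<sigma> \<in> free_module X B"
      by (rule koszul_exact_free[OF fin r, of 0 "\<lambda>_. w" B]) (use w w0 in auto)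
    show "\<exists>y. (\<forall>\<sigma>\<subseteq>X. card \<sigma> = Suc 0 \<longrightarrow> y \<sigma> \<in> M) \<and> (\<forall>\<sigma>\<subseteq>X. card \<sigma> = 0 \<longrightarrow> koszul_d X r y \<sigma> = z \<sigma>)"
    proof (intro exI[of _ "\<lambda>\<sigma>. lin_ext g (u \<sigma>)"] conjI allI impI)
      fix \<sigma> assume \<sigma>: "\<sigma> \<subseteq> X" "card \<sigma> = 0"
      then have "\<sigma> = {}" using finsub by auto
      then show "koszul_d X r (\<lambda>\<sigma>. lin_ext g (u \<sigma>)) \<sigma> = z \<sigma>" using u[OF \<sigma>] w(3) by (simp add: koszul_d_lin)
    qed (rule lin_in_M[OF uF])
  qed
qed

end

section \<open>Minimal graded free resolutions\<close>

text \<open>The ideal is identified with the vectors supported at 0, so that the augmentation is a linear map between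
modules of vectors, like all other maps of the resolution.\<close>

definition res_gens :: "('v, 'k::field) free_complex \<Rightarrow> nat \<Rightarrow> nat \<Rightarrow> ('v, 'k) vec" where
  "res_gens F i = (case i of 0 \<Rightarrow> \<lambda>b. single 0 (aug F b) | Suc k \<Rightarrow> bd F k)"

definition res_shifts :: "('v, 'k::field) free_complex \<Rightarrow> nat \<Rightarrow> nat \<Rightarrow> nat" where
  "res_shifts F i = (case i of 0 \<Rightarrow> \<lambda>_. 0 | Suc k \<Rightarrow> shift F k)"

primrec syzygies where
  "syzygies X I F 0 = single 0 ` I"
| "syzygies X I F (Suc i) = lin_kernel X (basis F i) (res_gens F i)"

lemma bd_map_eq_lin: "bd_map F i = lin_ext (res_gens F (Suc i))"
  by (rule ext) (simp add: bd_map_def lin_ext_def smul_def res_gens_def)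

lemma single_aug_map: "single 0 (aug_map F w) = lin_ext (res_gens F 0) w"
  by (simp add: aug_map_def lin_ext_def single_sum smul_single res_gens_def)

lemma aug_map_eq_0_iff: "aug_map F w = 0 \<longleftrightarrow> lin_ext (res_gens F 0) w = 0"
  unfolding single_aug_map[symmetric] by (metis lookup_single_eq single_zero)

lemma free_resolution_iff:
  "free_resolution X I F \<longleftrightarrow>
     (\<forall>i. \<forall>b\<in>basis F (Suc i). bd F i b \<in> free_module X (basis F i)) \<and>
     (\<forall>b\<in>basis F 0. aug F b \<in> poly_ring X) \<and>
     (\<forall>i. lin_ext (res_gens F i) ` free_module X (basis F i) = syzygies X I F i)"
proof -
  have "aug_map F ` S = I \<longleftrightarrow> lin_ext (res_gens F 0) ` S = single 0 ` I" for S
  proof -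
    have "lin_ext (res_gens F 0) ` S = single 0 ` (aug_map F ` S)"
      by (simp add: image_image single_aug_map)
    then show ?thesis using inj_image_eq_iff[OF inj_single[of "0::nat"], of "aug_map F ` S" I] by simp
  qed
  moreover have "(\<forall>i. Q i) \<longleftrightarrow> Q 0 \<and> Q 1 \<and> (\<forall>i. Q (Suc (Suc i)))" for Q :: "nat \<Rightarrow> bool"
    by (metis One_nat_def not0_implies_Suc)
  from this[of "\<lambda>i. lin_ext (res_gens F i) ` free_module X (basis F i) = syzygies X I F i"]
  have "(\<forall>i. lin_ext (res_gens F i) ` free_module X (basis F i) = syzygies X I F i) \<longleftrightarrow>
      lin_ext (res_gens F 0) ` free_module X (basis F 0) = single 0 ` I \<and>
      lin_ext (res_gens F 1) ` free_module X (basis F 1) = lin_kernel X (basis F 0) (res_gens F 0) \<and>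
      (\<forall>i. lin_ext (res_gens F (Suc (Suc i))) ` free_module X (basis F (Suc (Suc i)))
         = lin_kernel X (basis F (Suc i)) (res_gens F (Suc i)))"
    by simp
  ultimately show ?thesis
    unfolding free_resolution_def bd_map_eq_lin aug_map_eq_0_iff lin_kernel_def by simp
qed

text \<open>A product of monomials is 1 only if both are.\<close>

lemma lookup_mult_0: "lookup q 0 = 0 \<Longrightarrow> lookup (p * q) (0 :: 'v monomial) = 0"
proof (rule ccontr)
  assume q: "lookup q 0 = 0" and "lookup (p * q) 0 \<noteq> 0"
  then have "0 \<in> keys (p * q)" by (simp add: in_keys_iff)
  then obtain a b where "0 = a + b" "b \<in> keys q" using keys_mult[of p q] by blast
  then show False using q by (metis Un_empty in_keys_iff keys_add_nat keys_eq_empty)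
qed

lemma minimal_cover_of_resolution:
  assumes F: "minimal_graded_free_resolution X I F" and X: "finite X" "inj_on r X"
  shows "minimal_cover X r (res_shifts F i) (syzygies X I F i) (basis F i) (shift F i) (res_gens F i)"
proof
  have image: "\<And>i. lin_ext (res_gens F i) ` free_module X (basis F i) = syzygies X I F i"
    using F by (simp add: minimal_graded_free_resolution_def free_resolution_iff)
  then show "lin_ext (res_gens F i) ` free_module X (basis F i) = syzygies X I F i" .
  have gr: "graded_complex F" using F by (simp add: minimal_graded_free_resolution_def)
  show "homog (res_shifts F i) 0 (shift F i b) (res_gens F i b)" if "b \<in> basis F i" for b
    using gr that unfolding graded_complex_def
    by (cases i) (auto simp: homog_def res_gens_def res_shifts_def lookup_single when_def in_keys_iff)
  show "lookup (lookup w b) 0 = 0" if w: "w \<in> lin_kernel X (basis F i) (res_gens F i)" for w b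
  proof -
    have "w \<in> lin_ext (res_gens F (Suc i)) ` free_module X (basis F (Suc i))" using image[of "Suc i"] w by simp
    then obtain u where u: "u \<in> free_module X (basis F (Suc i))" and "w = lin_ext (bd F i) u"
      by (auto simp: res_gens_def)
    then have "lookup (lookup w b) 0 = (\<Sum>c\<in>keys u. lookup (lookup u c * lookup (bd F i c) b) 0)"
      by (simp add: lin_ext_def lookup_sum)
    also have "\<dots> = 0"
      using F u by (intro sum.neutral ballI lookup_mult_0)
        (auto simp: minimal_graded_free_resolution_def minimal_complex_def free_module_def)
    finally show ?thesis .
  qed
qed (use X in auto)

text \<open>Shifting dimensions along the resolution identifies the generators of its \<open>i\<close>-th module with a basis of
the 0-th Koszul homology of the \<open>i\<close>-th syzygy module, hence of the \<open>i\<close>-th Koszul homology of \<open>I\<close>.\<close>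

theorem no_generator_iff_koszul_exact:
  assumes F: "minimal_graded_free_resolution X I F" and X: "finite X" "inj_on r X"
  shows "(\<forall>b\<in>basis F i. shift F i b \<noteq> j) \<longleftrightarrow> koszul_exact X r (\<lambda>_. 0) (single 0 ` I) i j"
proof -
  note cover = minimal_cover_of_resolution[OF F X]
  have "koszul_exact X r (res_shifts F i) (syzygies X I F i) n j
      \<longleftrightarrow> koszul_exact X r (\<lambda>_. 0) (single 0 ` I) (i + n) j" for n
  proof (induction i arbitrary: n)
    case 0
    then show ?case by (simp add: res_shifts_def)
  next
    case (Suc i)
    have "koszul_exact X r (shift F i) (lin_kernel X (basis F i) (res_gens F i)) n j
        \<longleftrightarrow> koszul_exact X r (res_shifts F i) (syzygies X I F i) (Suc n) j"
      using minimal_cover.koszul_exact_kernelI[OF cover] minimal_cover.koszul_exact_kernelD[OF cover] by blast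
    then show ?case using Suc.IH[of "Suc n"] by (simp add: res_shifts_def)
  qed
  from this[of 0] show ?thesis using minimal_cover.koszul_exact_0_iff[OF cover, of i j] by simp
qed

subsection \<open>Existence\<close>

interpretation kspace: vector_space "\<lambda>(c::'k::field) (w::('v, 'k) vec). single 0 c \<odot> w"
  by standard (simp_all add: smul_add add_smul single_add smul_smul mult_single)

lemma homog_component_in_finite_span:
  assumes X: "finite X" and B: "finite {b \<in> B. s b \<le> j}"
  obtains T :: "('v, 'k::field) vec set" where "finite T"
    and "\<And>w. w \<in> free_module X B \<Longrightarrow> homog s 0 j w \<Longrightarrow> w \<in> kspace.span T"
proof -
  define D where "D = {m :: 'v monomial. keys m \<subseteq> X \<and> mdegree m \<le> j}"
  have "finite D"
  proof (rule finite_imageD)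
    have "lookup m v \<le> mdegree m" for m :: "'v monomial" and v
      by (cases "v \<in> keys m") (auto simp: mdegree_def in_keys_iff intro: member_le_sum)
    then have "lookup ` D \<subseteq> {f. \<forall>v. (v \<in> X \<longrightarrow> f v \<in> {..j}) \<and> (v \<notin> X \<longrightarrow> f v = 0)}"
      by (auto simp: D_def in_keys_iff subset_iff intro: order_trans)
    then show "finite (lookup ` D)"
      by (rule finite_subset) (rule finite_set_of_finite_funs[OF X], simp)
    show "inj_on lookup D" by (auto intro!: inj_onI poly_mapping_eqI)
  qed
  define T :: "('v, 'k) vec set" where "T = (\<lambda>(b, m). single b (single m 1)) ` ({b \<in> B. s b \<le> j} \<times> D)"
  show ?thesis
  proof (rule that[of T])
    show "finite T" using B \<open>finite D\<close> by (auto simp: T_def)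
    fix w :: "('v, 'k) vec" assume w: "w \<in> free_module X B" "homog s 0 j w"
    have "w = (\<Sum>b\<in>keys w. \<Sum>m\<in>keys (lookup w b). single b (single m (lookup (lookup w b) m)))"
      unfolding single_sum[symmetric] poly_mapping_expansion[symmetric] ..
    also have "\<dots> = (\<Sum>b\<in>keys w. \<Sum>m\<in>keys (lookup w b). single 0 (lookup (lookup w b) m) \<odot> single b (single m 1))"
      by (simp add: smul_single mult_single)
    also have "\<dots> \<in> kspace.span T"
    proof (intro kspace.span_sum kspace.span_scale kspace.span_base)
      fix b m assume "b \<in> keys w" "m \<in> keys (lookup w b)"
      then have "b \<in> B \<and> keys m \<subseteq> X" "mdegree m + s b = j"
        using w by (auto simp: free_module_iff homog_def in_keys_iff)
      then show "single b (single m 1) \<in> T" by (auto simp: T_def D_def)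
    qed
    finally show "w \<in> kspace.span T" .
  qed
qed

text \<open>Generators of the same degree are linearly independent over \<open>k\<close>, because a relation between them would be
a kernel element with constant coefficients. They live in a space of finite dimension.\<close>

lemma (in minimal_cover) finite_degrees:
  assumes M: "M \<subseteq> free_module X B0" and B0: "\<And>j. finite {b \<in> B0. s b \<le> j}"
  shows "finite {b \<in> B. s' b \<le> j}"
proof -
  have "finite {b \<in> B. s' b = i}" for i
  proof (rule finite_imageD)
    let ?C = "{b \<in> B. s' b = i}"
    have F: "single b p \<in> free_module X B" if "b \<in> ?C" "p \<in> poly_ring X" for b p
      using that by (auto intro: free_module_single)
    show inj: "inj_on g ?C"
    proof (rule inj_onI, rule ccontr)
      fix a b assume ab: "a \<in> ?C" "b \<in> ?C" "g a = g b" "a \<noteq> b"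
      then have "single a 1 - single b 1 \<in> lin_kernel X B g"
        using submodule_diff[OF submodule_free_module F[OF ab(1) poly_ring_1] F[OF ab(2) poly_ring_1]] by (simp add: lin_kernel_def lin_ext_diff lin_ext_single)
      from minimal[OF this, of a] show False using ab(4) by (simp add: lookup_minus lookup_single)
    qed
    obtain T :: "('v, 'k) vec set" where T: "finite T"
      and span: "\<And>w. w \<in> free_module X B0 \<Longrightarrow> homog s 0 i w \<Longrightarrow> w \<in> kspace.span T"
      using homog_component_in_finite_span[OF fin B0] by metis
    have "g ` ?C \<subseteq> kspace.span T"
      using span M graded lin_in_M[OF free_module_single[of _ B 1 X]] by (auto simp: lin_ext_single)
    moreover have "kspace.independent (g ` ?C)"
      unfolding kspace.independent_explicit_finite_subsets
    proof (intro allI impI ballI)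
      fix S u x assume S: "S \<subseteq> g ` ?C" "finite S" and u: "(\<Sum>x\<in>S. single 0 (u x) \<odot> x) = 0" and x: "x \<in> S"
      let ?h = "inv_into ?C g"
      have h: "?h y \<in> ?C" "g (?h y) = y" if "y \<in> S" for y
        using that S(1) inv_into_into[of y g ?C] f_inv_into_f[of y g ?C] by auto
      let ?w = "\<Sum>y\<in>S. single (?h y) (single 0 (u y)) :: ('v, 'k) vec"
      have "lin_ext g ?w = 0" using u h by (simp add: lin_ext_sum lin_ext_single)
      moreover have "?w \<in> free_module X B"
        using h by (intro submodule_sum[OF submodule_free_module] F) auto
      ultimately have "?w \<in> lin_kernel X B g" by (simp add: lin_kernel_def)
      then have "lookup (lookup ?w (?h x)) 0 = 0" by (rule minimal)
      moreover have "lookup (lookup ?w (?h x)) 0 = (\<Sum>y\<in>S. if y = x then u x else 0)"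
      proof -
        have "?h y = ?h x \<longleftrightarrow> y = x" if "y \<in> S" for y using h(2) that x by metis
        then show ?thesis unfolding lookup_sum by (intro sum.cong refl) (auto simp: lookup_single when_def)
      qed
      ultimately show "u x = 0" using S(2) x by simp
    qed
    ultimately show "finite (g ` ?C)" using kspace.independent_span_bound[OF T] by blast
  qed
  moreover have "{b \<in> B. s' b \<le> j} = (\<Union>i\<le>j. {b \<in> B. s' b = i})" by auto
  ultimately show ?thesis by simp
qed

text \<open>The space \<open>D\<close> is the part of degree \<open>j\<close> of \<open>\<mm>M\<close>, and \<open>G\<close> is a basis of a complement of \<open>D\<close> in the part of
degree \<open>j\<close> of \<open>M\<close>.\<close>

lemma minimal_generators_of_degree:
  fixes M :: "('v, 'k::field) vec set"
  assumes X: "finite X" and M: "submodule X M" "M \<subseteq> free_module X B0" and B0: "finite {b \<in> B0. s b \<le> j}"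
    and D_def: "D = {\<Sum>v\<in>X. var v \<odot> n v | n. \<forall>v\<in>X. n v \<in> M \<and> homog s 1 j (n v)}"
  obtains G where "finite G" and "G \<subseteq> {w \<in> M. homog s 0 j w}"
    and "\<And>w. w \<in> M \<Longrightarrow> homog s 0 j w \<Longrightarrow> \<exists>c. \<exists>d\<in>D. w = (\<Sum>x\<in>G. single 0 (c x) \<odot> x) + d"
    and "\<And>c. (\<Sum>x\<in>G. single 0 (c x) \<odot> x) \<in> D \<Longrightarrow> (\<forall>x\<in>G. c x = 0)"
proof -
  let ?Mj = "{w \<in> M. homog s 0 j w}"
  have D_sub: "D \<subseteq> ?Mj"
    unfolding D_def using M(1)
    by (auto intro!: submodule_sum[of X M] submodule_smul[of X M] homog_sum homog_var)
  have D: "kspace.subspace D"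
  proof (rule kspace.subspaceI)
    show "0 \<in> D" unfolding D_def using submodule_0[OF M(1)] by (intro CollectI exI[of _ "\<lambda>_. 0"]) auto
  next
    fix x y assume "x \<in> D" "y \<in> D"
    then obtain m n where "x = (\<Sum>v\<in>X. var v \<odot> m v)" "y = (\<Sum>v\<in>X. var v \<odot> n v)"
      and "\<forall>v\<in>X. m v \<in> M \<and> homog s 1 j (m v)" "\<forall>v\<in>X. n v \<in> M \<and> homog s 1 j (n v)"
      unfolding D_def by blast
    then show "x + y \<in> D" unfolding D_def
      by (intro CollectI exI[of _ "\<lambda>v. m v + n v"])
        (auto simp: smul_add sum.distrib intro: submodule_add[OF M(1)] homog_add)
  next
    fix c and x assume "x \<in> D"
    then obtain n where "x = (\<Sum>v\<in>X. var v \<odot> n v)" and "\<forall>v\<in>X. n v \<in> M \<and> homog s 1 j (n v)"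
      unfolding D_def by blast
    then show "single 0 c \<odot> x \<in> D" unfolding D_def
      by (intro CollectI exI[of _ "\<lambda>v. single 0 c \<odot> n v"])
        (auto simp: smul_sum smul_commute[of "single 0 c"] lookup_single when_def split: if_splits
          intro!: submodule_smul[OF M(1)] homog_smul[where i = j])
  qed
  obtain A where A: "A \<subseteq> D" "kspace.independent A" "D \<subseteq> kspace.span A"
    using kspace.maximal_independent_subset[of D] by blast
  obtain C where C: "A \<subseteq> C" "C \<subseteq> ?Mj" "kspace.independent C" "?Mj \<subseteq> kspace.span C"
    using kspace.maximal_independent_subset_extend[of A ?Mj] A D_sub by blast
  obtain T :: "('v, 'k) vec set" where T: "finite T"
    and span: "\<And>w. w \<in> free_module X B0 \<Longrightarrow> homog s 0 j w \<Longrightarrow> w \<in> kspace.span T"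
    using homog_component_in_finite_span[OF X B0] by metis
  have "C \<subseteq> kspace.span T" using C(2) M(2) span by auto
  then have finC: "finite C" using kspace.independent_span_bound[OF T C(3)] by blast
  have finA: "finite A" using C(1) finC by (rule finite_subset)
  show ?thesis
  proof (rule that[of "C - A"])
    show "finite (C - A)" using finC by simp
    show "C - A \<subseteq> ?Mj" using C(2) by blast
  next
    fix w assume "w \<in> M" "homog s 0 j w"
    then have "w \<in> kspace.span C" using C(4) by blast
    then obtain c where "w = (\<Sum>x\<in>C. single 0 (c x) \<odot> x)"
      unfolding kspace.span_finite[OF finC] by blast
    also have "\<dots> = (\<Sum>x\<in>C - A. single 0 (c x) \<odot> x) + (\<Sum>x\<in>A. single 0 (c x) \<odot> x)"
      by (rule sum.subset_diff[OF C(1) finC])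
    finally show "\<exists>c. \<exists>d\<in>D. w = (\<Sum>x\<in>C - A. single 0 (c x) \<odot> x) + d"
      using A(1) kspace.subspace_sum[OF D, of A "\<lambda>x. single 0 (c x) \<odot> x"] kspace.subspace_scale[OF D] by blast
  next
    fix c assume "(\<Sum>x\<in>C - A. single 0 (c x) \<odot> x) \<in> D"
    then have "(\<Sum>x\<in>C - A. single 0 (c x) \<odot> x) \<in> kspace.span A" using A(3) by blast
    then obtain e where e: "(\<Sum>x\<in>C - A. single 0 (c x) \<odot> x) = (\<Sum>x\<in>A. single 0 (e x) \<odot> x)"
      unfolding kspace.span_finite[OF finA] by blast
    let ?f = "\<lambda>x. if x \<in> A then - e x else c x"
    have "(\<Sum>x\<in>C. single 0 (?f x) \<odot> x) = (\<Sum>x\<in>C - A. single 0 (?f x) \<odot> x) + (\<Sum>x\<in>A. single 0 (?f x) \<odot> x)"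
      by (rule sum.subset_diff[OF C(1) finC])
    also have "(\<Sum>x\<in>C - A. single 0 (?f x) \<odot> x) = (\<Sum>x\<in>C - A. single 0 (c x) \<odot> x)"
      by (intro sum.cong) auto
    also have "(\<Sum>x\<in>A. single 0 (?f x) \<odot> x) = - (\<Sum>x\<in>A. single 0 (e x) \<odot> x)"
      unfolding sum_negf[symmetric] by (intro sum.cong) (auto simp: single_uminus uminus_smul)
    finally have "(\<Sum>x\<in>C. single 0 (?f x) \<odot> x) = 0" using e by simp
    then have "?f x = 0" if "x \<in> C" for x
      using kspace.independentD[OF C(3) finC order_refl, of ?f] that by blast
    then show "\<forall>x\<in>C - A. c x = 0" by force
  qed
qed

text \<open>Minimal generators are chosen degree by degree. They generate \<open>M\<close> by induction on the degree, which is
the graded version of the lemma of Nakayama. Finitely many generators in each degree are countably many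
altogether, so that they can be numbered by \<open>nat\<close>.\<close>

lemma exists_minimal_cover:
  fixes M :: "('v, 'k::field) vec set"
  assumes X: "finite X" "inj_on r X"
    and M: "submodule X M" "graded_sub s M" "M \<subseteq> free_module X B0" and B0: "\<And>j. finite {b \<in> B0. s b \<le> j}"
  obtains B s' g where "minimal_cover X r s M B s' g"
proof -
  define D where "D = (\<lambda>j. {\<Sum>v\<in>X. var v \<odot> n v | n. \<forall>v\<in>X. n v \<in> M \<and> homog s 1 j (n v)})"
  define minimal_gens where "minimal_gens = (\<lambda>j G. finite G \<and> G \<subseteq> {w \<in> M. homog s 0 j w}
     \<and> (\<forall>w. w \<in> M \<longrightarrow> homog s 0 j w \<longrightarrow> (\<exists>c. \<exists>d\<in>D j. w = (\<Sum>x\<in>G. single 0 (c x) \<odot> x) + d))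
     \<and> (\<forall>c. (\<Sum>x\<in>G. single 0 (c x) \<odot> x) \<in> D j \<longrightarrow> (\<forall>x\<in>G. c x = 0)))"
  have "\<exists>G. minimal_gens j G" for j
    unfolding minimal_gens_def
    by (rule minimal_generators_of_degree[OF X(1) M(1,3) B0, where j = j and D = "D j"]) (simp add: D_def, blast)
  then obtain G where "\<And>j. minimal_gens j (G j)" by metis
  then have finG: "\<And>j. finite (G j)" and G: "\<And>j. G j \<subseteq> {w \<in> M. homog s 0 j w}"
    and gen: "\<And>j w. w \<in> M \<Longrightarrow> homog s 0 j w \<Longrightarrow> \<exists>c. \<exists>d\<in>D j. w = (\<Sum>x\<in>G j. single 0 (c x) \<odot> x) + d"
    and ind: "\<And>j c. (\<Sum>x\<in>G j. single 0 (c x) \<odot> x) \<in> D j \<Longrightarrow> \<forall>x\<in>G j. c x = 0"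
    unfolding minimal_gens_def by blast+
  \<comment> \<open>indexing by pairs with the degree makes the degree of a generator readable from its index\<close>
  define K where "K = (SIGMA j:UNIV. G j)"
  have "countable K" unfolding K_def by (intro countable_SIGMA) (auto intro: countable_finite finG)
  then obtain e :: "nat \<times> ('v, 'k) vec \<Rightarrow> nat" where e: "inj_on e K" unfolding countable_def by blast
  define B where "B = e ` K"
  define s' where "s' = (\<lambda>b. fst (inv_into K e b))"
  define g where "g = (\<lambda>b. snd (inv_into K e b))"
  have s'e: "s' (e (j, x)) = j" and ge: "g (e (j, x)) = x" and eB: "e (j, x) \<in> B" if "x \<in> G j" for j x
    using that e by (auto simp: s'_def g_def B_def K_def)
  have gB: "g b \<in> G (s' b)" and eg: "e (s' b, g b) = b" if "b \<in> B" for b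
  proof -
    have "inv_into K e b \<in> K" "e (inv_into K e b) = b"
      using that by (auto simp: B_def inv_into_into f_inv_into_f)
    then show "g b \<in> G (s' b)" "e (s' b, g b) = b" by (auto simp: K_def s'_def g_def)
  qed
  have gM: "g b \<in> M" and gh: "homog s 0 (s' b) (g b)" if "b \<in> B" for b using gB[OF that] G by auto
  have reindex: "(\<Sum>b\<in>{b \<in> B. s' b = j}. f b) = (\<Sum>x\<in>G j. f (e (j, x)))" for f :: "nat \<Rightarrow> ('v, 'k) vec" and j
    by (rule sum.reindex_bij_witness[of _ "\<lambda>x. e (j, x)" g]) (auto simp: s'e ge eB eg gB dest: gB)
  have fin_deg: "finite {b \<in> B. s' b = j}" for j
  proof -
    have "{b \<in> B. s' b = j} \<subseteq> (\<lambda>x. e (j, x)) ` G j" using gB eg by force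
    then show ?thesis using finG finite_subset by blast
  qed
  let ?L = "lin_ext g ` free_module X B"
  have L: "submodule X ?L" by (rule submodule_lin_image[OF submodule_free_module])
  have lin_M: "lin_ext g w \<in> M" if "w \<in> free_module X B" for w
    by (rule lin_ext_in_submodule[OF M(1) that]) (rule gM)
  have gL: "g b \<in> ?L" if "b \<in> B" for b
    using that free_module_single[of b B 1 X] by (intro image_eqI[of _ _ "single b 1"]) (auto simp: lin_ext_single)
  have homog_L: "w \<in> ?L" if "w \<in> M" "homog s 0 j w" for w j
    using that
  proof (induction j arbitrary: w rule: less_induct)
    case (less j)
    obtain c d where d: "d \<in> D j" and w: "w = (\<Sum>x\<in>G j. single 0 (c x) \<odot> x) + d"
      using gen[OF less.prems] by blast
    have "x \<in> ?L" if "x \<in> G j" for x using gL[OF eB[OF that]] ge[OF that] by simp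
    then have "(\<Sum>x\<in>G j. single 0 (c x) \<odot> x) \<in> ?L"
      by (intro submodule_sum[OF L] submodule_smul[OF L]) auto
    moreover obtain n where n: "\<And>v. v \<in> X \<Longrightarrow> n v \<in> M" "\<And>v. v \<in> X \<Longrightarrow> homog s 1 j (n v)"
      and d': "d = (\<Sum>v\<in>X. var v \<odot> n v)"
      using d unfolding D_def by blast
    have "n v \<in> ?L" if v: "v \<in> X" for v
    proof (cases j)
      case 0
      then have "n v = 0" using n(2)[OF v] by (intro vec_eqI) (auto simp: homog_def)
      then show ?thesis using submodule_0[OF L] by simp
    next
      case (Suc i)
      then show ?thesis using less.IH[of i "n v"] n[OF v] homog_shift[of s 0 1 i "n v"] by simp
    qed
    then have "d \<in> ?L" unfolding d' by (intro submodule_sum[OF L] submodule_smul[OF L]) auto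
    ultimately show ?case unfolding w by (intro submodule_add[OF L])
  qed
  have image: "?L = M"
  proof
    show "?L \<subseteq> M" using lin_M by blast
    show "M \<subseteq> ?L"
    proof
      fix w assume w: "w \<in> M"
      obtain n where n: "w = (\<Sum>j\<le>n. hcomp s j w)" by (rule hcomp_decomposition)
      have "hcomp s j w \<in> ?L" for j
        using M(2) w by (intro homog_L[of _ j] homog_hcomp) (auto simp: graded_sub_def)
      then have "(\<Sum>j\<le>n. hcomp s j w) \<in> ?L" by (intro submodule_sum[OF L])
      then show "w \<in> ?L" using n by simp
    qed
  qed
  have minimal: "lookup (lookup w b0) 0 = 0" if "w \<in> lin_kernel X B g" for w b0
  proof (cases "b0 \<in> B")
    case False
    then show ?thesis using that by (auto simp: lin_kernel_def free_module_iff)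
  next
    case True
    define j where "j = s' b0"
    \<comment> \<open>a constant term in degree \<open>j\<close> would give a combination of the generators of degree \<open>j\<close> inside \<open>\<mm>M\<close>\<close>
    have w: "w \<in> free_module X B" "lin_ext g w = 0" using that by (auto simp: lin_kernel_def)
    define c where "c = (\<lambda>b. lookup (lookup w b) 0)"
    \<comment> \<open>the constant coefficients of the component of degree \<open>j\<close>; they belong to generators of degree \<open>j\<close>\<close>
    define a where "a = (\<Sum>b\<in>{b \<in> B. s' b = j}. single b (single 0 (c b)) :: ('v, 'k) vec)"
    \<comment> \<open>what is left has no constant terms, so its image lies in \<open>\<mm>M\<close>\<close>
    define w1 where "w1 = hcomp s' j w - a"
    have aF: "a \<in> free_module X B"
      unfolding a_def by (intro submodule_sum[OF submodule_free_module] free_module_single) auto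
    have ah: "homog s' 0 j a"
      unfolding a_def by (intro homog_sum) (auto simp: homog_def lookup_single when_def)
    have w1F: "w1 \<in> free_module X B" and w1h: "homog s' 0 j w1"
      unfolding w1_def using aF ah w
      by (auto intro!: submodule_diff[OF submodule_free_module] free_module_hcomp homog_diff homog_hcomp)
    have w10: "lookup (lookup w1 b) 0 = 0" for b
    proof -
      have "lookup (lookup a b) 0 = (\<Sum>x\<in>{b \<in> B. s' b = j}. if x = b then c b else 0)"
        unfolding a_def lookup_sum by (intro sum.cong refl) (auto simp: lookup_single when_def)
      also have "\<dots> = (if b \<in> B \<and> s' b = j then c b else 0)" using fin_deg by simp
      finally show ?thesis
        using w(1) by (auto simp: w1_def lookup_minus lookup_hcomp c_def when_def free_module_iff)
    qed
    obtain u where u: "\<And>\<sigma>. \<sigma> \<subseteq> X \<Longrightarrow> card \<sigma> = 0 \<Longrightarrow> koszul_d X r u \<sigma> = w1"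
      and uF: "\<And>\<sigma>. u \<sigma> \<in> free_module X B"
      and uh: "\<And>s j \<sigma>. (\<And>\<rho>. \<rho> \<subseteq> X \<Longrightarrow> card \<rho> = 0 \<Longrightarrow> homog s 0 j w1) \<Longrightarrow> homog s (Suc 0) j (u \<sigma>)"
      by (rule koszul_exact_free[OF X, of 0 "\<lambda>_. w1" B]) (use w1F w10 in auto)
    have "w1 = (\<Sum>v\<in>X. var v \<odot> u {v})" using u[of "{}"] by (simp add: koszul_d_def koszul_sign_def)
    then have "- lin_ext g w1 = (\<Sum>v\<in>X. var v \<odot> (- lin_ext g (u {v})))"
      by (simp add: lin_ext_sum lin_ext_smul sum_negf smul_uminus)
    moreover have "- lin_ext g (u {v}) \<in> M \<and> homog s 1 j (- lin_ext g (u {v}))" for v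
      using submodule_uminus[OF M(1) lin_M[OF uF]] uF[of "{v}"]
      by (auto intro!: homog_uminus homog_lin[where s' = s' and B = B] uh[OF w1h] gh simp: free_module_def)
    ultimately have "- lin_ext g w1 \<in> D j"
      unfolding D_def by (intro CollectI exI[of _ "\<lambda>v. - lin_ext g (u {v})"] conjI ballI) auto
    moreover have "lin_ext g (hcomp s' j w) = hcomp s j (lin_ext g w)"
      using hcomp_lin_ext[OF w(1) gh] by simp
    then have "lin_ext g a = - lin_ext g w1" using w(2) by (simp add: w1_def lin_ext_diff)
    moreover have "lin_ext g a = (\<Sum>x\<in>G j. single 0 (c (e (j, x))) \<odot> x)"
      unfolding a_def lin_ext_sum reindex by (intro sum.cong refl) (simp add: lin_ext_single ge)
    ultimately have "\<forall>x\<in>G j. c (e (j, x)) = 0" by (intro ind) simp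
    then have "c b0 = 0" using gB[OF True] eg[OF True] by (metis j_def)
    then show ?thesis by (simp add: c_def)
  qed
  have "minimal_cover X r s M B s' g"
    by standard (use X image gh minimal in auto)
  then show ?thesis by (rule that)
qed

text \<open>A minimal cover of \<open>I\<close>, then of its kernel, and so on. The covers have finitely many generators up to each
degree, and this is what makes the next cover possible.\<close>

theorem exists_minimal_resolution:
  fixes I :: "('v, 'k::field) mpoly set"
  assumes fin: "finite X"
    and I: "submodule X (single 0 ` I)" "graded_sub (\<lambda>_. 0) (single 0 ` I)" "I \<subseteq> poly_ring X"
  obtains F where "minimal_graded_free_resolution X I F"
proof -
  obtain r :: "'v \<Rightarrow> nat" where "inj_on r X" using finite_imp_inj_to_nat_seg[OF fin] by blast
  with fin have X: "finite X" "inj_on r X" .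
  have I0: "single 0 ` I \<subseteq> free_module X {0}" using I(3) by (auto intro: free_module_single)
  \<comment> \<open>a state consists of the basis, the degrees and the images of the basis vectors\<close>
  define P :: "nat \<Rightarrow> nat set \<times> (nat \<Rightarrow> nat) \<times> (nat \<Rightarrow> ('v, 'k) vec) \<Rightarrow> bool" where
    "P = (\<lambda>n (B, s, g). (\<forall>j. finite {b \<in> B. s b \<le> j}) \<and> (\<exists>s0 M. minimal_cover X r s0 M B s g) \<and>
       (n = 0 \<longrightarrow> minimal_cover X r (\<lambda>_. 0) (single 0 ` I) B s g))"
  define Q :: "nat \<Rightarrow> nat set \<times> (nat \<Rightarrow> nat) \<times> (nat \<Rightarrow> ('v, 'k) vec) \<Rightarrow> _ \<Rightarrow> bool" where
    "Q = (\<lambda>n (B, s, g) (B', s', g'). minimal_cover X r s (lin_kernel X B g) B' s' g')"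
  have "\<exists>f. \<forall>n. P n (f n) \<and> Q n (f n) (f (Suc n))"
  proof (rule dependent_nat_choice)
    obtain B s g where cov: "minimal_cover X r (\<lambda>_. 0) (single 0 ` I) B s g"
      by (rule exists_minimal_cover[OF X I(1,2) I0]) auto
    moreover have "finite {b \<in> B. s b \<le> j}" for j
      by (rule minimal_cover.finite_degrees[OF cov I0]) simp
    ultimately have "P 0 (B, s, g)" by (auto simp: P_def)
    then show "\<exists>x. P 0 x" by blast
  next
    fix x n assume "P n x"
    moreover obtain B s g where x: "x = (B, s, g)" by (metis prod_cases3)
    ultimately obtain s0 M where fin: "\<And>j. finite {b \<in> B. s b \<le> j}" and cov: "minimal_cover X r s0 M B s g"
      by (auto simp: P_def)
    have gr: "graded_sub s (lin_kernel X B g)"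
      by (rule graded_lin_kernel) (rule minimal_cover.graded[OF cov])
    have sub: "lin_kernel X B g \<subseteq> free_module X B" by (auto simp: lin_kernel_def)
    obtain B' s' g' where cov': "minimal_cover X r s (lin_kernel X B g) B' s' g'"
      by (rule exists_minimal_cover[OF X submodule_lin_kernel gr sub fin])
    moreover have "finite {b \<in> B'. s' b \<le> j}" for j
      by (rule minimal_cover.finite_degrees[OF cov' sub fin])
    ultimately have "P (Suc n) (B', s', g') \<and> Q n x (B', s', g')" by (auto simp: P_def Q_def x)
    then show "\<exists>y. P (Suc n) y \<and> Q n x y" by blast
  qed
  then obtain f where f: "\<And>n. P n (f n)" "\<And>n. Q n (f n) (f (Suc n))" by blast
  define B s g where "B = (\<lambda>n. fst (f n))" and "s = (\<lambda>n. fst (snd (f n)))" and "g = (\<lambda>n. snd (snd (f n)))"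
  have fn: "f n = (B n, s n, g n)" for n by (simp add: B_def s_def g_def)
  have c0: "minimal_cover X r (\<lambda>_. 0) (single 0 ` I) (B 0) (s 0) (g 0)"
    using f(1)[of 0] by (simp add: P_def fn)
  have cS: "minimal_cover X r (s n) (lin_kernel X (B n) (g n)) (B (Suc n)) (s (Suc n)) (g (Suc n))" for n
    using f(2)[of n] by (simp add: Q_def fn)
  define F :: "('v, 'k) free_complex" where
    "F = \<lparr>basis = B, shift = s, bd = (\<lambda>i. g (Suc i)), aug = (\<lambda>b. lookup (g 0 b) 0)\<rparr>"
  have gen_in: "g b \<in> M" if "minimal_cover X r s M B s' g" "b \<in> B" for s M B s' b and g :: "nat \<Rightarrow> ('v, 'k) vec"
    using minimal_cover.lin_in_M[OF that(1) free_module_single[OF that(2) poly_ring_1]] by (simp add: lin_ext_single)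
  have g0: "single 0 (lookup (g 0 b) 0) = g 0 b" "lookup (g 0 b) 0 \<in> I" if "b \<in> B 0" for b
    using gen_in[OF c0 that] by auto
  have cong: "lin_ext (res_gens F 0) w = lin_ext (g 0) w" if "w \<in> free_module X (B 0)" for w
    unfolding lin_ext_def using that g0 by (intro sum.cong) (auto simp: res_gens_def F_def free_module_def)
  have gens: "res_gens F (Suc i) = g (Suc i)" for i by (simp add: res_gens_def F_def)
  have kern: "lin_kernel X (B i) (res_gens F i) = lin_kernel X (B i) (g i)" for i
    by (cases i) (auto simp: lin_kernel_def cong gens)
  have "lin_ext (res_gens F i) ` free_module X (basis F i) = syzygies X I F i" for i
  proof (cases i)
    case 0
    then show ?thesis using minimal_cover.image[OF c0] cong by (simp add: F_def)
  next
    case (Suc n)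
    then show ?thesis using minimal_cover.image[OF cS[of n]] kern[of n] by (simp add: gens) (simp add: F_def)
  qed
  moreover have bd: "bd F i b \<in> lin_kernel X (B i) (g i)" if "b \<in> basis F (Suc i)" for i b
    using gen_in[OF cS] that by (simp add: F_def)
  ultimately have "free_resolution X I F"
    using g0 I(3) unfolding free_resolution_iff by (auto simp: F_def lin_kernel_def)
  moreover have "graded_complex F"
    unfolding graded_complex_def
  proof (intro conjI ballI allI)
    fix b m assume b: "b \<in> basis F 0" and m: "m \<in> keys (aug F b)"
    have "homog (\<lambda>_. 0) 0 (s 0 b) (g 0 b)" using minimal_cover.graded[OF c0] b by (simp add: F_def)
    then show "mdegree m = shift F 0 b" using m unfolding homog_def by (simp add: F_def in_keys_iff)
  next
    fix i b c m assume b: "b \<in> basis F (Suc i)" and m: "m \<in> keys (lookup (bd F i b) c)"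
    have "homog (s i) 0 (s (Suc i) b) (g (Suc i) b)" using minimal_cover.graded[OF cS] b by (simp add: F_def)
    then show "mdegree m + shift F i c = shift F (Suc i) b"
      using m unfolding homog_def by (simp add: F_def in_keys_iff)
  qed
  moreover have "minimal_complex F"
    unfolding minimal_complex_def
  proof (intro allI ballI)
    fix i b c assume b: "b \<in> basis F (Suc i)"
    have "\<exists>s0 M. minimal_cover X r s0 M (B i) (s i) (g i)" using f(1)[of i] by (simp add: P_def fn)
    then show "lookup (lookup (bd F i b) c) 0 = 0" using minimal_cover.minimal bd[OF b] by metis
  qed
  ultimately have "minimal_graded_free_resolution X I F" by (simp add: minimal_graded_free_resolution_def)
  then show ?thesis by (rule that)
qed

theorem finite_generators_in_degree:
  fixes F :: "('v, 'k::field) free_complex"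
  assumes F: "minimal_graded_free_resolution X I F" and fin: "finite X" and I: "I \<subseteq> poly_ring X"
  shows "finite {b \<in> basis F i. shift F i b \<le> j}"
proof -
  obtain r :: "'v \<Rightarrow> nat" where "inj_on r X" using finite_imp_inj_to_nat_seg[OF fin] by blast
  with fin have X: "finite X" "inj_on r X" .
  show ?thesis
  proof (induction i arbitrary: j)
  case 0
  have "single 0 ` I \<subseteq> free_module X {0}" using I by (auto intro: free_module_single)
  then show ?case
    using minimal_cover.finite_degrees[OF minimal_cover_of_resolution[OF F X, of 0], of "{0}"] by simp
next
  case (Suc i)
  have "lin_kernel X (basis F i) (res_gens F i) \<subseteq> free_module X (basis F i)" by (auto simp: lin_kernel_def)
  then show ?case
    using minimal_cover.finite_degrees[OF minimal_cover_of_resolution[OF F X, of "Suc i"], of "basis F i"] Suc.IH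
    by (simp add: res_shifts_def)
  qed
qed

theorem graded_betti_eq_0_iff:
  fixes I :: "('v, 'k::field) mpoly set"
  assumes X: "finite X" "inj_on r X"
    and I: "submodule X (single 0 ` I)" "graded_sub (\<lambda>_. 0) (single 0 ` I)" "I \<subseteq> poly_ring X"
  shows "graded_betti X I i j = 0 \<longleftrightarrow> koszul_exact X r (\<lambda>_. 0) (single 0 ` I) i j"
proof -
  define F :: "('v, 'k) free_complex" where "F = (SOME F. minimal_graded_free_resolution X I F)"
  obtain F0 :: "('v, 'k) free_complex" where "minimal_graded_free_resolution X I F0"
    by (rule exists_minimal_resolution[OF X(1) I])
  then have F: "minimal_graded_free_resolution X I F" unfolding F_def by (rule someI)
  have "finite {b \<in> basis F i. shift F i b = j}"
    by (rule finite_subset[OF _ finite_generators_in_degree[OF F X(1) I(3), of i j]]) auto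
  then have "graded_betti X I i j = 0 \<longleftrightarrow> (\<forall>b\<in>basis F i. shift F i b \<noteq> j)"
    by (auto simp: graded_betti_def F_def[symmetric])
  then show ?thesis by (simp add: no_generator_iff_koszul_exact[OF F X])
qed

section \<open>Edge ideals\<close>

definition edge_div :: "'v set set \<Rightarrow> 'v monomial \<Rightarrow> bool" where
  "edge_div \<E> m \<longleftrightarrow> (\<exists>E\<in>\<E>. E \<subseteq> keys m)"

lemma edge_div_mono: "edge_div \<E> m \<Longrightarrow> \<E> \<subseteq> \<F> \<Longrightarrow> keys m \<subseteq> keys n \<Longrightarrow> edge_div \<F> n"
  unfolding edge_div_def by blast

lemma edge_monomial_eq: "edge_monomial E = (single (chi E) 1 :: ('v, 'k::field) mpoly)"
proof (induction E rule: infinite_finite_induct)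
  case (insert x E)
  have "edge_monomial (insert x E) = (var x * edge_monomial E :: ('v, 'k) mpoly)"
    using insert.hyps by (simp add: edge_monomial_def)
  also have "\<dots> = single (single x 1 + chi E) 1" unfolding insert.IH by (simp add: var_def mult_single)
  also have "single x 1 + chi E = chi (insert x E)" using insert.hyps by (simp add: chi_def)
  finally show ?case .
qed (simp_all add: edge_monomial_def chi_def)

text \<open>Membership in a monomial ideal is decided monomial by monomial. For the converse each monomial of \<open>p\<close> is
charged to one edge that divides it.\<close>

lemma edge_ideal_iff:
  fixes H :: "'v hypergraph" and p :: "('v, 'k::field) mpoly"
  assumes fin: "finite (verts H)" and sub: "\<And>E. E \<in> edges H \<Longrightarrow> E \<subseteq> verts H"
  shows "p \<in> edge_ideal H \<longleftrightarrow> (\<forall>m. lookup p m \<noteq> 0 \<longrightarrow> keys m \<subseteq> verts H \<and> edge_div (edges H) m)"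
proof
  have finE: "finite E" if "E \<in> edges H" for E using sub[OF that] fin by (rule finite_subset)
  have "edges H \<subseteq> Pow (verts H)" using sub by blast
  then have fine: "finite (edges H)" by (rule finite_subset) (simp add: fin)
  { assume "p \<in> edge_ideal H"
    then obtain c where c: "\<And>E. E \<in> edges H \<Longrightarrow> c E \<in> poly_ring (verts H)"
      and p: "p = (\<Sum>E\<in>edges H. c E * edge_monomial E)"
      unfolding edge_ideal_def by blast
    show "\<forall>m. lookup p m \<noteq> 0 \<longrightarrow> keys m \<subseteq> verts H \<and> edge_div (edges H) m"
    proof (intro allI impI)
      fix m assume "lookup p m \<noteq> 0"
      then obtain E where E: "E \<in> edges H" and "lookup (c E * edge_monomial E) m \<noteq> 0"
        unfolding p lookup_sum by (metis (no_types, lifting) sum.neutral)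
      then have "m \<in> keys (c E * single (chi E) 1)" by (simp add: in_keys_iff edge_monomial_eq)
      then obtain a where "m = a + chi E" "a \<in> keys (c E)"
        using keys_mult[of "c E" "single (chi E) 1"] by auto
      then show "keys m \<subseteq> verts H \<and> edge_div (edges H) m"
        using c[OF E] sub[OF E] E finE[OF E] by (auto simp: keys_add_nat keys_chi poly_ring_def edge_div_def)
    qed }
  { assume p: "\<forall>m. lookup p m \<noteq> 0 \<longrightarrow> keys m \<subseteq> verts H \<and> edge_div (edges H) m"
    define e where "e = (\<lambda>m :: 'v monomial. SOME E. E \<in> edges H \<and> E \<subseteq> keys m)"
    have e: "e m \<in> edges H" "e m \<subseteq> keys m" if "m \<in> keys p" for m
    proof -
      have "\<exists>E. E \<in> edges H \<and> E \<subseteq> keys m" using p that unfolding edge_div_def by (auto simp: in_keys_iff)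
      from someI_ex[OF this] show "e m \<in> edges H" "e m \<subseteq> keys m" unfolding e_def by auto
    qed
    define c where "c = (\<lambda>E. \<Sum>m\<in>{m \<in> keys p. e m = E}. single (m - chi E) (lookup p m))"
    have "(\<Sum>E\<in>edges H. c E * edge_monomial E) = (\<Sum>E\<in>edges H. \<Sum>m\<in>{m \<in> keys p. e m = E}. single m (lookup p m))"
    proof (rule sum.cong)
      fix E assume E: "E \<in> edges H"
      have "c E * edge_monomial E = (\<Sum>m\<in>{m \<in> keys p. e m = E}. single (m - chi E + chi E) (lookup p m))"
        by (simp add: c_def edge_monomial_eq sum_distrib_right mult_single)
      also have "\<dots> = (\<Sum>m\<in>{m \<in> keys p. e m = E}. single m (lookup p m))"
        using e(2) by (intro sum.cong refl) (auto simp: minus_chi_add_chi)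
      finally show "c E * edge_monomial E = (\<Sum>m\<in>{m \<in> keys p. e m = E}. single m (lookup p m))" .
    qed simp
    also have "\<dots> = (\<Sum>m\<in>keys p. single m (lookup p m))"
      using e(1) by (intro sum.group finite_keys fine) auto
    also have "\<dots> = p" by (rule poly_mapping_expansion[symmetric])
    finally have "p = (\<Sum>E\<in>edges H. c E * edge_monomial E)" ..
    moreover have "c E \<in> poly_ring (verts H)" for E
      unfolding c_def
    proof (intro poly_ring_sum poly_ring_single)
      fix m assume "m \<in> {m \<in> keys p. e m = E}"
      then have "keys m \<subseteq> verts H" using p by (auto simp: in_keys_iff)
      then show "keys (m - chi E) \<subseteq> verts H" using keys_diff_nat_subset by (rule order_trans[rotated])
    qed
    ultimately show "p \<in> edge_ideal H" unfolding edge_ideal_def by blast }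
qed

lemma single_edge_ideal_iff:
  fixes H :: "'v hypergraph" and w :: "('v, 'k::field) vec"
  assumes "finite (verts H)" "\<And>E. E \<in> edges H \<Longrightarrow> E \<subseteq> verts H"
  shows "w \<in> single 0 ` edge_ideal H \<longleftrightarrow>
    (\<forall>b m. lookup (lookup w b) m \<noteq> 0 \<longrightarrow> b = 0 \<and> keys m \<subseteq> verts H \<and> edge_div (edges H) m)"
proof
  assume "w \<in> single 0 ` edge_ideal H"
  then obtain p where "p \<in> edge_ideal H" and w: "w = single 0 p" by blast
  then have "lookup p m \<noteq> 0 \<longrightarrow> keys m \<subseteq> verts H \<and> edge_div (edges H) m" for m
    using edge_ideal_iff[OF assms] by blast
  then show "\<forall>b m. lookup (lookup w b) m \<noteq> 0 \<longrightarrow> b = 0 \<and> keys m \<subseteq> verts H \<and> edge_div (edges H) m"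
    unfolding w by (simp add: lookup_single when_def)
next
  assume w: "\<forall>b m. lookup (lookup w b) m \<noteq> 0 \<longrightarrow> b = 0 \<and> keys m \<subseteq> verts H \<and> edge_div (edges H) m"
  then have "lookup w 0 \<in> edge_ideal H" by (simp add: edge_ideal_iff[OF assms])
  moreover have "w = single 0 (lookup w 0)"
    using w by (intro vec_eqI) (auto simp: lookup_single when_def)
  ultimately show "w \<in> single 0 ` edge_ideal H" by blast
qed

lemma edge_ideal_homogeneous:
  fixes H :: "'v hypergraph"
  assumes H: "finite (verts H)" "\<And>E. E \<in> edges H \<Longrightarrow> E \<subseteq> verts H"
  defines "I \<equiv> edge_ideal H :: ('v, 'k::field) mpoly set"
  shows "submodule (verts H) (single 0 ` I)" and "graded_sub (\<lambda>_. 0) (single 0 ` I)" and "I \<subseteq> poly_ring (verts H)"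
proof -
  have iff: "w \<in> single 0 ` I \<longleftrightarrow>
      (\<forall>b m. lookup (lookup w b) m \<noteq> 0 \<longrightarrow> b = 0 \<and> keys m \<subseteq> verts H \<and> edge_div (edges H) m)" for w :: "('v, 'k) vec"
    unfolding I_def by (rule single_edge_ideal_iff[OF H])
  have "v + w \<in> single 0 ` I" if "v \<in> single 0 ` I" "w \<in> single 0 ` I" for v w :: "('v, 'k) vec"
    using that unfolding iff lookup_add by (metis add.right_neutral)
  moreover have "p \<odot> w \<in> single 0 ` I" if p: "p \<in> poly_ring (verts H)" and w: "w \<in> single 0 ` I" for p and w :: "('v, 'k) vec"
    unfolding iff
  proof (intro allI impI)
    fix b m assume "lookup (lookup (p \<odot> w) b) m \<noteq> 0"
    then have "m \<in> keys (p * lookup w b)" by (simp add: in_keys_iff)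
    then obtain a c where m: "m = a + c" "a \<in> keys p" "c \<in> keys (lookup w b)"
      using keys_mult[of p "lookup w b"] by blast
    then have "b = 0 \<and> keys c \<subseteq> verts H \<and> edge_div (edges H) c" using w by (simp add: iff in_keys_iff)
    then show "b = 0 \<and> keys m \<subseteq> verts H \<and> edge_div (edges H) m"
      using m p by (auto simp: keys_add_nat poly_ring_def intro: edge_div_mono)
  qed
  moreover have "(0 :: ('v, 'k) vec) \<in> single 0 ` I" by (simp add: iff)
  ultimately show "submodule (verts H) (single 0 ` I)" by (simp add: submodule_def)
  show "graded_sub (\<lambda>_. 0) (single 0 ` I)"
    unfolding graded_sub_def Ball_def iff lookup_hcomp by (simp add: when_def)
  show "I \<subseteq> poly_ring (verts H)"
    by (auto simp: I_def edge_ideal_iff[OF H] poly_ring_iff)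
qed

section \<open>Linear quotients\<close>

text \<open>The sets of edges that can be listed so that each edge \<open>E\<close> satisfies: the colon of the ideal of the
previous edges by the monomial of \<open>E\<close> is generated by variables. The condition says that for a previous
edge \<open>E'\<close> there is a vertex \<open>y\<close> of \<open>E' - E\<close> that lies in the colon.\<close>

inductive linear_quotients :: "nat \<Rightarrow> 'v set set \<Rightarrow> bool" for d where
  empty: "linear_quotients d {}"
| insert: "linear_quotients d \<E> \<Longrightarrow> finite E \<Longrightarrow> card E = d \<Longrightarrow>
    (\<And>E'. E' \<in> \<E> \<Longrightarrow> \<exists>y\<in>E' - E. \<exists>G\<in>\<E>. G \<subseteq> insert y E) \<Longrightarrow> linear_quotients d (insert E \<E>)"

lemma in_keys_minus_chi:
  "finite \<sigma> \<Longrightarrow> w \<in> keys (u - chi \<sigma>) \<longleftrightarrow> (if w \<in> \<sigma> then 2 \<le> lookup u w else 1 \<le> lookup u w)"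
  by (auto simp: in_keys_iff lookup_minus lookup_chi)

lemma keys_minus_chi_mono: "\<tau> \<subseteq> \<sigma> \<Longrightarrow> finite \<sigma> \<Longrightarrow> keys (u - chi \<sigma>) \<subseteq> keys (u - chi \<tau>)"
  using finite_subset[of \<tau> \<sigma>] by (auto simp: in_keys_minus_chi split: if_splits)

text \<open>Adding \<open>E\<close> to \<open>\<E>\<close> adds those faces \<open>\<sigma>\<close> for which \<open>E\<close> fits into \<open>u - chi \<sigma>\<close> and no vertex of
\<open>Y\<close>, the set of variables that generate the colon, is left in \<open>u - chi \<sigma>\<close>. If such a face of cardinality
\<open>p\<close> exists and \<open>u\<close> does not have degree \<open>p + d\<close>, then \<open>u - chi \<sigma>\<close> is a proper multiple of the monomial of
\<open>E\<close>. A vertex \<open>v\<close> that divides the quotient is outside \<open>Y\<close>, and putting \<open>v\<close> into a new face or taking it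
out gives a new face again. Subtracting from a cycle the boundary of the cone over its new part leaves a
cycle on the old faces.\<close>

lemma linear_quotients_exact:
  fixes c :: "'v set \<Rightarrow> 'k::field"
  assumes "linear_quotients d \<E>" and r: "inj_on r (keys u)" and deg: "mdegree u \<noteq> p + d"
    and "scalar_cycle r (edge_div \<E>) u p c"
  shows "scalar_boundary r (edge_div \<E>) u p c"
  using assms(1,4)
proof (induction arbitrary: c)
  case empty
  then have "c \<sigma> = 0" for \<sigma> by (auto simp: scalar_cycle_def koszul_face_def edge_div_def)
  then show ?case by (auto simp: scalar_boundary_def scalar_d_def intro!: exI[of _ "\<lambda>_. 0"])
next
  case (insert \<E> E)
  let ?U = "keys u" and ?P = "edge_div (insert E \<E>)"
  have c: "c \<sigma> \<noteq> 0 \<Longrightarrow> koszul_face ?P u \<sigma> \<and> card \<sigma> = p" for \<sigma>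
    using insert.prems by (simp add: scalar_cycle_def)
  have cyc: "\<tau> \<subseteq> ?U \<Longrightarrow> scalar_d r ?U c \<tau> = 0" for \<tau>
    using insert.prems by (simp add: scalar_cycle_def)
  have fin: "\<sigma> \<subseteq> ?U \<Longrightarrow> finite \<sigma>" for \<sigma> by (rule finite_subset[OF _ finite_keys])
  define new where "new = (\<lambda>\<sigma>. koszul_face ?P u \<sigma> \<and> \<not> edge_div \<E> (u - chi \<sigma>))"
  define Y where "Y = {y. y \<notin> E \<and> (\<exists>G\<in>\<E>. G \<subseteq> insert y E)}"
  have new_iff: "new \<sigma> \<longleftrightarrow> \<sigma> \<subseteq> ?U \<and> E \<subseteq> keys (u - chi \<sigma>) \<and> Y \<inter> keys (u - chi \<sigma>) = {}" for \<sigma>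
  proof
    assume "new \<sigma>"
    then show "\<sigma> \<subseteq> ?U \<and> E \<subseteq> keys (u - chi \<sigma>) \<and> Y \<inter> keys (u - chi \<sigma>) = {}"
      unfolding new_def koszul_face_def edge_div_def Y_def by blast
  next
    assume *: "\<sigma> \<subseteq> ?U \<and> E \<subseteq> keys (u - chi \<sigma>) \<and> Y \<inter> keys (u - chi \<sigma>) = {}"
    have "\<not> E' \<subseteq> keys (u - chi \<sigma>)" if "E' \<in> \<E>" for E'
      using insert.hyps(4)[OF that] * unfolding Y_def by blast
    then show "new \<sigma>" using * unfolding new_def koszul_face_def edge_div_def by blast
  qed
  have mono: "koszul_face (edge_div \<E>) u \<sigma> \<Longrightarrow> koszul_face ?P u \<sigma>" for \<sigma>
    unfolding koszul_face_def edge_div_def by blast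
  have down: "edge_div \<F> (u - chi \<tau>)" if "edge_div \<F> (u - chi \<sigma>)" "\<sigma> \<subseteq> ?U" "\<tau> \<subseteq> \<sigma>" for \<F> \<sigma> \<tau>
    using edge_div_mono[OF that(1) order_refl keys_minus_chi_mono[OF that(3) fin[OF that(2)]]] .
  show ?case
  proof (cases "\<exists>\<sigma>. new \<sigma> \<and> c \<sigma> \<noteq> 0")
    case False
    have "scalar_cycle r (edge_div \<E>) u p c"
      unfolding scalar_cycle_def
    proof (intro conjI allI impI)
      fix \<sigma> assume "c \<sigma> \<noteq> 0"
      then have "\<not> new \<sigma>" "koszul_face ?P u \<sigma>" "card \<sigma> = p" using False c by auto
      then show "koszul_face (edge_div \<E>) u \<sigma>" "card \<sigma> = p" by (auto simp: new_def koszul_face_def)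
    qed (rule cyc)
    from insert.IH[OF this] show ?thesis using mono unfolding scalar_boundary_def by blast
  next
    case True
    then obtain \<sigma>0 where \<sigma>0: "new \<sigma>0" "c \<sigma>0 \<noteq> 0" by blast
    then have \<sigma>0': "\<sigma>0 \<subseteq> ?U" "E \<subseteq> keys (u - chi \<sigma>0)" "Y \<inter> keys (u - chi \<sigma>0) = {}" "card \<sigma>0 = p"
      using c[OF \<sigma>0(2)] by (auto simp: new_iff)
    \<comment> \<open>the apex of the cone: a variable by which \<open>u - chi \<sigma>0\<close> exceeds the monomial of \<open>E\<close>\<close>
    have "\<exists>v. (if v \<in> E then 1 else 0) < lookup (u - chi \<sigma>0) v"
    proof (rule ccontr)
      assume "\<not> ?thesis"
      then have le: "lookup (u - chi \<sigma>0) v \<le> (if v \<in> E then 1 else 0)" for v by (simp add: not_less)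
      have "u - chi \<sigma>0 = chi E"
      proof (rule poly_mapping_eqI)
        fix v
        have "lookup (u - chi \<sigma>0) v \<noteq> 0" if "v \<in> E" using \<sigma>0'(2) that by (auto simp: in_keys_iff)
        then show "lookup (u - chi \<sigma>0) v = lookup (chi E) v"
          using le[of v] by (cases "v \<in> E") (auto simp: lookup_chi insert.hyps(2))
      qed
      then have "u = chi E + chi \<sigma>0" using minus_chi_add_chi[OF \<sigma>0'(1)] by simp
      then have "mdegree u = card E + card \<sigma>0"
        using insert.hyps(2) fin[OF \<sigma>0'(1)] by (simp add: mdegree_add mdegree_chi)
      then show False using deg \<sigma>0'(4) insert.hyps(3) by simp
    qed
    then obtain v where v: "(if v \<in> E then 1 else 0) < lookup (u - chi \<sigma>0) v" by blast
    then have vk: "v \<in> keys (u - chi \<sigma>0)" by (simp add: in_keys_iff split: if_splits)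
    then have vY: "v \<notin> Y" using \<sigma>0'(3) by blast
    have vU: "v \<in> ?U" by (rule subsetD[OF keys_diff_nat_subset vk])
    have v2: "v \<in> E \<Longrightarrow> 2 \<le> lookup u v" using v by (auto simp: lookup_minus)
    have new_insert: "new (insert v \<sigma>)" if "new \<sigma>" for \<sigma>
    proof -
      have s: "\<sigma> \<subseteq> ?U" "finite \<sigma>" "insert v \<sigma> \<subseteq> ?U" using that vU fin by (auto simp: new_iff)
      have "E \<subseteq> keys (u - chi (insert v \<sigma>))"
      proof
        fix x assume x: "x \<in> E"
        then have "x \<in> keys (u - chi \<sigma>)" using that by (auto simp: new_iff)
        then show "x \<in> keys (u - chi (insert v \<sigma>))"
          using x v2 s(2) by (cases "x = v") (auto simp: in_keys_minus_chi)
      qed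
      moreover have "keys (u - chi (insert v \<sigma>)) \<subseteq> keys (u - chi \<sigma>)"
        using s(2) by (intro keys_minus_chi_mono) auto
      ultimately show ?thesis using s that unfolding new_iff by blast
    qed
    have new_remove: "new (\<sigma> - {v})" if "new \<sigma>" for \<sigma>
    proof -
      have s: "\<sigma> \<subseteq> ?U" "finite \<sigma>" using that fin by (auto simp: new_iff)
      have "Y \<inter> keys (u - chi (\<sigma> - {v})) \<subseteq> Y \<inter> keys (u - chi \<sigma>)"
      proof
        fix x assume x: "x \<in> Y \<inter> keys (u - chi (\<sigma> - {v}))"
        then have "x \<noteq> v" using vY by blast
        then show "x \<in> Y \<inter> keys (u - chi \<sigma>)"
          using x s(2) by (cases "x \<in> \<sigma>") (simp_all add: in_keys_minus_chi)
      qed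
      moreover have "keys (u - chi \<sigma>) \<subseteq> keys (u - chi (\<sigma> - {v}))"
        using s(2) by (intro keys_minus_chi_mono) auto
      ultimately show ?thesis using s(1) that unfolding new_iff by blast
    qed
    define cn where "cn = (\<lambda>\<sigma>. if new \<sigma> then c \<sigma> else 0)"
    define f where "f = cone r v cn"
    define c' where "c' = (\<lambda>\<sigma>. c \<sigma> - scalar_d r ?U f \<sigma>)"
    have f: "new \<sigma> \<and> card \<sigma> = Suc p" if nz: "f \<sigma> \<noteq> 0" for \<sigma>
    proof -
      have "v \<in> \<sigma>" "cn (\<sigma> - {v}) \<noteq> 0" using nz by (auto simp: f_def cone_def split: if_splits)
      then have "new (\<sigma> - {v})" and "c (\<sigma> - {v}) \<noteq> 0" by (auto simp: cn_def split: if_splits)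
      moreover from this have "card (\<sigma> - {v}) = p" using c by blast
      moreover have "insert v (\<sigma> - {v}) = \<sigma>" using \<open>v \<in> \<sigma>\<close> by blast
      ultimately have "new \<sigma>" using new_insert by metis
      then have "finite \<sigma>" using fin by (auto simp: new_iff)
      then show ?thesis using \<open>new \<sigma>\<close> \<open>card (\<sigma> - {v}) = p\<close> card.remove[of \<sigma> v] \<open>v \<in> \<sigma>\<close> by metis
    qed
    have c'_new: "c' \<sigma> = 0" if n: "new \<sigma>" for \<sigma>
    proof -
      have "scalar_d r ?U cn (\<sigma> - {v}) = scalar_d r ?U c (\<sigma> - {v})"
      proof (rule scalar_d_cong)
        fix w assume "w \<in> ?U - (\<sigma> - {v})"
        show "cn (insert w (\<sigma> - {v})) = c (insert w (\<sigma> - {v}))"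
        proof (rule ccontr)
          assume *: "\<not> ?thesis"
          then have nn: "\<not> new (insert w (\<sigma> - {v}))" and "c (insert w (\<sigma> - {v})) \<noteq> 0"
            by (auto simp: cn_def split: if_splits)
          then have "koszul_face ?P u (insert w (\<sigma> - {v}))" using c by blast
          then have "edge_div \<E> (u - chi (insert w (\<sigma> - {v})))" "insert w (\<sigma> - {v}) \<subseteq> ?U"
            using nn by (auto simp: new_def koszul_face_def)
          then have "edge_div \<E> (u - chi (\<sigma> - {v}))" by (rule down) blast
          then show False using new_remove[OF n] by (simp add: new_def)
        qed
      qed
      also have "\<dots> = 0" using n by (intro cyc) (auto simp: new_iff)
      finally have "cone r v (scalar_d r ?U cn) \<sigma> = 0" by (simp add: cone_def)
      then have "scalar_d r ?U f \<sigma> = cn \<sigma>"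
        using scalar_d_cone[OF finite_keys r vU, of \<sigma> cn] n by (simp add: f_def new_iff)
      then show ?thesis using n by (simp add: c'_def cn_def)
    qed
    have "scalar_cycle r (edge_div \<E>) u p c'"
      unfolding scalar_cycle_def
    proof (intro conjI allI impI)
      fix \<sigma> assume nz: "c' \<sigma> \<noteq> 0"
      have "koszul_face ?P u \<sigma> \<and> card \<sigma> = p"
      proof (cases "c \<sigma> = 0")
        case True
        then have "scalar_d r ?U f \<sigma> \<noteq> 0" using nz by (simp add: c'_def)
        then obtain w where w: "w \<in> ?U - \<sigma>" "f (insert w \<sigma>) \<noteq> 0"
          unfolding scalar_d_def by (metis (no_types, lifting) mult_zero_right sum.neutral)
        then have n: "koszul_face ?P u (insert w \<sigma>)" and card: "card (insert w \<sigma>) = Suc p"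
          using f by (auto simp: new_def)
        then have sub: "insert w \<sigma> \<subseteq> ?U" by (simp add: koszul_face_def)
        then have "finite \<sigma>" using fin by blast
        then have "card \<sigma> = p" using card w(1) by simp
        moreover have "koszul_face ?P u \<sigma>"
          using n sub down[of "insert E \<E>" "insert w \<sigma>" \<sigma>] unfolding koszul_face_def by blast
        ultimately show ?thesis by blast
      next
        case False
        then show ?thesis by (rule c)
      qed
      moreover have "\<not> new \<sigma>" using c'_new nz by blast
      ultimately show "koszul_face (edge_div \<E>) u \<sigma>" "card \<sigma> = p" by (auto simp: new_def koszul_face_def)
    next
      fix \<tau> assume "\<tau> \<subseteq> ?U"
      then show "scalar_d r ?U c' \<tau> = 0" unfolding c'_def scalar_d_diff by (simp add: cyc scalar_d_twice r)
    qed
    from insert.IH[OF this] obtain h where h: "\<And>\<sigma>. h \<sigma> \<noteq> 0 \<Longrightarrow> koszul_face (edge_div \<E>) u \<sigma> \<and> card \<sigma> = Suc p"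
      and dh: "\<And>\<sigma>. \<sigma> \<subseteq> ?U \<Longrightarrow> scalar_d r ?U h \<sigma> = c' \<sigma>"
      unfolding scalar_boundary_def by blast
    show ?thesis
      unfolding scalar_boundary_def
    proof (intro exI[of _ "\<lambda>\<sigma>. f \<sigma> + h \<sigma>"] conjI allI impI)
      fix \<sigma> assume "f \<sigma> + h \<sigma> \<noteq> 0"
      then have "f \<sigma> \<noteq> 0 \<or> h \<sigma> \<noteq> 0" by auto
      then show "koszul_face ?P u \<sigma>" "card \<sigma> = Suc p" using f h mono by (auto simp: new_def)
    next
      fix \<sigma> assume "\<sigma> \<subseteq> ?U"
      then show "scalar_d r ?U (\<lambda>\<sigma>. f \<sigma> + h \<sigma>) \<sigma> = c \<sigma>" by (simp add: scalar_d_add dh c'_def)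
    qed
  qed
qed

lemma linear_quotients_koszul_exact:
  fixes H :: "'v hypergraph"
  assumes H: "finite (verts H)" "\<And>E. E \<in> edges H \<Longrightarrow> E \<subseteq> verts H" and r: "inj_on r (verts H)"
    and lq: "linear_quotients d (edges H)" and j: "j \<noteq> p + d"
  shows "koszul_exact (verts H) r (\<lambda>_. 0) (single 0 ` (edge_ideal H :: ('v, 'k::field) mpoly set)) p j"
  unfolding koszul_exact_def
proof (intro allI impI, elim conjE)
  fix z :: "'v set \<Rightarrow> ('v, 'k) vec"
  let ?M = "single 0 ` (edge_ideal H :: ('v, 'k) mpoly set)" and ?X = "verts H"
  assume "\<forall>\<sigma>\<subseteq>?X. card \<sigma> = p \<longrightarrow> z \<sigma> \<in> ?M \<and> homog (\<lambda>_. 0) p j (z \<sigma>)"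
    and "\<forall>\<tau>\<subseteq>?X. Suc (card \<tau>) = p \<longrightarrow> koszul_d ?X r z \<tau> = 0"
  then have zM: "\<And>\<sigma>. \<sigma> \<subseteq> ?X \<Longrightarrow> card \<sigma> = p \<Longrightarrow> z \<sigma> \<in> ?M"
    and zh: "\<And>\<sigma>. \<sigma> \<subseteq> ?X \<Longrightarrow> card \<sigma> = p \<Longrightarrow> homog (\<lambda>_. 0) p j (z \<sigma>)"
    and zc: "\<And>\<tau>. \<tau> \<subseteq> ?X \<Longrightarrow> Suc (card \<tau>) = p \<Longrightarrow> koszul_d ?X r z \<tau> = 0"
    by auto
  have iff: "w \<in> ?M \<longleftrightarrow>
      (\<forall>b m. lookup (lookup w b) m \<noteq> 0 \<longrightarrow> b = 0 \<and> keys m \<subseteq> ?X \<and> edge_div (edges H) m)" for w :: "('v, 'k) vec"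
    by (rule single_edge_ideal_iff[OF H])
  define P where "P = (\<lambda>(b::nat) m. b = 0 \<and> edge_div (edges H) m)"
  obtain y where y: "\<And>\<sigma>. \<sigma> \<subseteq> ?X \<Longrightarrow> card \<sigma> = p \<Longrightarrow> koszul_d ?X r y \<sigma> = z \<sigma>"
    and ys: "\<And>\<sigma> b m. lookup (lookup (y \<sigma>) b) m \<noteq> 0 \<Longrightarrow> P b m \<and> keys m \<subseteq> ?X \<and> \<sigma> \<subseteq> ?X \<and> card \<sigma> = Suc p \<and>
        (\<exists>\<sigma>' m'. \<sigma>' \<subseteq> ?X \<and> card \<sigma>' = p \<and> lookup (lookup (z \<sigma>') b) m' \<noteq> 0 \<and> m' + chi \<sigma>' = m + chi \<sigma>)"
  proof (rule koszul_assemble[OF H(1), of p z P r])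
    fix \<sigma> b m assume "\<sigma> \<subseteq> ?X" "card \<sigma> = p" "lookup (lookup (z \<sigma>) b) m \<noteq> 0"
    then show "P b m \<and> keys m \<subseteq> ?X" using zM[of \<sigma>] unfolding iff P_def by blast
  next
    fix \<sigma> b m and c :: "'v set \<Rightarrow> 'k"
    assume \<sigma>: "\<sigma> \<subseteq> ?X" "card \<sigma> = p" and nz: "lookup (lookup (z \<sigma>) b) m \<noteq> 0" and c: "scalar_cycle r (P b) (m + chi \<sigma>) p c"
    have fin: "finite \<sigma>" using \<sigma>(1) H(1) by (rule finite_subset)
    have b: "b = 0" and m: "keys m \<subseteq> ?X" using zM[OF \<sigma>] nz unfolding iff by blast+
    have P: "P b = edge_div (edges H)" by (simp add: P_def b)
    have "keys (m + chi \<sigma>) \<subseteq> ?X" using m \<sigma>(1) fin by (simp add: keys_add_nat keys_chi)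
    then have "inj_on r (keys (m + chi \<sigma>))" by (rule inj_on_subset[OF r])
    moreover have "mdegree (m + chi \<sigma>) \<noteq> p + d"
      using zh[OF \<sigma>] nz \<sigma>(2) j fin unfolding homog_def by (simp add: mdegree_add mdegree_chi)
    ultimately show "scalar_boundary r (P b) (m + chi \<sigma>) p c"
      using c unfolding P by (intro linear_quotients_exact[OF lq])
  qed (use zc in \<open>blast+\<close>)
  show "\<exists>y. (\<forall>\<sigma>\<subseteq>?X. card \<sigma> = Suc p \<longrightarrow> y \<sigma> \<in> ?M) \<and> (\<forall>\<sigma>\<subseteq>?X. card \<sigma> = p \<longrightarrow> koszul_d ?X r y \<sigma> = z \<sigma>)"
  proof (intro exI[of _ y] conjI allI impI)
    show "y \<sigma> \<in> ?M" for \<sigma> unfolding iff using ys[of \<sigma>] unfolding P_def by blast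
  qed (rule y)
qed

section \<open>Geodesics between edges\<close>

definition edge_path :: "nat \<Rightarrow> 'v hypergraph \<Rightarrow> (nat \<Rightarrow> 'v set) \<Rightarrow> nat \<Rightarrow> bool" where
  "edge_path d H P n \<longleftrightarrow> (\<forall>i\<le>n. P i \<in> edges H) \<and> (\<forall>i<n. card (P i \<inter> P (Suc i)) = d - 1)"

lemma edge_path_append:
  assumes P: "edge_path d H P m" and Q: "edge_path d H Q n" and eq: "P m = Q 0"
  shows "edge_path d H (\<lambda>i. if i \<le> m then P i else Q (i - m)) (m + n)"
  unfolding edge_path_def
proof (intro conjI allI impI)
  fix i assume "i \<le> m + n"
  then show "(if i \<le> m then P i else Q (i - m)) \<in> edges H" using P Q by (auto simp: edge_path_def)
next
  fix i assume "i < m + n"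
  show "card ((if i \<le> m then P i else Q (i - m)) \<inter> (if Suc i \<le> m then P (Suc i) else Q (Suc i - m))) = d - 1"
  proof (cases "i < m")
    case True
    then show ?thesis using P by (simp add: edge_path_def)
  next
    case False
    then have "i - m < n" and "Suc i - m = Suc (i - m)" using \<open>i < m + n\<close> by auto
    moreover have "(if i \<le> m then P i else Q (i - m)) = Q (i - m)" using False eq by auto
    ultimately show ?thesis using Q False by (simp add: edge_path_def)
  qed
qed

lemma edge_path_of_proper_chain:
  assumes "proper_chain d H Es xs"
  shows "edge_path d H ((!) Es) (length xs)" and "Es ! 0 = hd Es" and "Es ! length xs = last Es"
proof -
  have len: "length Es = length xs + 1" and sub: "set Es \<subseteq> edges H"
    using assms by (auto simp: proper_chain_def chain_def)
  then have "Es \<noteq> []" by auto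
  then show "Es ! 0 = hd Es" "Es ! length xs = last Es" using len by (simp_all add: hd_conv_nth last_conv_nth)
  show "edge_path d H ((!) Es) (length xs)"
    using assms len sub nth_mem unfolding edge_path_def proper_chain_def by fastforce
qed

text \<open>A path that is no longer than the number of vertices it has to exchange. Each step gives up one vertex,
and counting shows that no vertex is given up twice and none of the target is given up at all.\<close>

locale geodesic =
  fixes d :: nat and H :: "'v hypergraph" and P :: "nat \<Rightarrow> 'v set" and n :: nat
  assumes path: "edge_path d H P n"
    and uniform: "\<And>E. E \<in> edges H \<Longrightarrow> finite E \<and> card E = d" and d: "d \<ge> 1"
    and short: "n \<le> card (P 0 - P n)"
begin

lemma P_finite: "i \<le> n \<Longrightarrow> finite (P i)" and P_card: "i \<le> n \<Longrightarrow> card (P i) = d"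
  using path uniform by (auto simp: edge_path_def)

lemma step: "i < n \<Longrightarrow> \<exists>z. P i - P (Suc i) = {z}"
proof -
  assume i: "i < n"
  then have "card (P i - P (Suc i)) = d - (d - 1)"
    using path P_finite[of i] P_card[of i] by (simp add: card_Diff_subset_Int edge_path_def)
  then have "card (P i - P (Suc i)) = 1" using d by simp
  then show ?thesis by (rule card_1_singletonE) blast
qed

definition lost :: "nat \<Rightarrow> 'v" where "lost i = the_elem (P i - P (Suc i))"

lemma lost: "i < n \<Longrightarrow> P i - P (Suc i) = {lost i}"
proof -
  assume "i < n"
  then obtain z where z: "P i - P (Suc i) = {z}" using step by blast
  then show ?thesis unfolding lost_def z by (simp only: the_elem_eq)
qed

lemma lost_later: "x \<in> P i \<Longrightarrow> x \<notin> P j \<Longrightarrow> i \<le> j \<Longrightarrow> j \<le> n \<Longrightarrow> \<exists>k. i \<le> k \<and> k < j \<and> lost k = x"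
proof (induction "j - i" arbitrary: j)
  case 0
  then show ?case by simp
next
  case (Suc m)
  then obtain j' where j: "j = Suc j'" by (cases j) auto
  show ?case
  proof (cases "x \<in> P j'")
    case True
    then have "x \<in> P j' - P (Suc j')" using Suc.prems j by simp
    then have "lost j' = x" using lost[of j'] Suc.prems j by simp
    then show ?thesis using Suc j by (intro exI[of _ j']) auto
  next
    case False
    then have "\<exists>k. i \<le> k \<and> k < j' \<and> lost k = x" using Suc j by (intro Suc.hyps(1)) auto
    then show ?thesis using j by auto
  qed
qed

lemma lost_image: "P 0 - P n = lost ` {..<n}" and lost_inj: "inj_on lost {..<n}"
proof -
  have sub: "P 0 - P n \<subseteq> lost ` {..<n}" using lost_later[of _ 0 n] by blast
  have le: "card (lost ` {..<n}) \<le> n" using card_image_le[of "{..<n}" lost] by simp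
  show eq: "P 0 - P n = lost ` {..<n}"
    using short le by (intro card_seteq sub) auto
  then have "card (lost ` {..<n}) = card {..<n}" using short le by simp
  then show "inj_on lost {..<n}" by (intro eq_card_imp_inj_on) auto
qed

lemma lost_in: "i < n \<Longrightarrow> j \<le> i \<Longrightarrow> lost i \<in> P j"
proof (rule ccontr)
  assume i: "i < n" "j \<le> i" and "lost i \<notin> P j"
  moreover have "lost i \<in> P 0" using lost_image i by auto
  ultimately obtain k where "k < j" "lost k = lost i" using lost_later[of "lost i" 0 j] by auto
  then show False using i inj_onD[OF lost_inj, of k i] by auto
qed

lemma lost_out: "i < j \<Longrightarrow> j \<le> n \<Longrightarrow> lost i \<notin> P j"
proof
  assume i: "i < j" "j \<le> n" and "lost i \<in> P j"
  moreover have "lost i \<notin> P n" using lost_image i by auto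
  ultimately obtain k where "j \<le> k" "k < n" "lost k = lost i" using lost_later[of "lost i" j n] by auto
  then show False using i inj_onD[OF lost_inj, of k i] by auto
qed

text \<open>As vertex between two consecutive edges the chain uses the one that is lost in the next step, which is
still there in both. For the last step any common vertex will do: it belongs to the final edge, so it is
none of the lost ones.\<close>

lemma proper_chain:
  assumes d2: "d \<ge> 2" and verts: "\<And>E. E \<in> edges H \<Longrightarrow> E \<subseteq> verts H"
  obtains xs where "proper_chain d H (map P [0..<Suc n]) xs" "length xs = n"
proof (cases n)
  case 0
  then have "proper_chain d H (map P [0..<Suc n]) []"
    using path by (simp add: proper_chain_def chain_def edge_path_def)
  then show ?thesis using that 0 by auto
next
  case (Suc m)
  have "card (P m \<inter> P n) = d - 1" using path Suc by (simp add: edge_path_def)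
  then have "P m \<inter> P n \<noteq> {}" using d2 by auto
  then obtain w where w: "w \<in> P m" "w \<in> P n" by blast
  define x where "x = (\<lambda>i. if i < m then lost (Suc i) else w)"
  have xP: "x i \<in> P i" "x i \<in> P (Suc i)" if "i < n" for i
  proof -
    have "i < m \<Longrightarrow> lost (Suc i) \<in> P i \<and> lost (Suc i) \<in> P (Suc i)" using lost_in[of "Suc i"] Suc by simp
    then show "x i \<in> P i" "x i \<in> P (Suc i)" using that w Suc by (auto simp: x_def less_Suc_eq)
  qed
  have x_inj: "inj_on x {..<n}"
  proof (rule linorder_inj_onI)
    fix i j assume ij: "i < j" "i \<in> {..<n}" "j \<in> {..<n}"
    then have "x i = lost (Suc i)" using Suc by (simp add: x_def)
    moreover have "x j \<noteq> lost (Suc i)"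
    proof (cases "j < m")
      case True
      then show ?thesis using ij Suc inj_onD[OF lost_inj, of "Suc i" "Suc j"] by (auto simp: x_def)
    next
      case False
      then show ?thesis using lost_out[of "Suc i" n] w ij Suc by (auto simp: x_def)
    qed
    ultimately show "x i \<noteq> x j" by simp
  qed auto
  have P_inj: "inj_on P {..n}"
  proof (rule linorder_inj_onI)
    fix i j assume "i < j" "i \<in> {..n}" "j \<in> {..n}"
    then show "P i \<noteq> P j" using lost_in[of i i] lost_out[of i j] by auto
  qed auto
  have edge: "P i \<in> edges H" if "i \<le> n" for i using path that by (simp add: edge_path_def)
  have "proper_chain d H (map P [0..<Suc n]) (map x [0..<n])"
    unfolding proper_chain_def chain_def
  proof (intro conjI allI impI)
    show "set (map P [0..<Suc n]) \<subseteq> edges H" using edge by auto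
    have "x i \<in> verts H" if "i < n" for i
      using xP(1)[OF that] verts[OF edge[of i]] that by auto
    then show "set (map x [0..<n]) \<subseteq> verts H" by auto
    show "distinct (map P [0..<Suc n])" 
      unfolding distinct_map using P_inj by (auto simp: atLeast0LessThan lessThan_Suc_atMost simp del: upt_Suc)
    show "distinct (map x [0..<n])" unfolding distinct_map using x_inj by (simp add: atLeast0LessThan)
  next
    fix i assume "i < length (map x [0..<n])"
    then have i: "i < n" by simp
    show "map x [0..<n] ! i \<in> map P [0..<Suc n] ! i" "map x [0..<n] ! i \<in> map P [0..<Suc n] ! (i + 1)"
      using xP i by (simp_all add: nth_append del: upt_Suc)
    show "card (map P [0..<Suc n] ! i \<inter> map P [0..<Suc n] ! (i + 1)) = d - 1"
      using path i by (simp add: edge_path_def del: upt_Suc)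
  qed simp
  then show ?thesis using that by auto
qed

end

section \<open>Edge distances\<close>

lemma length_interleave: "length (interleave Es xs) = length Es + length xs"
  by (induction Es xs rule: interleave.induct) auto

text \<open>A shortest proper chain with given ends is irredundant, since a proper subsequence would be shorter.\<close>

lemma edge_dist_le:
  assumes "proper_chain d H Es xs"
  shows "edge_dist d H (hd Es) (last Es) \<le> enat (length xs)"
proof -
  let ?Q = "\<lambda>(Fs, ys). proper_chain d H Fs ys \<and> hd Fs = hd Es \<and> last Fs = last Es"
  obtain Fs ys where F: "?Q (Fs, ys)" and least: "\<And>Gs zs. ?Q (Gs, zs) \<Longrightarrow> length ys \<le> length zs"
    using arg_min_natI[of ?Q "(Es, xs)" "\<lambda>(Fs, ys). length ys"] arg_min_nat_le[of ?Q _ "\<lambda>(Fs, ys). length ys"] assms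
    by (cases "arg_min (\<lambda>(Fs, ys). length ys) ?Q") fastforce
  have "irredundant_chain d H Fs ys"
    unfolding irredundant_chain_def
  proof (intro conjI notI)
    show "proper_chain d H Fs ys" using F by simp
    assume "\<exists>Gs zs. proper_chain d H Gs zs \<and> hd Gs = hd Fs \<and> last Gs = last Fs \<and>
        strict_subseq (interleave Gs zs) (interleave Fs ys)"
    then obtain Gs zs where G: "proper_chain d H Gs zs" "hd Gs = hd Fs" "last Gs = last Fs"
      and sub: "strict_subseq (interleave Gs zs) (interleave Fs ys)" by blast
    have "length (interleave Gs zs) < length (interleave Fs ys)"
      using sub subseq_same_length list_emb_length by (metis le_neq_implies_less subseq_order.less_le)
    moreover have "length Gs = length zs + 1" "length Fs = length ys + 1"
      using G F by (auto simp: proper_chain_def chain_def)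
    ultimately have "length zs < length ys" by (simp add: length_interleave)
    moreover have "length ys \<le> length zs" using least G F by simp
    ultimately show False by simp
  qed
  then have "edge_dist d H (hd Es) (last Es) \<le> enat (length ys)"
    unfolding edge_dist_def using F by (intro Inf_lower) auto
  also have "\<dots> \<le> enat (length xs)" using least assms by simp
  finally show ?thesis .
qed

lemma edge_dist_path:
  assumes "edge_dist d H E E' \<le> enat k"
  obtains P n where "edge_path d H P n" "P 0 = E" "P n = E'" "n \<le> k"
proof -
  let ?S = "{enat (length xs) | Es xs. irredundant_chain d H Es xs \<and> hd Es = E \<and> last Es = E'}"
  have "?S \<noteq> {}"
  proof
    assume "?S = {}"
    then have "edge_dist d H E E' = \<infinity>" unfolding edge_dist_def by (simp add: Inf_enat_def)
    then show False using assms by simp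
  qed
  then have "Inf ?S \<in> ?S" by (metis (no_types, lifting) LeastI Inf_enat_def ex_in_conv)
  then obtain Es xs where E: "irredundant_chain d H Es xs" "hd Es = E" "last Es = E'"
    and "edge_dist d H E E' = enat (length xs)"
    unfolding edge_dist_def by blast
  then have "length xs \<le> k" using assms by simp
  moreover have "proper_chain d H Es xs" using E by (simp add: irredundant_chain_def)
  ultimately show ?thesis using edge_path_of_proper_chain[of d H Es xs] E that[of "(!) Es" "length xs"] by simp
qed

lemma edge_dist_le_of_path:
  assumes path: "edge_path d H P n" and short: "n \<le> card (P 0 - P n)"
    and H: "\<And>E. E \<in> edges H \<Longrightarrow> finite E \<and> card E = d \<and> E \<subseteq> verts H" and d2: "d \<ge> 2"
  shows "edge_dist d H (P 0) (P n) \<le> enat n"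
proof -
  interpret geodesic d H P n using path short H d2 by unfold_locales auto
  obtain xs where xs: "proper_chain d H (map P [0..<Suc n]) xs" "length xs = n"
    using proper_chain[OF d2] H by blast
  have "hd (map P [0..<Suc n]) = P 0" by (simp add: upt_rec)
  then show ?thesis using edge_dist_le[OF xs(1)] xs(2) by simp
qed

text \<open>The last edge before \<open>P n\<close> differs from \<open>P n\<close> by one exchange, and the vertex given up in this last step
belongs to \<open>P 0 - P n\<close> because the path is geodesic.\<close>

lemma exchange_of_path:
  assumes path: "edge_path d H P n" and short: "n \<le> card (P 0 - P n)" and ne: "P 0 \<noteq> P n"
    and H: "\<And>E. E \<in> edges H \<Longrightarrow> finite E \<and> card E = d" and d: "d \<ge> 1"
  shows "\<exists>y\<in>P 0 - P n. \<exists>z\<in>P n. insert y (P n - {z}) \<in> edges H"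
proof -
  interpret geodesic d H P n using path short H d by unfold_locales auto
  obtain m where n: "n = Suc m" using ne by (cases n) auto
  have y: "P m - P n = {lost m}" using lost[of m] n by simp
  have int: "card (P m \<inter> P n) = d - 1" using path n by (simp add: edge_path_def)
  then have "card (P n - P m) = 1"
    using P_finite[of n] P_card[of n] d by (simp add: card_Diff_subset_Int Int_commute)
  then obtain z where z: "P n - P m = {z}" by (rule card_1_singletonE)
  have "insert (lost m) (P n - {z}) = P m" using y z by blast
  moreover have "P m \<in> edges H" using path n by (simp add: edge_path_def)
  moreover have "lost m \<in> P 0 - P n" using lost_image n by auto
  moreover have "z \<in> P n" using z by blast
  ultimately show ?thesis by metis
qed

section \<open>Triangulated hypergraphs\<close>

text \<open>Induction on the vertex set \<open>Y\<close>: if \<open>x\<close> is the vertex of \<open>Y\<close> provided by the triangulation, the edges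
without \<open>x\<close> come first, the edges with \<open>x\<close> follow in any order. An edge \<open>E\<close> with \<open>x\<close> and a neighbour \<open>y\<close> of
\<open>x\<close> outside \<open>E\<close> give the edge \<open>E - x + y\<close> by completeness, and this edge does not contain \<open>x\<close>. So it is
enough to find a neighbour of \<open>x\<close> in \<open>E' - E\<close>, or the edge \<open>E - x + y\<close> itself: if \<open>E'\<close> contains \<open>x\<close> then all
its vertices are neighbours, and otherwise exchange gives \<open>E - z + y\<close>, where either \<open>z = x\<close> or \<open>y\<close> is a
neighbour of \<open>x\<close>.\<close>

lemma triangulated_linear_quotients:
  assumes simple: "simple_hypergraph H" and uni: "uniform d H" and tri: "triangulated d H"
    and exchange: "\<And>E E'. E \<in> edges H \<Longrightarrow> E' \<in> edges H \<Longrightarrow> E \<noteq> E' \<Longrightarrow>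
       \<exists>y\<in>E' - E. \<exists>z\<in>E. insert y (E - {z}) \<in> edges H"
  shows "linear_quotients d (edges H)"
proof -
  have fin: "finite (verts H)" and sub: "\<And>E. E \<in> edges H \<Longrightarrow> E \<subseteq> verts H"
    and two: "\<And>E. E \<in> edges H \<Longrightarrow> 2 \<le> card E"
    using simple by (auto simp: simple_hypergraph_def)
  have card: "card E = d" and finE: "finite E" if "E \<in> edges H" for E
    using uni that sub[OF that] fin by (auto simp: uniform_def intro: finite_subset)
  have "Y \<subseteq> verts H \<Longrightarrow> linear_quotients d {E \<in> edges H. E \<subseteq> Y}" for Y
  proof (induction "card Y" arbitrary: Y rule: less_induct)
    case less
    show ?case
    proof (cases "Y = {}")
      case True
      then have none: "{E \<in> edges H. E \<subseteq> Y} = {}" using two by fastforce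
      show ?thesis unfolding none by (rule linear_quotients.empty)
    next
      case False
      then obtain x where x: "x \<in> Y" and
        "complete_hypergraph d (card (neighbors (induced H Y) x) + 1)
           (induced (induced H Y) (neighbors (induced H Y) x \<union> {x}))"
        using tri less.prems unfolding triangulated_def Let_def by blast
      moreover define N where "N = neighbors (induced H Y) x"
      ultimately have complete: "{E \<in> edges H. E \<subseteq> Y \<and> E \<subseteq> N \<union> {x}} = {E. E \<subseteq> N \<union> {x} \<and> card E = d}"
        by (simp add: complete_hypergraph_def induced_def conj_assoc)
      have nbr: "E - {x} \<subseteq> N" if "E \<in> edges H" "E \<subseteq> Y" "x \<in> E" for E
        using that by (auto simp: N_def neighbors_def induced_def)
      have xN: "x \<notin> N" by (simp add: N_def neighbors_def)
      let ?Z = "{E \<in> edges H. E \<subseteq> Y - {x}}" and ?S = "{E \<in> edges H. E \<subseteq> Y \<and> x \<in> E}"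
      have "finite Y" using less.prems fin by (rule finite_subset)
      then have "card (Y - {x}) < card Y" using x by (rule card_Diff1_less)
      then have Z: "linear_quotients d ?Z" using less.prems by (intro less.hyps) auto
      have colon: "\<exists>y\<in>E' - E. \<exists>G\<in>?Z. G \<subseteq> insert y E"
        if E: "E \<in> ?S" and E': "E' \<in> edges H" "E' \<subseteq> Y" and ne: "E' \<noteq> E" for E E'
      proof -
        have E1: "E \<in> edges H" "E \<subseteq> Y" "x \<in> E" using E by auto
        have swap: "\<exists>G\<in>?Z. G \<subseteq> insert y E" if y: "y \<in> N" "y \<notin> E" for y
        proof -
          have "insert y (E - {x}) \<subseteq> N" using y nbr[OF E1] by simp
          moreover have "card (insert y (E - {x})) = d"
          proof -
            have "card (insert y (E - {x})) = Suc (card (E - {x}))"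
              using y finE[OF E1(1)] by (intro card_insert_disjoint) auto
            also have "\<dots> = card E" by (rule card.remove[OF finE[OF E1(1)] E1(3), symmetric])
            finally show ?thesis using card[OF E1(1)] by simp
          qed
          ultimately have "insert y (E - {x}) \<in> {E. E \<subseteq> N \<union> {x} \<and> card E = d}" by blast
          then have "insert y (E - {x}) \<in> edges H" "insert y (E - {x}) \<subseteq> Y" unfolding complete[symmetric] by auto
          moreover have "x \<notin> insert y (E - {x})" using y xN by auto
          ultimately have "insert y (E - {x}) \<in> ?Z" by blast
          then show ?thesis by (rule rev_bexI) auto
        qed
        show ?thesis
        proof (cases "x \<in> E'")
          case True
          have "\<not> E' \<subseteq> E" using simple E1(1) E' ne by (auto simp: simple_hypergraph_def)
          then obtain y where y: "y \<in> E'" "y \<notin> E" by blast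
          then have "y \<in> N" using nbr[OF E' True] E1(3) by blast
          from swap[OF this y(2)] show ?thesis by (rule rev_bexI[rotated]) (simp add: y)
        next
          case False
          obtain y z where y: "y \<in> E' - E" and z: "z \<in> E" and G: "insert y (E - {z}) \<in> edges H"
            using exchange[OF E1(1) E'(1)] ne by blast
          have GY: "insert y (E - {z}) \<subseteq> Y" using y E1(2) E'(2) by blast
          show ?thesis
          proof (cases "z = x")
            case True
            then have "insert y (E - {z}) \<in> ?Z" using G GY y False by blast
            then have "\<exists>G\<in>?Z. G \<subseteq> insert y E" by (rule rev_bexI) auto
            then show ?thesis by (rule rev_bexI[OF y])
          next
            case zx: False
            then have "y \<in> N" using nbr[OF G GY] E1(3) y False by blast
            then have "\<exists>G\<in>?Z. G \<subseteq> insert y E" using y by (intro swap) auto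
            then show ?thesis by (rule rev_bexI[OF y])
          qed
        qed
      qed
      have "linear_quotients d (?Z \<union> S)" if "finite S" "S \<subseteq> ?S" for S
        using that
      proof (induction S)
        case empty
        then show ?case using Z by simp
      next
        case (insert E S)
        have E: "E \<in> ?S" using insert.prems by blast
        have "linear_quotients d (insert E (?Z \<union> S))"
        proof (rule linear_quotients.insert)
          show "linear_quotients d (?Z \<union> S)" using insert by blast
          show "finite E" "card E = d" using E finE card by auto
          fix E' assume E': "E' \<in> ?Z \<union> S"
          then have "E' \<in> edges H" "E' \<subseteq> Y" "E' \<noteq> E" using insert E by auto
          from colon[OF E this] obtain y G where "y \<in> E' - E" "G \<in> ?Z" "G \<subseteq> insert y E"
            by (elim bexE)
          then show "\<exists>y\<in>E' - E. \<exists>G\<in>?Z \<union> S. G \<subseteq> insert y E"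
            by (intro bexI[of _ y] bexI[of _ G] UnI1)
        qed
        then show ?case by simp
      qed
      moreover have "finite ?S" using fin less.prems sub by (intro finite_subset[of ?S "Pow (verts H)"]) auto
      ultimately have "linear_quotients d (?Z \<union> ?S)" by blast
      moreover have "?Z \<union> ?S = {E \<in> edges H. E \<subseteq> Y}" by blast
      ultimately show ?thesis by simp
    qed
  qed
  from this[of "verts H"] show ?thesis using sub by (simp add: Collect_conj_eq Int_absorb2 subset_iff Collect_mem_eq)
qed

text \<open>The difference of a vertex of \<open>E\<close> and a vertex of \<open>E'\<close> is a cycle in multidegree \<open>E \<union> E'\<close>. Its
coefficients over \<open>E\<close> add up to 1, whereas in the boundary of a chain of pairs that do not connect \<open>E\<close> to
\<open>E'\<close> they add up to 0. Hence some pair of \<open>v \<in> E\<close> and \<open>w \<in> E'\<close> is a face, and its face condition is an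
edge that avoids \<open>v\<close> and \<open>w\<close>.\<close>

lemma linear_syzygies_connect:
  fixes H :: "'v hypergraph"
  assumes H: "finite (verts H)" "\<And>E. E \<in> edges H \<Longrightarrow> E \<subseteq> verts H" and r: "inj_on r (verts H)"
    and E: "E \<in> edges H" "E' \<in> edges H" "E \<inter> E' = {}" "E \<noteq> {}" "E' \<noteq> {}"
    and exact: "koszul_exact (verts H) r (\<lambda>_. 0) (single 0 ` (edge_ideal H :: ('v, 'k::field) mpoly set))
      1 (card (E \<union> E'))"
  shows "\<exists>G\<in>edges H. G \<subseteq> E \<union> E' \<and> \<not> E \<subseteq> G \<and> \<not> E' \<subseteq> G"
proof (rule ccontr)
  assume no: "\<not> ?thesis"
  let ?X = "verts H" and ?M = "single 0 ` (edge_ideal H :: ('v, 'k) mpoly set)"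
  define U where "U = E \<union> E'"
  obtain e e' where e: "e \<in> E" "e' \<in> E'" using E by blast
  have ne: "e \<noteq> e'" "e' \<notin> E" "e \<notin> E'" using e E(3) by auto
  have UX: "U \<subseteq> ?X" using H(2) E by (auto simp: U_def)
  have finU: "finite U" using UX H(1) by (rule finite_subset)
  have finE: "finite E" "finite E'" using finU by (auto simp: U_def)
  have iff: "w \<in> ?M \<longleftrightarrow>
      (\<forall>b m. lookup (lookup w b) m \<noteq> 0 \<longrightarrow> b = 0 \<and> keys m \<subseteq> ?X \<and> edge_div (edges H) m)" for w :: "('v, 'k) vec"
    by (rule single_edge_ideal_iff[OF H])
  define t :: "'v \<Rightarrow> ('v, 'k) vec" where "t = (\<lambda>v. single 0 (single (chi (U - {v})) 1))"
  have t_coeff: "lookup (lookup (t v) b) m = (if b = 0 \<and> m = chi (U - {v}) then 1 else 0)" for v b m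
    by (auto simp: t_def lookup_single when_def)
  have tM: "t v \<in> ?M" if "v = e \<or> v = e'" for v
    unfolding iff t_coeff using that ne e UX finU E(1,2)
    by (auto simp: keys_chi edge_div_def U_def)
  have th: "homog (\<lambda>_. 0) 1 (card U) (t v)" if "v \<in> U" for v
    unfolding homog_def t_coeff using that finU card.remove[OF finU that] by (auto simp: mdegree_chi)
  have vt: "var v \<odot> t v = single 0 (single (chi U) 1)" if "v \<in> U" for v
  proof -
    have "single v 1 + chi (U - {v}) = chi U" unfolding chi_def using sum.remove[OF finU that, of "\<lambda>v. single v (1::nat)"] by simp
    then show ?thesis by (simp add: t_def smul_single var_def mult_single)
  qed
  \<comment> \<open>the cycle \<open>e - e'\<close>; its value at a vertex \<open>v\<close> carries the monomial of \<open>U - {v}\<close>\<close>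
  define z where "z = (\<lambda>\<sigma>. if \<sigma> = {e} then t e else if \<sigma> = {e'} then - t e' else 0)"
  have M: "submodule ?X ?M" by (rule edge_ideal_homogeneous(1)[OF H])
  have zM: "z \<sigma> \<in> ?M" for \<sigma>
    using tM submodule_0[OF M] submodule_uminus[OF M tM[of e']] by (simp add: z_def)
  have zh: "homog (\<lambda>_. 0) 1 (card U) (z \<sigma>)" for \<sigma>
    using th e by (auto simp: z_def U_def intro: homog_uminus)
  have zc: "koszul_d ?X r z {} = 0"
  proof -
    have "koszul_d ?X r z {} = (\<Sum>v\<in>?X. var v \<odot> z {v})" by (simp add: koszul_d_def koszul_sign_def)
    also have "\<dots> = (\<Sum>v\<in>{e, e'}. var v \<odot> z {v})"
      using H(1) UX e by (intro sum.mono_neutral_right) (auto simp: z_def U_def)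
    also have "\<dots> = 0" using ne e by (simp add: z_def smul_uminus vt U_def)
    finally show ?thesis .
  qed
  obtain y where yM: "\<And>\<sigma>. \<sigma> \<subseteq> ?X \<Longrightarrow> card \<sigma> = Suc 1 \<Longrightarrow> y \<sigma> \<in> ?M"
    and y: "\<And>\<sigma>. \<sigma> \<subseteq> ?X \<Longrightarrow> card \<sigma> = 1 \<Longrightarrow> koszul_d ?X r y \<sigma> = z \<sigma>"
  proof (rule koszul_exactE[OF exact, of z])
    fix \<tau> :: "'v set" assume "\<tau> \<subseteq> ?X" "Suc (card \<tau>) = 1"
    then have "\<tau> = {}" using finite_subset[OF _ H(1)] by auto
    then show "koszul_d ?X r z \<tau> = 0" using zc by simp
  qed (use zM zh in \<open>auto simp: U_def\<close>)
  define f where "f = (\<lambda>\<rho>. lookup (lookup (y \<rho>) 0) (chi U - chi \<rho>))"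
  have minus: "chi U - chi \<rho> = chi (U - \<rho>)" if "\<rho> \<subseteq> U" for \<rho>
    using that finU finite_subset[OF that finU] by (intro poly_mapping_eqI) (auto simp: lookup_minus lookup_chi)
  have f0: "f {w, v} = 0" if "v \<in> E" "w \<in> E'" for v w
  proof (rule ccontr)
    assume "f {w, v} \<noteq> 0"
    moreover have vw: "{w, v} \<subseteq> U" "w \<noteq> v" using that E(3) by (auto simp: U_def)
    moreover have "y {w, v} \<in> ?M" using vw UX by (intro yM) auto
    ultimately have "edge_div (edges H) (chi (U - {w, v}))"
      unfolding iff f_def minus[OF vw(1)] by blast
    then obtain G where "G \<in> edges H" "G \<subseteq> U - {w, v}" using finU by (auto simp: edge_div_def keys_chi)
    then show False using no that unfolding U_def by blast
  qed
  have "lookup (lookup (z {v}) 0) (chi U - chi {v}) = (\<Sum>w\<in>E - {v}. koszul_sign r w {v} * f {w, v})" if v: "v \<in> E" for v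
  proof -
    have k: "keys (chi U) = U" by (rule keys_chi[OF finU])
    have vU: "{v} \<subseteq> U" using v by (simp add: U_def)
    then have "z {v} = koszul_d ?X r y {v}" using UX by (intro y[symmetric]) auto
    then have "lookup (lookup (z {v}) 0) (chi U - chi {v}) = scalar_d r U f {v}"
      using scalar_d_coefficients[OF H(1), of "chi U" "{v}" r y 0] UX vU unfolding k f_def by simp
    also have "\<dots> = (\<Sum>w\<in>E - {v}. koszul_sign r w {v} * f {w, v})"
      unfolding scalar_d_def using finU f0[OF v] by (intro sum.mono_neutral_right) (auto simp: U_def)
    finally show ?thesis .
  qed
  then have "(\<Sum>v\<in>E. lookup (lookup (z {v}) 0) (chi U - chi {v})) = (\<Sum>v\<in>E. \<Sum>w\<in>E - {v}. koszul_sign r w {v} * f {w, v})"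
    by simp
  also have "\<dots> = 0"
  proof (rule antisymmetric_double_sum[OF finE(1)])
    show "inj_on r E" using inj_on_subset[OF r H(2)] E(1) by blast
    fix v w assume vw: "v \<in> E" "w \<in> E" "v \<noteq> w"
    then have "r v \<noteq> r w" using \<open>inj_on r E\<close> by (auto dest: inj_onD)
    then have "koszul_sign r w {v} = (- koszul_sign r v {w} :: 'k)"
      using koszul_sign_insert[of "{}" v r w, where ?'b = 'k] koszul_sign_insert[of "{}" w r v, where ?'b = 'k]
      by (auto simp: koszul_sign_def)
    then show "koszul_sign r w {v} * f {w, v} = - (koszul_sign r v {w} * f {v, w})" by (simp add: insert_commute)
  qed
  finally have "(\<Sum>v\<in>E. lookup (lookup (z {v}) 0) (chi U - chi {v})) = 0" .
  moreover have "(\<Sum>v\<in>E. lookup (lookup (z {v}) 0) (chi U - chi {v})) = (\<Sum>v\<in>E. if v = e then 1 else 0)"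
  proof (rule sum.cong)
    fix v assume v: "v \<in> E"
    then have "v \<noteq> e'" "chi U - chi {v} = chi (U - {v})" using ne minus[of "{v}"] by (auto simp: U_def)
    then show "lookup (lookup (z {v}) 0) (chi U - chi {v}) = (if v = e then 1 else 0)"
      by (simp add: z_def t_coeff)
  qed simp
  ultimately show False using finE e by simp
qed

theorem corollary7p6:
  fixes H :: "'v hypergraph" and d :: nat and I :: "('v, 'k::field) mpoly set"
  assumes "simple_hypergraph H"
    and "uniform d H"
    and "properly_connected d H"
    and "triangulated d H"
    and "I = edge_ideal H"
  shows "(linear_resolution d (verts H) I \<longleftrightarrow> linear_first_syzygies d (verts H) I) \<and>
         (linear_first_syzygies d (verts H) I \<longleftrightarrow> edge_diam d H \<le> enat d)"
proof -
  let ?X = "verts H"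
  have fin: "finite ?X" and sub: "\<And>E. E \<in> edges H \<Longrightarrow> E \<subseteq> ?X"
    and two: "\<And>E. E \<in> edges H \<Longrightarrow> 2 \<le> card E"
    using assms(1) by (auto simp: simple_hypergraph_def)
  have edge: "finite E \<and> card E = d \<and> E \<subseteq> ?X" if "E \<in> edges H" for E
    using assms(2) that sub[OF that] fin by (auto simp: uniform_def intro: finite_subset)
  have d2: "2 \<le> d" if "E \<in> edges H" for E using two[OF that] edge[OF that] by simp
  have diff: "card (E - E') = d - card (E \<inter> E')" if "E \<in> edges H" for E E'
    using edge[OF that] by (simp add: card_Diff_subset_Int)
  have dist: "edge_dist d H E E' = enat (card (E - E'))" if "E \<in> edges H" "E' \<in> edges H" "E \<inter> E' \<noteq> {}" for E E'
    using assms(3) that diff[OF that(1)] by (simp add: properly_connected_def)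
  obtain r :: "'v \<Rightarrow> nat" where r: "inj_on r ?X" using finite_imp_inj_to_nat_seg[OF fin] by blast
  have betti: "graded_betti ?X I i j = 0 \<longleftrightarrow> koszul_exact ?X r (\<lambda>_. 0) (single 0 ` I) i j" for i j
    using graded_betti_eq_0_iff[OF fin r edge_ideal_homogeneous[OF fin sub]] assms(5) by simp
  have ab: "linear_first_syzygies d ?X I" if "linear_resolution d ?X I"
    using that unfolding linear_resolution_def linear_first_syzygies_def by (metis add.commute)
  have ca: "linear_resolution d ?X I" if diam: "edge_diam d H \<le> enat d"
  proof -
    have "\<exists>y\<in>E' - E. \<exists>z\<in>E. insert y (E - {z}) \<in> edges H"
      if E: "E \<in> edges H" "E' \<in> edges H" "E \<noteq> E'" for E E'
    proof -
      have "edge_dist d H E' E \<le> enat (card (E' - E))"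
      proof (cases "E' \<inter> E = {}")
        case True
        have "edge_dist d H E' E \<le> edge_diam d H"
          unfolding edge_diam_def using E by (intro SUP_upper2[of "(E', E)"]) auto
        also have "\<dots> \<le> enat (card (E' - E))" using diam diff[OF E(2), of E] True by simp
        finally show ?thesis .
      next
        case False
        then show ?thesis using dist[OF E(2,1)] by simp
      qed
      then obtain P n where "edge_path d H P n" "P 0 = E'" "P n = E" "n \<le> card (E' - E)"
        by (rule edge_dist_path)
      then show ?thesis using exchange_of_path[of d H P n] edge d2[OF E(1)] E(3) by force
    qed
    then have "linear_quotients d (edges H)"
      by (intro triangulated_linear_quotients[OF assms(1,2,4)]) auto
    then show ?thesis
      unfolding linear_resolution_def betti unfolding assms(5)
      using linear_quotients_koszul_exact[OF fin sub r] by blast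
  qed
  have bc: "edge_diam d H \<le> enat d" if linear: "linear_first_syzygies d ?X I"
    unfolding edge_diam_def
  proof (rule SUP_least, clarify)
    fix E E' assume E: "E \<in> edges H" "E' \<in> edges H"
    show "edge_dist d H E E' \<le> enat d"
    proof (cases "E \<inter> E' = {}")
      case False
      then show ?thesis using dist[OF E] diff[OF E(1)] by simp
    next
      case True
      have ne: "E \<noteq> {}" "E' \<noteq> {}" using two[OF E(1)] two[OF E(2)] by auto
      have "card (E \<union> E') = 2 * d" using edge[OF E(1)] edge[OF E(2)] True by (simp add: card_Un_disjoint)
      then have "card (E \<union> E') \<noteq> d + 1" using d2[OF E(1)] by simp
      then have "koszul_exact ?X r (\<lambda>_. 0) (single 0 ` I) 1 (card (E \<union> E'))"
        using linear unfolding linear_first_syzygies_def betti by blast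
      then obtain G where G: "G \<in> edges H" "G \<subseteq> E \<union> E'" "\<not> E \<subseteq> G" "\<not> E' \<subseteq> G"
        using linear_syzygies_connect[OF fin sub r E True ne, where ?'k = 'k] unfolding assms(5) by blast
      have fG: "finite G" "card G = d" and fE: "finite E" "finite E'" "card E = d" "card E' = d"
        using edge G(1) E by auto
      have EG: "E \<inter> G \<noteq> {}"
      proof
        assume "E \<inter> G = {}"
        then have "G \<subseteq> E'" using G(2) by blast
        then have "G = E'" using fG fE by (intro card_subset_eq) auto
        then show False using G(4) by blast
      qed
      have GE': "G \<inter> E' \<noteq> {}"
      proof
        assume "G \<inter> E' = {}"
        then have "G \<subseteq> E" using G(2) by blast
        then have "G = E" using fG fE by (intro card_subset_eq) auto
        then show False using G(3) by blast
      qed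
      obtain P m where P: "edge_path d H P m" "P 0 = E" "P m = G" "m \<le> card (E - G)"
        using dist[OF E(1) G(1) EG] by (metis edge_dist_path order_refl)
      obtain Q n where Q: "edge_path d H Q n" "Q 0 = G" "Q n = E'" "n \<le> card (G - E')"
        using dist[OF G(1) E(2) GE'] by (metis edge_dist_path order_refl)
      have "G - E' = E \<inter> G" using G(2) True by blast
      moreover have "card (E \<inter> G) \<le> d" using fE card_mono[of E "E \<inter> G"] by simp
      ultimately have mn: "m + n \<le> d" using P(4) Q(4) diff[OF E(1), of G] by simp
      define R where "R = (\<lambda>i. if i \<le> m then P i else Q (i - m))"
      have R: "edge_path d H R (m + n)"
        unfolding R_def using P(3) Q(2) by (intro edge_path_append[OF P(1) Q(1)]) simp
      have ends: "R 0 = E" "R (m + n) = E'" using P Q by (auto simp: R_def)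
      have "m + n \<le> card (R 0 - R (m + n))" using mn True diff[OF E(1), of E'] by (simp add: ends)
      from edge_dist_le_of_path[OF R this edge d2[OF E(1)]]
      have "edge_dist d H E E' \<le> enat (m + n)" by (simp add: ends)
      also have "\<dots> \<le> enat d" using mn by simp
      finally show ?thesis .
    qed
  qed
  show ?thesis using ab ca bc by blast
qed

end
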